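(* Let $m=m(n)$ be positive integers, let $d=d(n)\in(0,m]$, put $p=d/m$, and let $H=H(n)$ be drawn either from $\mathcal{H}(n,m,d)$ (in which case $d$ is a positive integer) or from $\mathbb{H}(n,m,p)$. Assume that $p=d/m$ is bounded away from $1$ (i.e. $p\le1-\varepsilon_0$ for some constant $\varepsilon_0>0$). If $m\gg n$ and $d=pm\ge(m/n)^{1+\varepsilon}$ for some constant $\varepsilon>0$, then with high probability $$\operatorname{disc}(H)=\Theta\left(\sqrt{\frac{dn}{m}\log\left(\frac{m}{n}\right)}\right),$$ i.e. there are constants $0<c<C$ (not depending on $n$) such that $$\mathbb{P}\left[c\sqrt{\tfrac{dn}{m}\log(\tfrac mn)}\le\operatorname{disc}(H)\le C\sqrt{\tfrac{dn}{m}\log(\tfrac mn)}\right]\to1\quad\text{as }n\to\infty.$$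
   Context: A hypergraph $H=(V,E)$ consists of a vertex set $V=\{v_1,\dots,v_n\}$ and a multiset $E=\{e_1,\dots,e_m\}$ of subsets of $V$ (edges; repetitions allowed). A colouring is a function $\psi:V\to\{-1,1\}$; for an edge $e$ put $\psi(e)=\sum_{v\in e}\psi(v)$, and $\operatorname{disc}(\psi)=\max_{e\in E}|\psi(e)|$. The discrepancy of $H$ is $\operatorname{disc}(H)=\min_\psi\operatorname{disc}(\psi)$, the minimum being over all colourings. Edge-independent model $\mathbb{H}(n,m,p)$: the random hypergraph with vertices $v_1,\dots,v_n$ and edges $e_1,\dots,e_m$ in which each vertex $v_j$ is placed in each edge $e_i$ independently with probability $p$ (all $mn$ choices independent). Edge-dependent model $\mathcal{H}(n,m,d)$: for each vertex $v\in\{v_1,\dots,v_n\}$, independently draw a uniformly random subset $I_v\subseteq\{1,\dots,m\}$ with $|I_v|=d$, and define the edges by $e_i=\{u\in V: i\in I_u\}$ for $1\le i\le m$. All asymptotics are as $n\to\infty$; $m\gg n$ means $n/m\to0$; $\log$ is the natural logarithm. An event holds with high probability if its probability tends to $1$ as $n\to\infty$. *)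

theory Defs
  imports "HOL-Probability.Probability"
begin

text \<open>Edges form a multiset, so repeated edges are kept.\<close>
type_synonym 'a hypergraph = "'a set \<times> 'a set multiset"

definition colourings :: "'a set \<Rightarrow> ('a \<Rightarrow> int) set" where
  "colourings V = V \<rightarrow>\<^sub>E {-1, 1}"

text \<open>The maximum is only meaningful for a nonempty multiset of edges.\<close>
definition disc_colouring :: "'a set multiset \<Rightarrow> ('a \<Rightarrow> int) \<Rightarrow> int" where
  "disc_colouring E \<psi> = Max ((\<lambda>e. \<bar>\<Sum>v\<in>e. \<psi> v\<bar>) ` set_mset E)"

definition disc :: "'a hypergraph \<Rightarrow> int" where
  "disc H = Min (disc_colouring (snd H) ` colourings (fst H))"

text \<open>\<open>e i\<close> is the edge with label \<open>i\<close>; distinct labels may carry equal edges.\<close>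
definition hypergraph_of :: "nat \<Rightarrow> nat \<Rightarrow> (nat \<Rightarrow> nat set) \<Rightarrow> nat hypergraph" where
  "hypergraph_of n m e = ({1..n}, image_mset e (mset_set {1..m}))"

text \<open>Here \<open>X (j, i)\<close> says that vertex \<open>j\<close> is placed in edge \<open>i\<close>. The library's
  \<open>bernoulli_pmf\<close> truncates its parameter to the unit interval, so \<open>0 \<le> p \<le> 1\<close> is intended.\<close>
definition edge_independent :: "nat \<Rightarrow> nat \<Rightarrow> real \<Rightarrow> nat hypergraph pmf" where
  "edge_independent n m p =
     map_pmf (\<lambda>X. hypergraph_of n m (\<lambda>i. {j \<in> {1..n}. X (j, i)}))
       (Pi_pmf ({1..n} \<times> {1..m}) False (\<lambda>_. bernoulli_pmf p))"

text \<open>Here \<open>I u\<close> is the set of labels of the edges containing vertex \<open>u\<close>. Only \<open>d \<le> m\<close> is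
  intended: otherwise there is no set to draw and \<open>pmf_of_set\<close> is unspecified.\<close>
definition edge_dependent :: "nat \<Rightarrow> nat \<Rightarrow> nat \<Rightarrow> nat hypergraph pmf" where
  "edge_dependent n m d =
     map_pmf (\<lambda>I. hypergraph_of n m (\<lambda>i. {u \<in> {1..n}. i \<in> I u}))
       (Pi_pmf {1..n} {} (\<lambda>_. pmf_of_set {S. S \<subseteq> {1..m} \<and> card S = d}))"

end

theory Submission
  imports Defs
begin

text \<open>Write \<open>\<lambda> = m / n\<close>, \<open>p = d / m\<close> and \<open>\<mu> = p n\<close>, the mean size of an edge. The hypothesis
on \<open>d\<close> says that \<open>\<mu> \<ge> \<lambda> powr \<epsilon>\<close>, so \<open>\<mu>\<close> eventually exceeds every multiple of \<open>ln \<lambda>\<close>, and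
the claim is that the discrepancy is of order \<open>\<tau> = sqrt (\<mu> ln \<lambda>)\<close>.

The lower bound is a first moment argument. Cut the vertex set into about \<open>ln \<lambda> / 10\<close> blocks of
equal variance. In each block a signed sum of Bernoulli variables exceeds its mean by a constant
number of standard deviations with constant probability, and if this happens in all blocks at
once the value of the edge is at least of order \<open>\<tau>\<close>; so a fixed colouring gives a fixed edge such a value with
probability at least \<open>\<lambda> powr (- 1/2)\<close> (\<open>anticoncentration_log_scale\<close>). All \<open>m\<close> edges fail with
probability at most \<open>exp (- m / sqrt \<lambda>) = exp (- n sqrt \<lambda>)\<close>, which beats the number \<open>2 ^ n\<close> of
colourings. In the edge-dependent model the edges are not independent, so they are exposed one by one
(\<open>uniform_subsets_exposure\<close>): given the earlier edges, the vertices join the next edge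
independently of each other. As long as only a small fraction of the edges is exposed, the
conditional probabilities stay away from \<open>1\<close>, and they add up to at least \<open>\<mu> / 2\<close> unless the exposed
edges are abnormally large, which is unlikely. Hence the same estimate applies to a constant
fraction of the edges.

The upper bound uses the entropy method: by pigeonhole two colourings of a set \<open>U\<close> agree up to
rounding on all edges and differ on a tenth of \<open>U\<close>, and half their difference is a partial colouring
(\<open>partial_colouring\<close>). This is iterated on the uncoloured part. The difficulty is that the uncoloured
set depends on the hypergraph, so that its intersection with some edges may be far larger than
expected. The lemma \<open>spread_prob_some_large_traces_le\<close> controls all vertex sets \<open>U\<close> at the same time:
with high probability the edges that meet \<open>U\<close> in more than
\<open>max \<tau> (exp 3 * \<mu> * sqrt (card U / n))\<close> vertices meet it in at most \<open>8 * card U\<close> vertices altogether.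
There are so few of them that they can be balanced exactly, while the other edges pay an amount
that decreases geometrically from round to round and adds up to \<open>O(\<tau>)\<close>. When \<open>\<tau>\<close> is the
larger term of the maximum, an edge that meets \<open>U\<close> in at most \<open>\<tau>\<close> vertices needs no further attention,
because the vertices left in it cannot contribute more than \<open>\<tau>\<close>.

Both models enter the upper bound only through the inequality
\<open>P(v \<in> e i for all (v, i) in S) \<le> p ^ card S\<close>, called \<open>spread\<close> below.\<close>


section \<open>Counting colourings and exponential moments\<close>

lemma cosh_le_exp_half_square:
  fixes t :: real
  assumes "t \<ge> 0"
  shows "exp t + exp (- t) \<le> 2 * exp (t\<^sup>2 / 2)"
proof -
  have "- (2 * t) * (1/2) + ln (1 + (1/2) * (exp (2 * t) - 1)) \<le> (2 * t)\<^sup>2 / 8"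
    by (rule Hoeffdings_lemma_aux) (use assms in auto)
  hence "ln ((1 + exp (2 * t)) / 2) \<le> t\<^sup>2 / 2 + t"
    by (simp add: field_simps power2_eq_square)
  hence "(1 + exp (2 * t)) / 2 \<le> exp (t\<^sup>2 / 2 + t)"
    by (metis add_pos_pos divide_pos_pos exp_gt_zero exp_le_cancel_iff exp_ln zero_less_numeral zero_less_one)
  hence "exp (- t) * ((1 + exp (2 * t)) / 2) \<le> exp (- t) * exp (t\<^sup>2 / 2 + t)"
    by (intro mult_left_mono) auto
  also have "exp (- t) * ((1 + exp (2 * t)) / 2) = (exp t + exp (- t)) / 2"
    by (simp add: field_simps flip: exp_add)
  also have "exp (- t) * exp (t\<^sup>2 / 2 + t) = exp (t\<^sup>2 / 2)"
    by (simp flip: exp_add)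
  finally show ?thesis by simp
qed

lemma finite_colourings: "finite U \<Longrightarrow> finite (colourings U)"
  unfolding colourings_def by (intro finite_PiE) auto

lemma card_colourings: "finite U \<Longrightarrow> card (colourings U) = 2 ^ card U"
  unfolding colourings_def by (subst card_PiE) (auto simp: numeral_2_eq_2)

lemma sum_colourings_prod:
  fixes g :: "'a \<Rightarrow> int \<Rightarrow> real"
  assumes "finite U"
  shows "(\<Sum>\<psi>\<in>colourings U. \<Prod>v\<in>U. g v (\<psi> v)) = (\<Prod>v\<in>U. g v 1 + g v (- 1))"
proof -
  have "(\<Prod>v\<in>U. g v 1 + g v (- 1)) = (\<Prod>v\<in>U. \<Sum>z\<in>{-1,1::int}. g v z)"
    by (simp add: add.commute)
  also have "\<dots> = (\<Sum>\<psi>\<in>colourings U. \<Prod>v\<in>U. g v (\<psi> v))"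
    unfolding colourings_def by (rule prod_sum_PiE) (use assms in auto)
  finally show ?thesis by simp
qed

text \<open>The unnormalised moment generating function of the value that a uniformly random colouring gives
to \<open>A\<close>; the sign \<open>s\<close> allows both tails to be treated at once.\<close>

lemma sum_colourings_exp_le:
  fixes \<theta> :: real
  assumes "finite U" "A \<subseteq> U" "\<theta> \<ge> 0" "s = 1 \<or> s = - 1" 
  shows "(\<Sum>\<psi>\<in>colourings U. exp (\<theta> * (s * real_of_int (\<Sum>v\<in>A. \<psi> v))))
     \<le> 2 ^ card U * exp (\<theta>\<^sup>2 / 2 * card A)"
proof -
  have [simp]: "finite A" using assms finite_subset by blast
  define g where "g = (\<lambda>v z. if v \<in> A then exp (\<theta> * s * real_of_int z) else (1::real))"
  have "exp (\<theta> * (s * real_of_int (\<Sum>v\<in>A. \<psi> v))) = (\<Prod>v\<in>U. g v (\<psi> v))" for \<psi>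
  proof -
    have "(\<Prod>v\<in>U. g v (\<psi> v)) = (\<Prod>v\<in>A. exp (\<theta> * s * real_of_int (\<psi> v)))"
      unfolding g_def using assms by (simp add: prod.If_cases Int_absorb1)
    also have "\<dots> = exp (\<Sum>v\<in>A. \<theta> * s * real_of_int (\<psi> v))"
      by (simp add: exp_sum)
    also have "(\<Sum>v\<in>A. \<theta> * s * real_of_int (\<psi> v)) = \<theta> * (s * real_of_int (\<Sum>v\<in>A. \<psi> v))"
      by (simp add: sum_distrib_left mult.assoc)
    finally show ?thesis by simp
  qed
  hence "(\<Sum>\<psi>\<in>colourings U. exp (\<theta> * (s * real_of_int (\<Sum>v\<in>A. \<psi> v)))) =
     (\<Prod>v\<in>U. g v 1 + g v (- 1))"
    using sum_colourings_prod[OF \<open>finite U\<close>, of g] by simp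
  also have "\<dots> \<le> (\<Prod>v\<in>U. 2 * (if v \<in> A then exp (\<theta>\<^sup>2 / 2) else 1))"
    using cosh_le_exp_half_square[OF \<open>\<theta> \<ge> 0\<close>] assms(4)
    by (intro prod_mono) (auto simp: g_def add.commute)
  also have "\<dots> = 2 ^ card U * exp (\<theta>\<^sup>2 / 2) ^ card A"
    using assms by (simp add: prod.distrib prod.If_cases Int_absorb1)
  also have "exp (\<theta>\<^sup>2 / 2) ^ card A = exp (\<theta>\<^sup>2 / 2 * card A)"
    by (metis exp_of_nat_mult mult.commute)
  finally show ?thesis .
qed

lemma colouring_sum_values:
  assumes "finite A" "\<psi> \<in> A \<rightarrow> {-1, 1::int}"
  shows "(\<Sum>v\<in>A. \<psi> v) \<in> (\<lambda>k. int (card A) - 2 * int k) ` {..card A}"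
proof -
  let ?N = "{v\<in>A. \<psi> v = -1}"
  have "(\<Sum>v\<in>A. \<psi> v) = (\<Sum>v\<in>A. 1 - 2 * (if \<psi> v = -1 then 1 else 0))"
    using assms by (intro sum.cong) auto
  also have "\<dots> = int (card A) - 2 * int (card ?N)"
    using assms(1) by (simp add: sum_subtractf sum.If_cases Collect_conj_eq flip: sum_distrib_left)
  finally show ?thesis
    using card_mono[OF \<open>finite A\<close>, of ?N] by blast
qed

lemma half_difference_partial_colouring:
  assumes "finite U" "\<psi> \<in> colourings U" "\<psi>' \<in> colourings U"
  defines "x \<equiv> \<lambda>v. (\<psi> v - \<psi>' v) div 2"
  shows "v \<in> U \<Longrightarrow> x v \<in> {-1, 0, 1}"
    and "v \<in> U \<Longrightarrow> x v = 0 \<longleftrightarrow> \<psi> v = \<psi>' v"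
    and "A \<subseteq> U \<Longrightarrow> 2 * (\<Sum>v\<in>A. x v) = (\<Sum>v\<in>A. \<psi> v) - (\<Sum>v\<in>A. \<psi>' v)"
proof -
  have 1: "\<psi> v \<in> {-1, 1}" "\<psi>' v \<in> {-1, 1}" if "v \<in> U" for v
    using assms that by (auto simp: colourings_def PiE_def Pi_def)
  show "v \<in> U \<Longrightarrow> x v \<in> {-1, 0, 1}" "v \<in> U \<Longrightarrow> x v = 0 \<longleftrightarrow> \<psi> v = \<psi>' v"
    using 1[of v] by (auto simp: x_def)
  have "2 * x v = \<psi> v - \<psi>' v" if "v \<in> U" for v
    using 1[OF that] by (auto simp: x_def)
  thus "2 * (\<Sum>v\<in>A. x v) = (\<Sum>v\<in>A. \<psi> v) - (\<Sum>v\<in>A. \<psi>' v)" if "A \<subseteq> U"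
    using that by (subst sum_distrib_left, subst sum_subtractf[symmetric]) (intro sum.cong, auto)
qed

section \<open>The entropy method\<close>

definition edge_sums :: "'i set \<Rightarrow> ('i \<Rightarrow> 'a set) \<Rightarrow> ('a \<Rightarrow> int) \<Rightarrow> 'i \<Rightarrow> int" where
  "edge_sums B f \<psi> = (\<lambda>i\<in>B. \<Sum>v\<in>f i. \<psi> v)"

lemma card_edge_sums_le:
  assumes "finite U" "finite B" "\<And>i. i \<in> B \<Longrightarrow> f i \<subseteq> U" "C \<subseteq> colourings U"
  shows "finite (edge_sums B f ` C)" "card (edge_sums B f ` C) \<le> (\<Prod>i\<in>B. card (f i) + 1)"
proof -
  define V where "V = (\<lambda>i. (\<lambda>k. int (card (f i)) - 2 * int k) ` {..card (f i)})"
  have sub: "edge_sums B f ` C \<subseteq> PiE B V"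
  proof (rule subsetI, elim imageE, simp only:)
    fix \<psi> assume "\<psi> \<in> C"
    hence \<psi>: "\<psi> \<in> U \<rightarrow> {-1, 1}" using assms by (auto simp: colourings_def PiE_def)
    show "edge_sums B f \<psi> \<in> PiE B V"
      unfolding edge_sums_def V_def
    proof (intro restrict_PiE_iff[THEN iffD2] ballI)
      fix i assume "i \<in> B"
      thus "(\<Sum>v\<in>f i. \<psi> v) \<in> (\<lambda>k. int (card (f i)) - 2 * int k) ` {..card (f i)}"
        using assms \<psi> finite_subset[OF assms(3)[OF \<open>i \<in> B\<close>]] 
        by (intro colouring_sum_values) (auto simp: Pi_def)
    qed
  qed
  have fin: "finite (PiE B V)" using assms by (intro finite_PiE) (auto simp: V_def)
  show "finite (edge_sums B f ` C)" using sub fin finite_subset by blast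
  have "card (edge_sums B f ` C) \<le> card (PiE B V)" by (rule card_mono[OF fin sub])
  also have "\<dots> = (\<Prod>i\<in>B. card (V i))" using assms by (simp add: card_PiE)
  also have "\<dots> \<le> (\<Prod>i\<in>B. card (f i) + 1)"
    by (intro prod_mono) (auto simp: V_def intro: order.trans[OF card_image_le])
  finally show "card (edge_sums B f ` C) \<le> (\<Prod>i\<in>B. card (f i) + 1)" .
qed

text \<open>If the edges admit fewer vectors of values than there are colourings, two colourings have equal
values on all edges, and half their difference vanishes on each edge.\<close>

lemma exact_partial_colouring:
  assumes "finite U" "finite B" "\<And>i. i \<in> B \<Longrightarrow> f i \<subseteq> U" 
    and "(\<Prod>i\<in>B. card (f i) + 1) < 2 ^ card U"
  obtains x :: "'a \<Rightarrow> int" where "\<And>v. v \<in> U \<Longrightarrow> x v \<in> {-1, 0, 1}" "\<exists>v\<in>U. x v \<noteq> 0"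
    "\<And>i. i \<in> B \<Longrightarrow> (\<Sum>v\<in>f i. x v) = 0"
proof -
  have "card (edge_sums B f ` colourings U) < card (colourings U)"
    using card_edge_sums_le(2)[of U B f "colourings U"] assms by (simp add: card_colourings)
  hence "\<not> inj_on (edge_sums B f) (colourings U)"
    by (rule pigeonhole)
  then obtain \<psi> \<psi>' where \<psi>: "\<psi> \<in> colourings U" "\<psi>' \<in> colourings U" "\<psi> \<noteq> \<psi>'"
    "edge_sums B f \<psi> = edge_sums B f \<psi>'"
    by (auto simp: inj_on_def)
  note half = half_difference_partial_colouring[OF \<open>finite U\<close> \<psi>(1,2)]
  obtain v where "v \<in> U" "\<psi> v \<noteq> \<psi>' v"
    using \<psi>(1-3) unfolding colourings_def by (meson PiE_ext)
  show ?thesis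
  proof (rule that[of "\<lambda>v. (\<psi> v - \<psi>' v) div 2"])
    fix i assume i: "i \<in> B"
    have "(\<Sum>v\<in>f i. \<psi> v) = (\<Sum>v\<in>f i. \<psi>' v)"
      using fun_cong[OF \<psi>(4), of i] i by (simp add: edge_sums_def)
    thus "(\<Sum>v\<in>f i. (\<psi> v - \<psi>' v) div 2) = 0"
      using half(3)[OF assms(3)[OF i]] by simp
  qed (use half \<open>v \<in> U\<close> \<open>\<psi> v \<noteq> \<psi>' v\<close> in blast)+
qed

text \<open>Chernoff's argument with weight \<open>1/9\<close> per disagreement: this weight is optimal for radius
\<open>card U / 10\<close>.\<close>

lemma hamming_ball_card:
  assumes "finite U" "\<psi> \<in> colourings U"
  shows "card {\<psi>'\<in>colourings U. 10 * card {v\<in>U. \<psi>' v \<noteq> \<psi> v} \<le> card U}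
     \<le> (9 powr (1/10) * (10/9)) ^ card U"
proof -
  let ?D = "\<lambda>\<psi>'. {v\<in>U. \<psi>' v \<noteq> \<psi> v}"
  let ?K = "{\<psi>'\<in>colourings U. 10 * card (?D \<psi>') \<le> card U}"
  let ?u = "card U"
  define g where "g = (\<lambda>v z. if z \<noteq> \<psi> v then 1/9 else (1::real))"
  have \<psi>: "\<psi> v = 1 \<or> \<psi> v = -1" if "v \<in> U" for v
    using assms that by (auto simp: colourings_def PiE_def Pi_def)
  have "real (card ?K) * (1/9) powr (?u / 10) = (\<Sum>\<psi>'\<in>?K. (1/9) powr (?u / 10))"
    by simp
  also have "\<dots> \<le> (\<Sum>\<psi>'\<in>?K. \<Prod>v\<in>U. g v (\<psi>' v))"
  proof (rule sum_mono)
    fix \<psi>' assume "\<psi>' \<in> ?K"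
    hence le: "real (card (?D \<psi>')) \<le> ?u / 10" by simp
    have "(\<Prod>v\<in>U. g v (\<psi>' v)) = (1/9) ^ card (?D \<psi>')"
      unfolding g_def using \<open>finite U\<close> by (simp add: prod.If_cases Collect_conj_eq)
    also have "\<dots> = (1/9) powr real (card (?D \<psi>'))" by (simp add: powr_realpow)
    also have "\<dots> \<ge> (1/9) powr (?u / 10)" using le by (intro powr_mono') auto
    finally show "(1/9) powr (?u / 10) \<le> (\<Prod>v\<in>U. g v (\<psi>' v))" .
  qed
  also have "\<dots> \<le> (\<Sum>\<psi>'\<in>colourings U. \<Prod>v\<in>U. g v (\<psi>' v))"
    using assms by (intro sum_mono2 finite_colourings prod_nonneg) (auto simp: g_def)
  also have "\<dots> = (\<Prod>v\<in>U. g v 1 + g v (- 1))" by (rule sum_colourings_prod[OF assms(1)])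
  also have "\<dots> = (\<Prod>v\<in>U. 10/9)" using \<psi> by (intro prod.cong) (fastforce simp: g_def)+
  finally have "real (card ?K) * (1/9) powr (?u / 10) \<le> (10/9) ^ ?u" by simp
  hence "real (card ?K) * (1/9) powr (?u / 10) * 9 powr (?u / 10) \<le> (10/9) ^ ?u * 9 powr (?u / 10)"
    by (intro mult_right_mono) auto
  also have "real (card ?K) * (1/9) powr (?u / 10) * 9 powr (?u / 10) = real (card ?K)"
    by (simp add: mult.assoc flip: powr_mult)
  also have "9 powr (?u / 10) = (9 powr (1/10)) ^ ?u"
    by (simp add: powr_powr flip: powr_realpow)
  finally show ?thesis by (simp only: power_mult_distrib mult.commute)
qed

lemma sum_power_abs_le:
  fixes x :: real
  assumes "0 \<le> x" "x \<le> 1/2"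
  shows "(\<Sum>z\<in>{- int N..int N}. x ^ nat \<bar>z\<bar>) \<le> 1 + 4 * x"
proof -
  have "(\<Sum>z\<in>{- int N..int N}. x ^ nat \<bar>z\<bar>) \<le> 1 + 4 * x - 4 * x ^ Suc N"
  proof (induction N)
    case (Suc N)
    have "{- int (Suc N)..int (Suc N)} = {- int N..int N} \<union> {int (Suc N), - int (Suc N)}"
      by auto
    hence "(\<Sum>z\<in>{- int (Suc N)..int (Suc N)}. x ^ nat \<bar>z\<bar>) =
       (\<Sum>z\<in>{- int N..int N}. x ^ nat \<bar>z\<bar>) + 2 * x ^ Suc N"
      by (simp add: sum.union_disjoint nat_add_distrib)
    also have "\<dots> \<le> 1 + 4 * x - 4 * x ^ Suc N + 2 * x ^ Suc N"
      using Suc by simp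
    also have "x ^ Suc (Suc N) \<le> x ^ Suc N * (1/2)"
      using assms by (subst power_Suc2) (intro mult_left_mono, auto)
    hence "1 + 4 * x - 4 * x ^ Suc N + 2 * x ^ Suc N \<le> 1 + 4 * x - 4 * x ^ Suc (Suc N)"
      by linarith
    finally show ?case .
  qed simp
  also have "\<dots> \<le> 1 + 4 * x" using assms by simp
  finally show ?thesis .
qed

text \<open>Rankin's trick: every counted vector has weight \<open>exp (\<kappa> (L - norm)) \<ge> 1\<close>, and the sum of these
weights over all integer vectors factorises over the coordinates.\<close>

lemma card_small_l1_norm_le:
  fixes \<kappa> L :: real
  assumes "finite G" "exp (- \<kappa>) \<le> 1/2" "S \<subseteq> {b \<in> extensional G. (\<Sum>i\<in>G. \<bar>real_of_int (b i)\<bar>) \<le> L}"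
  shows "finite S" "card S \<le> exp (\<kappa> * L) * (1 + 4 * exp (- \<kappa>)) ^ card G"
proof -
  have "\<kappa> \<ge> 0" using assms(2) 
    by (smt (verit) exp_le_one_iff field_sum_of_halves)
  define N where "N = nat \<lceil>L\<rceil>"
  have N: "\<bar>b i\<bar> \<le> int N" if "b \<in> S" "i \<in> G" for b i
  proof -
    have "\<bar>real_of_int (b i)\<bar> \<le> (\<Sum>i\<in>G. \<bar>real_of_int (b i)\<bar>)"
      using assms(1) that by (intro member_le_sum) auto
    also have "\<dots> \<le> L" using that assms by auto
    finally show ?thesis unfolding N_def by linarith
  qed
  let ?P = "PiE G (\<lambda>_. {- int N..int N})"
  have "S \<subseteq> ?P"
    using assms(3) N by (force simp: PiE_def Pi_def)
  moreover have "finite ?P" using assms by (intro finite_PiE) auto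
  ultimately show "finite S" using finite_subset by blast
  have "real (card S) = (\<Sum>b\<in>S. 1)" by simp
  also have "\<dots> \<le> (\<Sum>b\<in>S. exp (\<kappa> * L) * (\<Prod>i\<in>G. exp (- \<kappa>) ^ nat \<bar>b i\<bar>))"
  proof (rule sum_mono)
    fix b assume "b \<in> S"
    have "(\<Prod>i\<in>G. exp (- \<kappa>) ^ nat \<bar>b i\<bar>) = exp (\<Sum>i\<in>G. - \<kappa> * \<bar>real_of_int (b i)\<bar>)"
      using assms(1) by (simp add: exp_sum mult.commute flip: exp_of_nat_mult)
    also have "(\<Sum>i\<in>G. - \<kappa> * \<bar>real_of_int (b i)\<bar>) = - \<kappa> * (\<Sum>i\<in>G. \<bar>real_of_int (b i)\<bar>)"
      by (rule sum_distrib_left[symmetric])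
    finally have "exp (\<kappa> * L) * (\<Prod>i\<in>G. exp (- \<kappa>) ^ nat \<bar>b i\<bar>) = 
        exp (\<kappa> * (L - (\<Sum>i\<in>G. \<bar>real_of_int (b i)\<bar>)))"
      by (simp add: algebra_simps flip: exp_add)
    moreover have "\<kappa> * (L - (\<Sum>i\<in>G. \<bar>real_of_int (b i)\<bar>)) \<ge> 0"
      using \<open>b \<in> S\<close> assms(3) \<open>\<kappa> \<ge> 0\<close> by (intro mult_nonneg_nonneg) auto
    ultimately show "1 \<le> exp (\<kappa> * L) * (\<Prod>i\<in>G. exp (- \<kappa>) ^ nat \<bar>b i\<bar>)" by simp
  qed
  also have "\<dots> \<le> (\<Sum>b\<in>?P. exp (\<kappa> * L) * (\<Prod>i\<in>G. exp (- \<kappa>) ^ nat \<bar>b i\<bar>))"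
    using \<open>S \<subseteq> ?P\<close> \<open>finite ?P\<close> by (intro sum_mono2) (auto intro!: mult_nonneg_nonneg prod_nonneg)
  also have "\<dots> = exp (\<kappa> * L) * (\<Prod>i\<in>G. \<Sum>z\<in>{- int N..int N}. exp (- \<kappa>) ^ nat \<bar>z\<bar>)"
    using assms(1) by (subst prod_sum_PiE) (auto simp: sum_distrib_left)
  also have "\<dots> \<le> exp (\<kappa> * L) * (\<Prod>i\<in>G. 1 + 4 * exp (- \<kappa>))"
    using assms(2) by (intro mult_left_mono prod_mono conjI sum_nonneg sum_power_abs_le) auto
  finally show "card S \<le> exp (\<kappa> * L) * (1 + 4 * exp (- \<kappa>)) ^ card G" by simp
qed

text \<open>A rounded value is nonzero only if \<open>\<bar>y\<bar> \<ge> \<Delta> / 2\<close>, and then it is at most \<open>z = 2 \<bar>y\<bar> / \<Delta>\<close>. Since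
\<open>z \<le> exp (a (z - 1))\<close> for \<open>z \<ge> 1\<close>, it is dominated by a multiple of an exponential in \<open>y\<close> and another one in \<open>- y\<close>,
whose means over random colourings are known.\<close>

lemma rounded_abs_le:
  fixes y \<Delta> a :: real
  assumes "\<Delta> > 0" "a \<ge> 1"
  shows "\<bar>real_of_int (round (y / \<Delta>))\<bar> \<le> exp (- a) * (exp (2 * a / \<Delta> * y) + exp (2 * a / \<Delta> * (- y)))"
proof (cases "round (y / \<Delta>) = 0")
  case False
  define z where "z = 2 * \<bar>y / \<Delta>\<bar>"
  have "\<bar>y / \<Delta>\<bar> \<ge> 1/2" using False round_unique'[of "y / \<Delta>" 0] by force
  hence "z \<ge> 1" unfolding z_def by linarith
  have "\<bar>y / \<Delta> - real_of_int (round (y / \<Delta>))\<bar> \<le> 1/2"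
    using of_int_round_abs_le[of "y / \<Delta>"] by (simp add: abs_minus_commute)
  hence "\<bar>real_of_int (round (y / \<Delta>))\<bar> \<le> z" using \<open>\<bar>y / \<Delta>\<bar> \<ge> 1/2\<close> unfolding z_def by linarith
  also have "z \<le> exp (z - 1)" using exp_ge_add_one_self[of "z - 1"] by simp
  also have "\<dots> \<le> exp (a * (z - 1))" using \<open>z \<ge> 1\<close> assms by (simp add: mult_right_mono[of 1 a "z - 1", simplified])
  also have "\<dots> = exp (- a) * exp (2 * a / \<Delta> * \<bar>y\<bar>)"
    using assms by (simp add: z_def algebra_simps flip: exp_add)
  also have "\<dots> \<le> exp (- a) * (exp (2 * a / \<Delta> * y) + exp (2 * a / \<Delta> * (- y)))"
    by (intro mult_left_mono) (auto simp: abs_if)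
  finally show ?thesis .
qed (auto intro!: mult_nonneg_nonneg add_nonneg_nonneg)

text \<open>In the partial colouring lemma there are \<open>exp (3 u / 20)\<close> signatures, and the colourings near a given
one number at most \<open>(9 powr (1/10) * (10/9)) ^ u\<close>. The product of both must stay below \<open>2 ^ u / 2\<close>, which
follows for \<open>u \<ge> 4\<close> since \<open>(2 / 1.65) ^ 4 > 2\<close>.\<close>

lemma counting_constant: "exp (3/20) * (9 powr (1/10) * (10/9)) \<le> (1.65 :: real)"
proof -
  have "(9::real) powr (1/10) \<le> (1.25 ^ 10) powr (1/10)"
    by (intro powr_mono2) (auto simp: power_divide)
  also have "\<dots> = (1.25 :: real)"
  proof -
    have "(1.25 :: real) ^ 10 = 1.25 powr 10" by (rule powr_numeral[symmetric]) simp
    thus ?thesis by (simp only: powr_powr) simp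
  qed
  finally have 1: "(9::real) powr (1/10) \<le> 1.25" .
  have "exp (3/20 :: real) \<le> 1 + 3/20 + (3/20)^2"
    by (rule exp_bound) auto
  hence 2: "exp (3/20 :: real) \<le> 1.1725" by (simp add: power2_eq_square)
  have "exp (3/20) * (9 powr (1/10) * (10/9)) \<le> (1.1725 :: real) * (1.25 * (10/9))"
    using 1 2 by (intro mult_mono) auto
  thus ?thesis by simp
qed

text \<open>The signature of a colouring consists of its exact values on the bad edges \<open>B\<close> and of its values on
the good edges \<open>G\<close> rounded to multiples of \<open>\<Delta> = 4 sqrt (\<kappa> T)\<close>. The standard deviation of a value is
at most \<open>sqrt T\<close>, so most rounded values are \<open>0\<close>: by Markov's inequality at least half of the
colourings have a rounded vector of norm at most \<open>L\<close>, and few vectors are so short. Thus some signature is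
shared by more colourings than fit into a Hamming ball of radius \<open>card U / 10\<close>, and two colourings
with that signature and larger distance give \<open>x\<close>.\<close>

lemma partial_colouring:
  fixes T m :: real
  assumes fin: "finite U" "finite G" "finite B" and card_U: "card U \<ge> 4"
    and m: "card G \<le> m" "card U \<le> m" and "T > 0"
    and sub: "\<And>i. i \<in> G \<union> B \<Longrightarrow> f i \<subseteq> U"
    and good: "\<And>i. i \<in> G \<Longrightarrow> card (f i) \<le> T"
    and bad: "(\<Prod>i\<in>B. real (card (f i)) + 1) \<le> exp (card U / 20)"
  obtains x :: "'a \<Rightarrow> int" where "\<And>v. v \<in> U \<Longrightarrow> x v \<in> {-1, 0, 1}"
    "10 * card {v\<in>U. x v = 0} \<le> 9 * card U"
    "\<And>i. i \<in> B \<Longrightarrow> (\<Sum>v\<in>f i. x v) = 0"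
    "\<And>i. i \<in> G \<Longrightarrow> \<bar>real_of_int (\<Sum>v\<in>f i. x v)\<bar> \<le> 2 * sqrt (T * ln (80 * m / card U))"
proof -
  let ?u = "real (card U)" and ?C = "colourings U"
  let ?s = "\<lambda>\<psi> i. real_of_int (\<Sum>v\<in>f i. \<psi> v)"
  \<comment> \<open>\<open>exp (- \<kappa>)\<close> is the weight per unit of norm in the count of rounded vectors; a fraction \<open>u / 80 m\<close> for each of
    at most \<open>m\<close> coordinates makes the count \<open>exp (O(u))\<close>.\<close>
  define \<kappa> where "\<kappa> = ln (80 * m / ?u)"
  have u0: "?u > 0" using card_U by simp
  have "m > 0" using m u0 by linarith
  have exp_\<kappa>: "exp (- \<kappa>) = ?u / (80 * m)"
    unfolding \<kappa>_def using u0 \<open>m > 0\<close> by (simp add: exp_minus)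
  have exp_le: "exp (- \<kappa>) \<le> 1/80"
    unfolding exp_\<kappa> using m \<open>m > 0\<close> by (simp add: field_simps)
  have "\<kappa> \<ge> 1"
  proof -
    have "exp 1 \<le> (80::real)" using Transcendental.exp_le by linarith
    also have "\<dots> \<le> 80 * m / ?u" using m u0 by (simp add: field_simps)
    finally show ?thesis unfolding \<kappa>_def using u0 \<open>m > 0\<close> by (subst ln_ge_iff) auto
  qed
  define \<Delta> where "\<Delta> = 4 * sqrt (\<kappa> * T)"
  have "\<Delta> > 0" unfolding \<Delta>_def using \<open>\<kappa> \<ge> 1\<close> \<open>T > 0\<close> by simp
  have \<Delta>2: "\<Delta>\<^sup>2 = 16 * \<kappa> * T" unfolding \<Delta>_def using \<open>\<kappa> \<ge> 1\<close> \<open>T > 0\<close> by (simp add: power_mult_distrib)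
  \<comment> \<open>The exponent that goes with \<open>a = 4 \<kappa>\<close> in the bound for rounded values.\<close>
  define \<theta> where "\<theta> = 2 * (4 * \<kappa>) / \<Delta>"
  have "\<theta> \<ge> 0" unfolding \<theta>_def using \<open>\<Delta> > 0\<close> \<open>\<kappa> \<ge> 1\<close> by simp
  have \<theta>2: "\<theta>\<^sup>2 / 2 * T = 2 * \<kappa>"
    unfolding \<theta>_def power_divide power_mult_distrib \<Delta>2 using \<open>\<kappa> \<ge> 1\<close> \<open>T > 0\<close> 
    by (simp add: field_simps power2_eq_square)
  define b where "b = (\<lambda>\<psi>. \<lambda>i\<in>G. round (?s \<psi> i / \<Delta>))"

  have cost_edge: "(\<Sum>\<psi>\<in>?C. \<bar>real_of_int (b \<psi> i)\<bar>) \<le> 2 ^ card U * (2 * exp (- 2 * \<kappa>))" if i: "i \<in> G" for i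
  proof -
    have mgf: "(\<Sum>\<psi>\<in>?C. exp (\<theta> * (s * ?s \<psi> i))) \<le> 2 ^ card U * exp (2 * \<kappa>)" 
      if "s = 1 \<or> s = -1" for s :: real
    proof -
      have "(\<Sum>\<psi>\<in>?C. exp (\<theta> * (s * ?s \<psi> i))) \<le> 2 ^ card U * exp (\<theta>\<^sup>2 / 2 * card (f i))"
        using sub i that \<open>\<theta> \<ge> 0\<close> by (intro sum_colourings_exp_le fin) auto
      also have "\<theta>\<^sup>2 / 2 * card (f i) \<le> \<theta>\<^sup>2 / 2 * T"
        using good[OF i] by (intro mult_left_mono) auto
      finally show ?thesis using \<theta>2 by simp
    qed
    have "(\<Sum>\<psi>\<in>?C. \<bar>real_of_int (b \<psi> i)\<bar>) \<le> 
        (\<Sum>\<psi>\<in>?C. exp (- (4 * \<kappa>)) * (exp (\<theta> * ?s \<psi> i) + exp (\<theta> * (- ?s \<psi> i))))"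
    proof (rule sum_mono)
      fix \<psi>
      show "\<bar>real_of_int (b \<psi> i)\<bar> \<le> exp (- (4 * \<kappa>)) * (exp (\<theta> * ?s \<psi> i) + exp (\<theta> * (- ?s \<psi> i)))"
        using rounded_abs_le[OF \<open>\<Delta> > 0\<close>, of "4 * \<kappa>" "?s \<psi> i"] \<open>\<kappa> \<ge> 1\<close> i
        by (simp only: b_def \<theta>_def restrict_apply' if_True)
    qed
    also have "\<dots> = exp (- (4 * \<kappa>)) * ((\<Sum>\<psi>\<in>?C. exp (\<theta> * (1 * ?s \<psi> i))) + (\<Sum>\<psi>\<in>?C. exp (\<theta> * ((-1) * ?s \<psi> i))))"
      by (simp only: sum.distrib sum_distrib_left[symmetric] mult_1 mult_minus1)
    also have "\<dots> \<le> exp (- (4 * \<kappa>)) * (2 ^ card U * exp (2 * \<kappa>) + 2 ^ card U * exp (2 * \<kappa>))"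
      by (intro mult_left_mono add_mono mgf) auto
    also have "\<dots> = 2 ^ card U * (2 * (exp (- (4 * \<kappa>)) * exp (2 * \<kappa>)))" by simp
    also have "exp (- (4 * \<kappa>)) * exp (2 * \<kappa>) = exp (- 2 * \<kappa>)" by (simp flip: exp_add)
    finally show ?thesis by simp
  qed

  define cost where "cost = (\<lambda>\<psi>. \<Sum>i\<in>G. \<bar>real_of_int (b \<psi> i)\<bar>)"
  \<comment> \<open>Twice the bound on the mean cost, for Markov's inequality.\<close>
  define L where "L = 4 * m * exp (- 2 * \<kappa>)"
  have "L > 0" using \<open>m > 0\<close> by (simp add: L_def)
  define C1 where "C1 = {\<psi>\<in>?C. cost \<psi> \<le> L}"
  have fC: "finite ?C" using fin by (intro finite_colourings)
  have fC1: "finite C1" using fC by (simp add: C1_def)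
  have card_C1: "2 ^ card U \<le> 2 * real (card C1)"
  proof -
    have "L * card (?C - C1) = (\<Sum>\<psi>\<in>?C - C1. L)" by simp
    also have "\<dots> \<le> (\<Sum>\<psi>\<in>?C - C1. cost \<psi>)"
      by (intro sum_mono) (auto simp: C1_def)
    also have "\<dots> \<le> (\<Sum>\<psi>\<in>?C. cost \<psi>)"
      using fC by (intro sum_mono2) (auto simp: cost_def sum_nonneg)
    also have "\<dots> = (\<Sum>i\<in>G. \<Sum>\<psi>\<in>?C. \<bar>real_of_int (b \<psi> i)\<bar>)"
      unfolding cost_def by (rule sum.swap)
    also have "\<dots> \<le> (\<Sum>i\<in>G. 2 ^ card U * (2 * exp (- 2 * \<kappa>)))" by (intro sum_mono cost_edge)
    also have "\<dots> = card G * (2 ^ card U * (2 * exp (- 2 * \<kappa>)))" by simp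
    also have "\<dots> \<le> m * (2 ^ card U * (2 * exp (- 2 * \<kappa>)))" using m by (intro mult_right_mono) auto
    also have "\<dots> = L * (2 ^ card U / 2)" by (simp add: L_def)
    finally have "real (card (?C - C1)) \<le> 2 ^ card U / 2" using \<open>L > 0\<close> by simp
    moreover have "card (?C - C1) = 2 ^ card U - card C1"
      using card_Diff_subset[OF fC1, of ?C] fin by (auto simp: C1_def card_colourings)
    moreover have "card C1 \<le> 2 ^ card U"
      using card_mono[OF fC, of C1] fin by (auto simp: C1_def card_colourings)
    ultimately show ?thesis by (simp add: of_nat_diff)
  qed

  have \<kappa>L: "\<kappa> * L \<le> ?u / 20"
  proof -
    have "\<kappa> \<le> exp \<kappa>" using exp_ge_add_one_self[of \<kappa>] by linarith
    hence "\<kappa> * (4 * m * exp (- 2 * \<kappa>)) \<le> exp \<kappa> * (4 * m * exp (- 2 * \<kappa>))"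
      using \<open>m > 0\<close> by (intro mult_right_mono) auto
    also have "\<dots> = 4 * m * exp (- \<kappa>)" by (simp flip: exp_add)
    also have "\<dots> = ?u / 20" using \<open>m > 0\<close> by (simp add: exp_\<kappa>)
    finally show ?thesis by (simp add: L_def)
  qed
  have S1: "finite (b ` C1)" "real (card (b ` C1)) \<le> exp (?u / 20) * exp (?u / 20)"
  proof -
    have sub1: "b ` C1 \<subseteq> {b \<in> extensional G. (\<Sum>i\<in>G. \<bar>real_of_int (b i)\<bar>) \<le> L}"
      by (auto simp: C1_def cost_def b_def)
    have half: "exp (- \<kappa>) \<le> 1/2" using exp_le by linarith
    show "finite (b ` C1)" by (rule card_small_l1_norm_le(1)[OF fin(2) half sub1])
    have "card (b ` C1) \<le> exp (\<kappa> * L) * (1 + 4 * exp (- \<kappa>)) ^ card G"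
      by (rule card_small_l1_norm_le(2)[OF fin(2) half sub1])
    also have "(1 + 4 * exp (- \<kappa>)) ^ card G \<le> exp (4 * exp (- \<kappa>)) ^ card G"
      by (intro power_mono exp_ge_add_one_self) (auto intro: add_nonneg_nonneg)
    also have "\<dots> = exp (card G * (4 * exp (- \<kappa>)))" by (simp flip: exp_of_nat_mult)
    also have "card G * (4 * exp (- \<kappa>)) \<le> m * (4 * exp (- \<kappa>))"
      using m by (intro mult_right_mono) auto
    also have "\<dots> = ?u / 20" using \<open>m > 0\<close> by (simp add: exp_\<kappa>)
    also have "exp (\<kappa> * L) \<le> exp (?u / 20)" using \<kappa>L by simp
    finally show "real (card (b ` C1)) \<le> exp (?u / 20) * exp (?u / 20)" by simp
  qed
  have S2: "finite (edge_sums B f ` C1)" "real (card (edge_sums B f ` C1)) \<le> exp (?u / 20)"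
  proof -
    have 1: "C1 \<subseteq> colourings U" by (auto simp: C1_def)
    have sub2: "f i \<subseteq> U" if "i \<in> B" for i using sub that by auto
    note * = card_edge_sums_le[of U B f C1, OF fin(1,3) sub2 1]
    show "finite (edge_sums B f ` C1)" by (rule *)
    have "real (card (edge_sums B f ` C1)) \<le> real (\<Prod>i\<in>B. card (f i) + 1)"
      using *(2) by (simp only: of_nat_le_iff)
    also have "\<dots> \<le> exp (?u / 20)" using bad by (simp add: add.commute)
    finally show "real (card (edge_sums B f ` C1)) \<le> exp (?u / 20)" .
  qed

  define sig where "sig = (\<lambda>\<psi>. (b \<psi>, edge_sums B f \<psi>))"
  let ?R = "b ` C1 \<times> edge_sums B f ` C1"
  have R: "real (card ?R) \<le> exp (3 / 20) ^ card U"
  proof -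
    have "real (card ?R) = real (card (b ` C1)) * real (card (edge_sums B f ` C1))"
      by (simp add: card_cartesian_product)
    also have "\<dots> \<le> (exp (?u / 20) * exp (?u / 20)) * exp (?u / 20)"
      using S1 S2 by (intro mult_mono) auto
    also have "\<dots> = exp (3 / 20) ^ card U" by (simp flip: exp_add exp_of_nat_mult)
    finally show ?thesis .
  qed
  have "C1 \<noteq> {}"
  proof
    assume "C1 = {}"
    hence "(2::real) ^ card U \<le> 0" using card_C1 by simp
    moreover have "(2::real) ^ card U > 0" by simp
    ultimately show False by linarith
  qed
  have "\<exists>y\<in>?R. card C1 \<le> card (sig -` {y} \<inter> C1) * card ?R"
    using S1(1) S2(1) fC1 \<open>C1 \<noteq> {}\<close> by (intro pigeonhole_card) (auto simp: sig_def)
  then obtain y where y: "card C1 \<le> card (sig -` {y} \<inter> C1) * card ?R" by blast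
  define K where "K = sig -` {y} \<inter> C1"
  have "K \<noteq> {}" using y \<open>C1 \<noteq> {}\<close> fC1 by (auto simp: K_def card_eq_0_iff)
  then obtain \<psi> where \<psi>: "\<psi> \<in> K" by blast
  have KC: "K \<subseteq> ?C" by (auto simp: K_def C1_def)
  have "\<exists>\<psi>'\<in>K. \<not> 10 * card {v\<in>U. \<psi>' v \<noteq> \<psi> v} \<le> card U"
  proof (rule ccontr)
    assume "\<not> ?thesis"
    hence "K \<subseteq> {\<psi>'\<in>?C. 10 * card {v\<in>U. \<psi>' v \<noteq> \<psi> v} \<le> card U}" using KC by auto
    hence "card K \<le> card {\<psi>'\<in>?C. 10 * card {v\<in>U. \<psi>' v \<noteq> \<psi> v} \<le> card U}"
      using fC by (intro card_mono) auto
    hence K: "real (card K) \<le> (9 powr (1/10) * (10/9)) ^ card U"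
      using hamming_ball_card[OF fin(1), of \<psi>] \<psi> KC by force
    have "2 ^ card U \<le> 2 * real (card C1)" by (rule card_C1)
    also have "\<dots> \<le> 2 * (real (card K) * real (card ?R))"
      using y by (simp add: K_def flip: of_nat_mult)
    also have "\<dots> \<le> 2 * ((9 powr (1/10) * (10/9)) ^ card U * exp (3 / 20) ^ card U)"
      using K R by (intro mult_left_mono mult_mono) auto
    also have "\<dots> = 2 * (exp (3 / 20) * (9 powr (1/10) * (10/9))) ^ card U"
      by (simp only: power_mult_distrib mult_ac)
    also have "\<dots> \<le> 2 * 1.65 ^ card U"
      using counting_constant by (intro mult_left_mono power_mono) auto
    finally have "2 ^ card U / 1.65 ^ card U \<le> (2::real)"
      by (subst pos_divide_le_eq) auto
    hence "(2 / 1.65) ^ card U \<le> (2::real)" by (simp only: power_divide)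
    moreover have "(2 / 1.65) ^ 4 \<le> ((2 / 1.65) ^ card U :: real)"
      using card_U by (intro power_increasing) auto
    ultimately show False by (simp add: power4_eq_xxxx)
  qed
  then obtain \<psi>' where \<psi>': "\<psi>' \<in> K" "card U < 10 * card {v\<in>U. \<psi>' v \<noteq> \<psi> v}" by auto
  have same: "b \<psi>' = b \<psi>" "edge_sums B f \<psi>' = edge_sums B f \<psi>"
    using \<psi> \<psi>' by (auto simp: K_def sig_def)
  have in_C: "\<psi>' \<in> ?C" "\<psi> \<in> ?C" using \<psi> \<psi>' KC by auto
  note half = half_difference_partial_colouring[OF fin(1) in_C]
  define x where "x = (\<lambda>v. (\<psi>' v - \<psi> v) div 2)"
  show ?thesis
  proof (rule that[of x])
    show "x v \<in> {-1, 0, 1}" if "v \<in> U" for v using half(1)[OF that] by (simp add: x_def)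
    have "{v\<in>U. x v = 0} = U - {v\<in>U. \<psi>' v \<noteq> \<psi> v}" using half(2) by (auto simp: x_def)
    hence "card {v\<in>U. x v = 0} = card U - card {v\<in>U. \<psi>' v \<noteq> \<psi> v}"
      using fin(1) by (simp add: card_Diff_subset)
    thus "10 * card {v\<in>U. x v = 0} \<le> 9 * card U" using \<psi>'(2) by linarith
  next
    fix i assume i: "i \<in> B"
    have "(\<Sum>v\<in>f i. \<psi>' v) = (\<Sum>v\<in>f i. \<psi> v)"
      using fun_cong[OF same(2), of i] i by (simp add: edge_sums_def)
    thus "(\<Sum>v\<in>f i. x v) = 0" using half(3)[of "f i"] sub i by (simp add: x_def)
  next
    fix i assume i: "i \<in> G"
    have "round (?s \<psi>' i / \<Delta>) = round (?s \<psi> i / \<Delta>)"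
      using fun_cong[OF same(1), of i] i by (simp add: b_def)
    hence "\<bar>?s \<psi>' i / \<Delta> - ?s \<psi> i / \<Delta>\<bar> < 1" by (rule round_eq_imp_diff_1)
    hence "\<bar>(?s \<psi>' i - ?s \<psi> i) / \<Delta>\<bar> < 1" by (simp only: diff_divide_distrib)
    hence "\<bar>?s \<psi>' i - ?s \<psi> i\<bar> < \<Delta>"
      using \<open>\<Delta> > 0\<close> by (simp add: abs_divide)
    moreover have "2 * (\<Sum>v\<in>f i. x v) = (\<Sum>v\<in>f i. \<psi>' v) - (\<Sum>v\<in>f i. \<psi> v)"
      using half(3)[of "f i"] sub i by (simp add: x_def)
    hence "2 * real_of_int (\<Sum>v\<in>f i. x v) = ?s \<psi>' i - ?s \<psi> i"
      by (metis of_int_diff of_int_mult of_int_numeral)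
    ultimately have "\<bar>real_of_int (\<Sum>v\<in>f i. x v)\<bar> \<le> \<Delta> / 2" by linarith
    also have "\<Delta> / 2 = 2 * sqrt (T * ln (80 * m / card U))"
      by (simp add: \<Delta>_def \<kappa>_def mult.commute)
    finally show "\<bar>real_of_int (\<Sum>v\<in>f i. x v)\<bar> \<le> 2 * sqrt (T * ln (80 * m / card U))" .
  qed
qed

section \<open>Colouring a hypergraph with sparse traces\<close>

lemma ln_add_one_le_two_sqrt:
  fixes s :: real
  assumes "s \<ge> 0"
  shows "ln (s + 1) \<le> 2 * sqrt s"
proof -
  have "s + 1 \<le> (1 + sqrt s)\<^sup>2" using assms by (simp add: power2_sum)
  also have "\<dots> \<le> (exp (sqrt s))\<^sup>2" using assms by (intro power_mono) auto
  also have "\<dots> = exp (2 * sqrt s)" by (simp add: exp_double)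
  finally have "ln (s + 1) \<le> ln (exp (2 * sqrt s))" using assms by (subst ln_le_cancel_iff) auto
  thus ?thesis by simp
qed

text \<open>For edges of sizes \<open>k i\<close> the product bounds the number of vectors of values that colourings can have.
Its logarithm is a sum of terms \<open>ln (k i + 1)\<close>, each smaller than \<open>k i\<close> by a factor of order \<open>sqrt \<tau>\<close> or more.\<close>

lemma prod_card_add_one_le:
  fixes \<tau> c u :: real
  assumes "finite B" "\<tau> > 0" and large: "\<And>i. i \<in> B \<Longrightarrow> real (k i) > \<tau>"
    and total: "(\<Sum>i\<in>B. real (k i)) \<le> c * u"
  shows "(\<Prod>i\<in>B. real (k i) + 1) \<le> exp (2 * c * u / sqrt \<tau>)"
proof -
  have "(\<Prod>i\<in>B. real (k i) + 1) = exp (\<Sum>i\<in>B. ln (real (k i) + 1))"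
    using assms(1) by (simp add: exp_sum add_nonneg_pos)
  also have "(\<Sum>i\<in>B. ln (real (k i) + 1)) \<le> (\<Sum>i\<in>B. 2 / sqrt \<tau> * real (k i))"
  proof (rule sum_mono)
    fix i assume i: "i \<in> B"
    have "ln (real (k i) + 1) \<le> 2 * sqrt (real (k i))" by (rule ln_add_one_le_two_sqrt) simp
    also have "\<dots> = 2 * (real (k i) / sqrt (real (k i)))" by (simp add: real_div_sqrt)
    also have "\<dots> \<le> 2 * (real (k i) / sqrt \<tau>)"
      using large[OF i] \<open>\<tau> > 0\<close> by (intro mult_left_mono divide_left_mono) auto
    finally show "ln (real (k i) + 1) \<le> 2 / sqrt \<tau> * real (k i)" by simp
  qed
  also have "\<dots> = 2 / sqrt \<tau> * (\<Sum>i\<in>B. real (k i))" by (simp add: sum_distrib_left)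
  also have "\<dots> \<le> 2 / sqrt \<tau> * (c * u)" using total \<open>\<tau> > 0\<close> by (intro mult_left_mono) auto
  finally show ?thesis by (simp add: mult_ac)
qed

lemma complete_partial_colouring:
  fixes x y :: "'a \<Rightarrow> int"
  assumes "finite U" and x: "\<And>v. v \<in> U \<Longrightarrow> x v \<in> {-1, 0, 1}"
    and y: "\<And>v. v \<in> U \<Longrightarrow> x v = 0 \<Longrightarrow> y v \<in> {-1, 1}"
  defines "z \<equiv> \<lambda>v. if x v = 0 then y v else x v"
  shows "v \<in> U \<Longrightarrow> z v \<in> {-1, 1}"
    and "(\<Sum>v\<in>A \<inter> U. z v) = (\<Sum>v\<in>A \<inter> U. x v) + (\<Sum>v\<in>A \<inter> {v\<in>U. x v = 0}. y v)"
proof -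
  show "v \<in> U \<Longrightarrow> z v \<in> {-1, 1}" using x[of v] y[of v] by (auto simp: z_def)
  have "(\<Sum>v\<in>A \<inter> U. z v) = (\<Sum>v\<in>A \<inter> U. x v + (if x v = 0 then y v else 0))"
    by (intro sum.cong) (auto simp: z_def)
  also have "\<dots> = (\<Sum>v\<in>A \<inter> U. x v) + (\<Sum>v\<in>{v\<in>A \<inter> U. x v = 0}. y v)"
    using assms(1) by (subst sum.inter_filter) (auto simp: sum.distrib)
  also have "{v\<in>A \<inter> U. x v = 0} = A \<inter> {v\<in>U. x v = 0}" by auto
  finally show "(\<Sum>v\<in>A \<inter> U. z v) = (\<Sum>v\<in>A \<inter> U. x v) + (\<Sum>v\<in>A \<inter> {v\<in>U. x v = 0}. y v)" .
qed

definition trace_size :: "('i \<Rightarrow> 'a set) \<Rightarrow> 'a set \<Rightarrow> 'i \<Rightarrow> nat" where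
  "trace_size e U i = card (e i \<inter> U)"

text \<open>The deterministic properties of the random hypergraph from which a colouring of small discrepancy
is built. In the application \<open>\<tau> = sqrt (\<mu> ln \<lambda>)\<close> and \<open>\<alpha> = exp 3 * \<mu>\<close>. An edge chosen without regard to
\<open>U\<close> would have a trace of mean size \<open>\<mu> * card U / card V\<close>; the threshold decreases only like the
square root of \<open>card U / card V\<close>, and this room pays for the choice of \<open>U\<close>, while the decrease is still
fast enough to make the total cost of the rounds converge. The bound on \<open>sqrt \<tau>\<close> turns \<open>8 * card U\<close> into
the budget \<open>card U / 20\<close> for the edges to be balanced exactly, and the bound on \<open>\<alpha>\<close> guarantees that \<open>U\<close> has
more than four vertices as long as \<open>\<tau>\<close> is not the larger term of the threshold.\<close>

locale sparse_traces =
  fixes V :: "'a set" and E :: "'i set" and e :: "'i \<Rightarrow> 'a set" and \<tau> \<alpha> :: real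
  assumes finite_V: "finite V" and V_nonempty: "V \<noteq> {}" and finite_E: "finite E"
    and V_le_E: "card V \<le> card E"
    and \<tau>_large: "sqrt \<tau> \<ge> 320" and \<alpha>_pos: "\<alpha> > 0" and \<alpha>_small: "4 * \<alpha>\<^sup>2 \<le> card V * \<tau>\<^sup>2"
    and sparse: "\<And>U. U \<subseteq> V \<Longrightarrow> U \<noteq> {} \<Longrightarrow>
      (\<Sum>i | i \<in> E \<and> real (trace_size e U i) > max \<tau> (\<alpha> * sqrt (card U / card V)). real (trace_size e U i))
        \<le> 8 * card U"
begin

lemma \<tau>_pos: "\<tau> > 0"
  using \<tau>_large by (metis less_le_trans real_sqrt_gt_0_iff zero_less_numeral)

lemma large_traces_prod_le:
  assumes "U \<subseteq> V" "U \<noteq> {}"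
  shows "(\<Prod>i | i \<in> E \<and> real (trace_size e U i) > max \<tau> (\<alpha> * sqrt (card U / card V)). real (trace_size e U i) + 1)
     \<le> exp (card U / 20)"
proof -
  let ?B = "{i. i \<in> E \<and> real (trace_size e U i) > max \<tau> (\<alpha> * sqrt (card U / card V))}"
  have "(\<Prod>i\<in>?B. real (trace_size e U i) + 1) \<le> exp (2 * 8 * real (card U) / sqrt \<tau>)"
    using finite_E \<tau>_pos sparse[OF assms] by (intro prod_card_add_one_le) auto
  also have "2 * 8 * real (card U) / sqrt \<tau> \<le> 2 * 8 * real (card U) / 320"
    using \<tau>_large \<tau>_pos by (intro divide_left_mono) auto
  finally show ?thesis by simp
qed

text \<open>Balance the edges with more than \<open>\<tau>\<close> vertices in \<open>U\<close> exactly, colour at least one vertex and recurse.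
As soon as an edge has at most \<open>\<tau>\<close> vertices in the uncoloured set, whatever happens there changes its
value by at most \<open>\<tau>\<close>; until then its value has stayed \<open>0\<close>.\<close>

lemma colour_small_set:
  assumes "U \<subseteq> V" "\<alpha> * sqrt (card U / card V) \<le> \<tau>"
  shows "\<exists>z :: 'a \<Rightarrow> int. (\<forall>v\<in>U. z v \<in> {-1, 1}) \<and> (\<forall>i\<in>E. \<bar>real_of_int (\<Sum>v\<in>e i \<inter> U. z v)\<bar> \<le> \<tau>)"
  using assms
proof (induction "card U" arbitrary: U rule: less_induct)
  case less
  have fin: "finite U" using less.prems finite_V finite_subset by blast
  show ?case
  proof (cases "U = {}")
    case True
    thus ?thesis using \<tau>_pos by auto
  next
    case False
    define B where "B = {i. i \<in> E \<and> real (trace_size e U i) > \<tau>}"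
    have Beq: "B = {i. i \<in> E \<and> real (trace_size e U i) > max \<tau> (\<alpha> * sqrt (card U / card V))}"
      using less.prems by (auto simp: B_def)
    have "real (\<Prod>i\<in>B. card (e i \<inter> U) + 1) \<le> exp (card U / 20)"
      using large_traces_prod_le[OF less.prems(1) False] by (simp add: Beq trace_size_def add.commute)
    also have "\<dots> = exp (1/20) ^ card U" by (simp flip: exp_of_nat_mult)
    also have "exp (1/20 :: real) < 2" using real_exp_bound_lemma[of "1/20"] by simp
    hence "exp (1/20 :: real) ^ card U < 2 ^ card U"
      using False fin by (intro power_strict_mono) (auto simp: card_gt_0_iff)
    finally have "real (\<Prod>i\<in>B. card (e i \<inter> U) + 1) < real (2 ^ card U)" by simp
    hence prod: "(\<Prod>i\<in>B. card (e i \<inter> U) + 1) < 2 ^ card U" by (simp only: of_nat_less_iff)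
    obtain x :: "'a \<Rightarrow> int" where x: "\<And>v. v \<in> U \<Longrightarrow> x v \<in> {-1, 0, 1}" "\<exists>v\<in>U. x v \<noteq> 0"
      "\<And>i. i \<in> B \<Longrightarrow> (\<Sum>v\<in>e i \<inter> U. x v) = 0"
      by (rule exact_partial_colouring[OF fin _ _ prod]) (use finite_E in \<open>auto simp: B_def\<close>)
    let ?U' = "{v\<in>U. x v = 0}"
    have "?U' \<subset> U" using x(2) by auto
    hence lt: "card ?U' < card U" by (rule psubset_card_mono[OF fin])
    have "\<alpha> * sqrt (card ?U' / card V) \<le> \<alpha> * sqrt (card U / card V)"
      using lt \<alpha>_pos by (intro mult_left_mono real_sqrt_le_mono divide_right_mono) auto
    hence "\<exists>y :: 'a \<Rightarrow> int. (\<forall>v\<in>?U'. y v \<in> {-1, 1}) \<and> (\<forall>i\<in>E. \<bar>real_of_int (\<Sum>v\<in>e i \<inter> ?U'. y v)\<bar> \<le> \<tau>)"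
      using less.prems by (intro less.hyps[OF lt]) auto
    then obtain y where y: "\<And>v. v \<in> ?U' \<Longrightarrow> y v \<in> {-1, 1}"
      "\<And>i. i \<in> E \<Longrightarrow> \<bar>real_of_int (\<Sum>v\<in>e i \<inter> ?U'. y v)\<bar> \<le> \<tau>" by blast
    define z where "z = (\<lambda>v. if x v = 0 then y v else x v)"
    have z: "\<And>v. v \<in> U \<Longrightarrow> z v \<in> {-1, 1}"
      "\<And>A. (\<Sum>v\<in>A \<inter> U. z v) = (\<Sum>v\<in>A \<inter> U. x v) + (\<Sum>v\<in>A \<inter> ?U'. y v)"
      using complete_partial_colouring[of U x y, OF fin x(1)] y(1) unfolding z_def by blast+
    show ?thesis
    proof (intro exI[of _ z] conjI ballI)
      fix i assume i: "i \<in> E"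
      show "\<bar>real_of_int (\<Sum>v\<in>e i \<inter> U. z v)\<bar> \<le> \<tau>"
      proof (cases "i \<in> B")
        case True
        thus ?thesis using z(2)[of "e i"] x(3) y(2)[OF i] by simp
      next
        case False
        have "\<bar>\<Sum>v\<in>e i \<inter> U. z v\<bar> \<le> (\<Sum>v\<in>e i \<inter> U. \<bar>z v\<bar>)" by (rule sum_abs)
        also have "\<dots> = (\<Sum>v\<in>e i \<inter> U. 1)" using z(1) by (intro sum.cong) force+
        also have "\<dots> = int (trace_size e U i)" by (simp add: trace_size_def)
        finally have "\<bar>real_of_int (\<Sum>v\<in>e i \<inter> U. z v)\<bar> \<le> real (trace_size e U i)" by linarith
        also have "\<dots> \<le> \<tau>" using False i by (auto simp: B_def)
        finally show ?thesis .
      qed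
    qed (use z(1) in auto)
  qed
qed

text \<open>The sum of the geometric series of costs: a round at a set of relative size \<open>w\<close> costs at most
\<open>4 * sqrt (\<alpha> * ln (80 * \<lambda>)) * w powr (1/8)\<close>, and \<open>w\<close> shrinks by a factor \<open>9/10\<close> or more from round to round.\<close>

definition drift :: real where
  "drift = 4 * sqrt (\<alpha> * ln (80 * (card E / card V))) / (1 - (9/10) powr (1/8))"

lemma one_add_ln_le_powr:
  fixes y :: real
  assumes "y > 0"
  shows "1 + ln y \<le> 4 * y powr (1/4)"
proof -
  have "ln (y powr (1/4)) \<le> y powr (1/4) - 1" using assms by (intro ln_le_minus_one) simp
  thus ?thesis using assms by (simp add: ln_powr)
qed

text \<open>With \<open>w = u / card V\<close> the cost of a round is \<open>2 * sqrt (\<alpha> * sqrt w * (l + ln (1/w)))\<close> for a constant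
\<open>l \<ge> 1\<close>. A quarter power of \<open>w\<close> absorbs \<open>ln (1/w)\<close>, which leaves \<open>w powr (1/8)\<close> after the outer root. The
right-hand side telescopes when the rounds are added.\<close>

lemma round_cost_le:
  fixes u :: real
  assumes u: "0 < u" "u \<le> card V"
  shows "2 * sqrt (\<alpha> * sqrt (u / card V) * ln (80 * real (card E) / u)) \<le>
    drift * ((u / card V) powr (1/8) - (9/10 * u / card V) powr (1/8))"
proof -
  let ?n = "real (card V)" and ?m = "real (card E)"
  define w where "w = u / ?n"
  define l where "l = ln (80 * (?m / ?n))"
  have n: "?n > 0" and mn: "?m \<ge> ?n"
    using finite_V V_nonempty V_le_E by (auto simp: card_gt_0_iff)
  hence m: "?m > 0" by linarith
  have w: "0 < w" "w \<le> 1" using u n by (auto simp: w_def)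
  have "exp 1 \<le> (80::real)" using Transcendental.exp_le by linarith
  also have "80 \<le> 80 * (?m / ?n)" using mn n by (simp add: field_simps)
  finally have l1: "l \<ge> 1" unfolding l_def using m n by (subst ln_ge_iff) auto
  have "80 * ?m / u = 80 * (?m / ?n) * (1 / w)" using n u by (simp add: w_def)
  hence "ln (80 * ?m / u) = ln (80 * (?m / ?n) * (1 / w))" by (rule arg_cong)
  also have "\<dots> = l + ln (1 / w)"
    unfolding l_def by (rule ln_mult_pos) (use m n w in auto)
  also have "\<dots> \<le> l * (1 + ln (1 / w))"
    using l1 w by (simp add: algebra_simps mult_right_mono[of 1 l, simplified])
  also have "\<dots> \<le> l * (4 * (1 / w) powr (1/4))"
    using l1 w by (intro mult_left_mono one_add_ln_le_powr) auto
  finally have "\<alpha> * sqrt w * ln (80 * ?m / u) \<le> \<alpha> * sqrt w * (l * (4 * (1 / w) powr (1/4)))"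
    using \<alpha>_pos w by (intro mult_left_mono) auto
  also have "\<dots> = 4 * (\<alpha> * l) * (w powr (1/2) * (1 / w) powr (1/4))"
    using w by (simp add: powr_half_sqrt)
  also have "w powr (1/2) * (1 / w) powr (1/4) = w powr (1/4)"
    using w by (simp add: powr_divide field_simps flip: powr_add)
  also have "\<dots> = (w powr (1/8))\<^sup>2" using w by (simp add: powr_power)
  finally have "sqrt (\<alpha> * sqrt w * ln (80 * ?m / u)) \<le> sqrt (4 * (\<alpha> * l) * (w powr (1/8))\<^sup>2)"
    by (rule real_sqrt_le_mono)
  also have "\<dots> = 2 * sqrt (\<alpha> * l) * w powr (1/8)"
    by (simp add: real_sqrt_mult)
  finally have *: "2 * sqrt (\<alpha> * sqrt w * ln (80 * ?m / u)) \<le> 4 * sqrt (\<alpha> * l) * w powr (1/8)" by simp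
  have "(9/10::real) powr (1/8) < 1 powr (1/8)" by (intro powr_less_mono2) auto
  hence c: "1 - (9/10::real) powr (1/8) > 0" by simp
  have "(9/10 * u / ?n) powr (1/8) = (9/10) powr (1/8) * w powr (1/8)"
    using w by (simp add: w_def flip: powr_mult)
  hence "drift * ((u / ?n) powr (1/8) - (9/10 * u / ?n) powr (1/8)) =
      drift * (1 - (9/10) powr (1/8)) * w powr (1/8)"
    by (simp add: w_def[symmetric] algebra_simps)
  also have "drift * (1 - (9/10) powr (1/8)) = 4 * sqrt (\<alpha> * l)"
    unfolding drift_def l_def using c by simp
  finally show ?thesis using * by (simp add: w_def)
qed

lemma colour_set:
  assumes "U \<subseteq> V"
  shows "\<exists>z :: 'a \<Rightarrow> int. (\<forall>v\<in>U. z v \<in> {-1, 1}) \<and>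
     (\<forall>i\<in>E. \<bar>real_of_int (\<Sum>v\<in>e i \<inter> U. z v)\<bar> \<le> \<tau> + drift * (card U / card V) powr (1/8))"
  using assms
proof (induction "card U" arbitrary: U rule: less_induct)
  case less
  let ?n = "real (card V)" and ?m = "real (card E)" and ?u = "real (card U)"
  have fin: "finite U" using less.prems finite_V finite_subset by blast
  have n: "?n > 0" and mn: "?n \<le> ?m" 
    using finite_V V_nonempty V_le_E by (auto simp: card_gt_0_iff)
  have "(9/10::real) powr (1/8) < 1 powr (1/8)" by (intro powr_less_mono2) auto
  moreover have "ln (80 * (?m / ?n)) \<ge> 0" using n mn by (intro ln_ge_zero) (auto simp: field_simps)
  ultimately have "drift \<ge> 0" 
    unfolding drift_def using \<alpha>_pos by (intro divide_nonneg_nonneg mult_nonneg_nonneg) auto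
  define T where "T = \<alpha> * sqrt (?u / ?n)"
  show ?case
  proof (cases "T \<le> \<tau>")
    case True
    then obtain z :: "'a \<Rightarrow> int" where z: "\<forall>v\<in>U. z v \<in> {-1, 1}" 
      "\<forall>i\<in>E. \<bar>real_of_int (\<Sum>v\<in>e i \<inter> U. z v)\<bar> \<le> \<tau>"
      using colour_small_set[OF less.prems] unfolding T_def by blast
    have "0 \<le> drift * (?u / ?n) powr (1/8)" using \<open>drift \<ge> 0\<close> by simp
    thus ?thesis using z by (intro exI[of _ z]) force
  next
    case False
    hence T: "T > \<tau>" by simp
    hence "U \<noteq> {}" using \<tau>_pos by (auto simp: T_def)
    hence u0: "?u > 0" using fin by (simp add: card_gt_0_iff)
    have un: "?u \<le> ?n" using card_mono[OF finite_V less.prems] by simp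
    have "\<tau>\<^sup>2 < T\<^sup>2" using T \<tau>_pos by (intro power_strict_mono) auto
    also have "T\<^sup>2 = \<alpha>\<^sup>2 * ?u / ?n" by (simp add: T_def power_mult_distrib)
    finally have "?n * \<tau>\<^sup>2 < \<alpha>\<^sup>2 * ?u" using n by (simp add: field_simps)
    hence "4 * \<alpha>\<^sup>2 < ?u * \<alpha>\<^sup>2" using \<alpha>_small by (simp add: mult.commute)
    hence u4: "card U \<ge> 4" using \<alpha>_pos by simp
    define B where "B = {i. i \<in> E \<and> real (trace_size e U i) > max \<tau> T}"
    have bad: "(\<Prod>i\<in>B. real (card (e i \<inter> U)) + 1) \<le> exp (?u / 20)"
      using large_traces_prod_le[OF less.prems \<open>U \<noteq> {}\<close>] by (simp add: B_def T_def trace_size_def)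
    obtain x :: "'a \<Rightarrow> int" where x: "\<And>v. v \<in> U \<Longrightarrow> x v \<in> {-1, 0, 1}"
      "10 * card {v\<in>U. x v = 0} \<le> 9 * card U"
      "\<And>i. i \<in> B \<Longrightarrow> (\<Sum>v\<in>e i \<inter> U. x v) = 0"
      "\<And>i. i \<in> E - B \<Longrightarrow> \<bar>real_of_int (\<Sum>v\<in>e i \<inter> U. x v)\<bar> \<le> 2 * sqrt (T * ln (80 * ?m / ?u))"
    proof (rule partial_colouring[of U "E - B" B ?m T "\<lambda>i. e i \<inter> U"])
      show "real (card (E - B)) \<le> ?m" using finite_E by (simp add: card_mono)
      show "card (e i \<inter> U) \<le> T" if "i \<in> E - B" for i
        using that T by (auto simp: B_def trace_size_def)
    qed (use fin finite_E u4 bad un mn T \<tau>_pos in \<open>auto simp: B_def\<close>)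
    let ?U' = "{v\<in>U. x v = 0}"
    have lt: "card ?U' < card U" using x(2) u4 by linarith
    obtain y where y: "\<And>v. v \<in> ?U' \<Longrightarrow> y v \<in> {-1, 1::int}"
      "\<And>i. i \<in> E \<Longrightarrow> \<bar>real_of_int (\<Sum>v\<in>e i \<inter> ?U'. y v)\<bar> \<le> \<tau> + drift * (card ?U' / ?n) powr (1/8)"
      using less.hyps[OF lt] less.prems by blast
    define z where "z = (\<lambda>v. if x v = 0 then y v else x v)"
    have z: "\<And>v. v \<in> U \<Longrightarrow> z v \<in> {-1, 1}"
      "\<And>A. (\<Sum>v\<in>A \<inter> U. z v) = (\<Sum>v\<in>A \<inter> U. x v) + (\<Sum>v\<in>A \<inter> ?U'. y v)"
      using complete_partial_colouring[of U x y, OF fin x(1)] y(1) unfolding z_def by blast+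
    have shrink: "(card ?U' / ?n) powr (1/8) \<le> (9/10 * ?u / ?n) powr (1/8)"
      using x(2) n by (intro powr_mono2 divide_right_mono) auto
    have cost: "2 * sqrt (T * ln (80 * ?m / ?u)) \<le>
        drift * ((?u / ?n) powr (1/8) - (9/10 * ?u / ?n) powr (1/8))"
      unfolding T_def using round_cost_le[OF u0 un] by simp
    show ?thesis
    proof (intro exI[of _ z] conjI ballI)
      fix i assume i: "i \<in> E"
      have "\<bar>real_of_int (\<Sum>v\<in>e i \<inter> U. x v)\<bar> \<le> 2 * sqrt (T * ln (80 * ?m / ?u))"
      proof (cases "i \<in> B")
        case True
        have "ln (80 * ?m / ?u) \<ge> 0" using u0 un mn by (intro ln_ge_zero) (auto simp: field_simps)
        thus ?thesis using x(3)[OF True] T \<tau>_pos by simp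
      qed (use x(4) i in auto)
      hence "\<bar>real_of_int (\<Sum>v\<in>e i \<inter> U. z v)\<bar> \<le> 
          2 * sqrt (T * ln (80 * ?m / ?u)) + (\<tau> + drift * (card ?U' / ?n) powr (1/8))"
        using z(2)[of "e i"] y(2)[OF i] by (simp del: of_int_sum)
      also have "\<dots> \<le> drift * ((?u / ?n) powr (1/8) - (9/10 * ?u / ?n) powr (1/8)) + 
          (\<tau> + drift * (9/10 * ?u / ?n) powr (1/8))"
        using cost shrink \<open>drift \<ge> 0\<close> by (intro add_mono mult_left_mono) auto
      also have "\<dots> = \<tau> + drift * (?u / ?n) powr (1/8)" by (simp add: algebra_simps)
      finally show "\<bar>real_of_int (\<Sum>v\<in>e i \<inter> U. z v)\<bar> \<le> \<tau> + drift * (?u / ?n) powr (1/8)" .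
    qed (use z(1) in auto)
  qed
qed

end

section \<open>Large traces in spread random hypergraphs\<close>

lemma sum_Pow_power_card:
  fixes w :: real
  assumes "finite U"
  shows "(\<Sum>S\<in>Pow U. w ^ card S) = (1 + w) ^ card U"
proof -
  have "(\<Prod>v\<in>U. w + 1) = (\<Sum>S\<in>Pow U. (\<Prod>v\<in>S. w) * (\<Prod>v\<in>U - S. 1))"
    using assms by (rule prod_add)
  thus ?thesis by (simp add: add.commute)
qed

text \<open>Exponential moments of edge sizes require only upper bounds on probabilities of inclusion, and these
hold in the edge-dependent model as well, although its edges are not independent.\<close>

definition spread :: "('i \<Rightarrow> 'a set) pmf \<Rightarrow> 'a set \<Rightarrow> 'i set \<Rightarrow> real \<Rightarrow> bool" where
  "spread P V E p \<longleftrightarrow> 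
     (\<forall>S \<subseteq> V \<times> E. measure_pmf.prob P {e. \<forall>(v, i)\<in>S. v \<in> e i} \<le> p ^ card S)"

lemma integrable_indicator_pmf: "integrable (measure_pmf P) (\<lambda>x. indicator A x :: real)"
  by (rule measure_pmf.integrable_const_bound[where B = 1]) (auto simp: indicator_def)

text \<open>A function of the traces with nonnegative coefficients in the basis of inclusion indicators has at most
the mean that it would have in the independent model: expand the product over the edges and apply
the hypothesis to every term.\<close>

lemma spread_expectation_prod_le:
  fixes c :: "'i \<Rightarrow> 'a set \<Rightarrow> real"
  assumes spread: "spread P V E p" and fin: "finite V" "finite E" and U: "U \<subseteq> V"
    and c: "\<And>i S. i \<in> E \<Longrightarrow> S \<subseteq> U \<Longrightarrow> c i S \<ge> 0"
  defines "X \<equiv> \<lambda>e. \<Prod>i\<in>E. \<Sum>S\<in>Pow U. c i S * of_bool (S \<subseteq> e i)"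
  shows "integrable (measure_pmf P) X"
    and "measure_pmf.expectation P X \<le> (\<Prod>i\<in>E. \<Sum>S\<in>Pow U. c i S * p ^ card S)"
proof -
  have finU: "finite U" using fin U finite_subset by blast
  let ?F = "PiE E (\<lambda>_. Pow U)"
  have finF: "finite ?F" using fin finU by (intro finite_PiE) auto
  have of_bool_prod: "(\<Prod>i\<in>E. of_bool (Q i)) = (of_bool (\<forall>i\<in>E. Q i) :: real)" for Q
    using fin(2) by (induction rule: finite_induct) auto
  have X: "X = (\<lambda>e. \<Sum>F\<in>?F. (\<Prod>i\<in>E. c i (F i)) * indicator {e. \<forall>i\<in>E. F i \<subseteq> e i} e)"
  proof
    fix e
    have "X e = (\<Sum>F\<in>?F. \<Prod>i\<in>E. c i (F i) * of_bool (F i \<subseteq> e i))"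
      unfolding X_def using fin finU by (intro prod_sum_PiE) auto
    also have "\<dots> = (\<Sum>F\<in>?F. (\<Prod>i\<in>E. c i (F i)) * indicator {e. \<forall>i\<in>E. F i \<subseteq> e i} e)"
      by (intro sum.cong) (auto simp: prod.distrib of_bool_prod indicator_def)
    finally show "X e = (\<Sum>F\<in>?F. (\<Prod>i\<in>E. c i (F i)) * indicator {e. \<forall>i\<in>E. F i \<subseteq> e i} e)" .
  qed
  have int: "integrable (measure_pmf P) (\<lambda>e. (\<Prod>i\<in>E. c i (F i)) * indicator {e. \<forall>i\<in>E. F i \<subseteq> e i} e)" for F
    using integrable_indicator_pmf by (intro integrable_mult_right) blast
  show "integrable (measure_pmf P) X" unfolding X by (intro Bochner_Integration.integrable_sum int)
  have "measure_pmf.expectation P X = 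
      (\<Sum>F\<in>?F. (\<Prod>i\<in>E. c i (F i)) * measure_pmf.prob P {e. \<forall>i\<in>E. F i \<subseteq> e i})"
    unfolding X by (subst Bochner_Integration.integral_sum[OF int]) simp
  also have "\<dots> \<le> (\<Sum>F\<in>?F. (\<Prod>i\<in>E. c i (F i)) * (\<Prod>i\<in>E. p ^ card (F i)))"
  proof (intro sum_mono mult_left_mono prod_nonneg)
    fix F assume F: "F \<in> ?F"
    hence Fi: "F i \<subseteq> U" if "i \<in> E" for i using that by (auto simp: PiE_def Pi_def)
    show "\<And>i. i \<in> E \<Longrightarrow> 0 \<le> c i (F i)" using c Fi by auto
    define S where "S = {(v, i). i \<in> E \<and> v \<in> F i}"
    have "S \<subseteq> V \<times> E" using Fi U by (auto simp: S_def)
    hence "measure_pmf.prob P {e. \<forall>(v, i)\<in>S. v \<in> e i} \<le> p ^ card S"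
      using spread by (auto simp: spread_def)
    also have "{e. \<forall>(v, i)\<in>S. v \<in> e i} = {e. \<forall>i\<in>E. F i \<subseteq> e i}" by (auto simp: S_def)
    also have "S = prod.swap ` (SIGMA i:E. F i)" by (auto simp: S_def image_iff)
    also have "card \<dots> = card (SIGMA i:E. F i)" by (intro card_image) auto
    also have "\<dots> = (\<Sum>i\<in>E. card (F i))"
      using fin Fi finU finite_subset by (intro card_SigmaI) blast+
    also have "p ^ \<dots> = (\<Prod>i\<in>E. p ^ card (F i))" by (simp add: power_sum)
    finally show "measure_pmf.prob P {e. \<forall>i\<in>E. F i \<subseteq> e i} \<le> (\<Prod>i\<in>E. p ^ card (F i))" .
  qed
  also have "\<dots> = (\<Sum>F\<in>?F. \<Prod>i\<in>E. c i (F i) * p ^ card (F i))" by (simp add: prod.distrib)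
  also have "\<dots> = (\<Prod>i\<in>E. \<Sum>S\<in>Pow U. c i S * p ^ card S)"
    using fin finU by (subst prod_sum_PiE) auto
  finally show "measure_pmf.expectation P X \<le> (\<Prod>i\<in>E. \<Sum>S\<in>Pow U. c i S * p ^ card S)" .
qed

lemma pmf_Markov:
  fixes X :: "'a \<Rightarrow> real"
  assumes "integrable (measure_pmf P) X" "\<And>x. X x \<ge> 0" "K > 0" "\<And>x. x \<in> A \<Longrightarrow> X x \<ge> K"
  shows "measure_pmf.prob P A \<le> measure_pmf.expectation P X / K"
proof -
  have "K * measure_pmf.prob P A = measure_pmf.expectation P (\<lambda>x. K * indicator A x)" by simp
  also have "\<dots> \<le> measure_pmf.expectation P X"
    using assms integrable_indicator_pmf[of P A]
    by (intro integral_mono integrable_mult_right) (auto simp: indicator_def)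
  finally show ?thesis using assms(3) by (simp add: field_simps)
qed

text \<open>The exponential moment of the total size at base \<open>2\<close>, because \<open>2 ^ card (e i \<inter> V)\<close> is the number of
subsets of \<open>V\<close> contained in \<open>e i\<close>.\<close>

lemma spread_prob_total_size_le:
  fixes P :: "('i \<Rightarrow> 'a set) pmf"
  assumes spread: "spread P V E p" and fin: "finite V" "finite E" and "F \<subseteq> E" "p \<ge> 0"
  shows "measure_pmf.prob P {e. real (\<Sum>i\<in>F. card (e i \<inter> V)) > s} \<le> exp (p * card V * card F) / 2 powr s"
proof -
  define c :: "'i \<Rightarrow> 'a set \<Rightarrow> real" where "c = (\<lambda>i S. of_bool (i \<in> F \<or> S = {}))"
  define X where "X = (\<lambda>e. \<Prod>i\<in>E. \<Sum>S\<in>Pow V. c i S * of_bool (S \<subseteq> e i))"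
  have finF: "finite F" using assms finite_subset by blast
  have X: "X e = 2 ^ (\<Sum>i\<in>F. card (e i \<inter> V))" for e
  proof -
    have "(\<Sum>S\<in>Pow V. c i S * of_bool (S \<subseteq> e i)) = (if i \<in> F then 2 ^ card (e i \<inter> V) else 1)" for i
    proof (cases "i \<in> F")
      case True
      hence "(\<Sum>S\<in>Pow V. c i S * of_bool (S \<subseteq> e i)) = (\<Sum>S\<in>Pow V. of_bool (S \<subseteq> e i))"
        by (simp add: c_def)
      also have "\<dots> = real (card (Pow V \<inter> {S. S \<subseteq> e i}))"
        using fin by (simp add: sum_of_bool_eq)
      also have "Pow V \<inter> {S. S \<subseteq> e i} = Pow (e i \<inter> V)" by auto
      also have "card (Pow (e i \<inter> V)) = 2 ^ card (e i \<inter> V)" using fin by (intro card_Pow) auto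
      finally show ?thesis using True by simp
    next
      case False
      hence "(\<Sum>S\<in>Pow V. c i S * of_bool (S \<subseteq> e i)) = (\<Sum>S\<in>{{}}. c i S * of_bool (S \<subseteq> e i))"
        using fin by (intro sum.mono_neutral_right) (auto simp: c_def)
      thus ?thesis using False by (simp add: c_def)
    qed
    hence "X e = (\<Prod>i\<in>E. if i \<in> F then 2 ^ card (e i \<inter> V) else 1)" by (simp add: X_def)
    also have "\<dots> = (\<Prod>i\<in>F. 2 ^ card (e i \<inter> V))"
      using fin assms(4) by (simp add: prod.If_cases Int_absorb1)
    finally show ?thesis by (simp add: power_sum)
  qed
  have rhs: "(\<Sum>S\<in>Pow V. c i S * p ^ card S) \<le> (if i \<in> F then exp (p * card V) else 1)" for i
  proof (cases "i \<in> F")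
    case True
    hence "(\<Sum>S\<in>Pow V. c i S * p ^ card S) = (1 + p) ^ card V"
      using fin by (simp add: c_def sum_Pow_power_card)
    also have "\<dots> \<le> exp p ^ card V" using assms by (intro power_mono) auto
    also have "\<dots> = exp (p * card V)" by (simp add: mult.commute flip: exp_of_nat_mult)
    finally show ?thesis using True by simp
  next
    case False
    hence "(\<Sum>S\<in>Pow V. c i S * p ^ card S) = (\<Sum>S\<in>{{}}. c i S * p ^ card S)"
      using fin by (intro sum.mono_neutral_right) (auto simp: c_def)
    thus ?thesis using False by (simp add: c_def)
  qed
  have "c i S \<ge> 0" for i S by (simp add: c_def)
  note ex = spread_expectation_prod_le[OF spread fin order.refl, of c, folded X_def, OF this]
  have "measure_pmf.expectation P X \<le> (\<Prod>i\<in>E. if i \<in> F then exp (p * card V) else 1)"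
    using rhs assms by (intro order.trans[OF ex(2)] prod_mono) (auto intro!: sum_nonneg simp: c_def)
  also have "\<dots> = exp (p * card V * card F)"
    using fin assms(4) by (simp add: prod.If_cases Int_absorb1 mult.commute flip: exp_of_nat_mult)
  finally have E: "measure_pmf.expectation P X \<le> exp (p * card V * card F)" .
  have "measure_pmf.prob P {e. real (\<Sum>i\<in>F. card (e i \<inter> V)) > s} \<le> measure_pmf.expectation P X / 2 powr s"
  proof (rule pmf_Markov[OF ex(1)])
    fix e assume "e \<in> {e. real (\<Sum>i\<in>F. card (e i \<inter> V)) > s}"
    hence "2 powr s \<le> 2 powr real (\<Sum>i\<in>F. card (e i \<inter> V))" by (intro powr_mono) auto
    also have "\<dots> = X e" unfolding X by (rule powr_realpow) simp
    finally show "2 powr s \<le> X e" .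
  qed (auto simp: X)
  also have "\<dots> \<le> exp (p * card V * card F) / 2 powr s" using E by (intro divide_right_mono) auto
  finally show ?thesis .
qed

text \<open>Two exponential weights are at work: \<open>\<theta>\<close> measures the total size \<open>b\<close> of the large traces, and \<open>z\<close> is the
Chernoff weight for the event that a single trace exceeds \<open>T\<close>.\<close>

lemma spread_prob_large_traces_le:
  fixes T \<theta> b z p :: real and P :: "('i \<Rightarrow> 'a set) pmf"
  assumes spread: "spread P V E p" and fin: "finite V" "finite E" and U: "U \<subseteq> V"
    and "p \<ge> 0" "T > 0" "z \<ge> 1" "\<theta> \<ge> 0"
  shows "measure_pmf.prob P {e. (\<Sum>i | i \<in> E \<and> real (trace_size e U i) > T. real (trace_size e U i)) > b}
     \<le> exp (card E * exp (z * p * exp \<theta> * card U) / z powr T - \<theta> * b)"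
proof -
  have finU: "finite U" using fin U finite_subset by blast
  define c :: "'i \<Rightarrow> 'a set \<Rightarrow> real" 
    where "c = (\<lambda>i S. if S = {} then 1 else if card S > T then exp (\<theta> * card S) else 0)"
  have c0: "c i S \<ge> 0" for i S by (simp add: c_def)
  define X where "X = (\<lambda>e. \<Prod>i\<in>E. \<Sum>S\<in>Pow U. c i S * of_bool (S \<subseteq> e i))"
  let ?W = "\<lambda>e. \<Sum>i | i \<in> E \<and> real (trace_size e U i) > T. real (trace_size e U i)"
  note ex = spread_expectation_prod_le[OF spread fin U, of c, folded X_def, OF c0]
  have X_ge: "exp (\<theta> * ?W e) \<le> X e" for e
  proof -
    have "\<theta> * ?W e = (\<Sum>i | i \<in> E \<and> real (trace_size e U i) > T. \<theta> * real (trace_size e U i))"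
      by (simp add: sum_distrib_left)
    also have "\<dots> = (\<Sum>i\<in>E. if real (trace_size e U i) > T then \<theta> * real (trace_size e U i) else 0)"
      using fin by (intro sum.inter_filter)
    finally have "exp (\<theta> * ?W e) = 
        (\<Prod>i\<in>E. exp (if real (trace_size e U i) > T then \<theta> * real (trace_size e U i) else 0))"
      using fin by (simp add: exp_sum)
    also have "\<dots> \<le> X e" unfolding X_def
    proof (intro prod_mono conjI)
      fix i assume i: "i \<in> E"
      \<comment> \<open>One term of the sum of nonnegative terms suffices.\<close>
      define S where "S = (if real (trace_size e U i) > T then e i \<inter> U else {})"
      have "exp (if real (trace_size e U i) > T then \<theta> * real (trace_size e U i) else 0) = 
          c i S * of_bool (S \<subseteq> e i)"
        using \<open>T > 0\<close> by (auto simp: S_def c_def trace_size_def)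
      also have "\<dots> \<le> (\<Sum>S\<in>Pow U. c i S * of_bool (S \<subseteq> e i))"
        using finU c0 by (intro member_le_sum) (auto simp: S_def)
      finally show "exp (if real (trace_size e U i) > T then \<theta> * real (trace_size e U i) else 0) \<le> 
          (\<Sum>S\<in>Pow U. c i S * of_bool (S \<subseteq> e i))" .
    qed auto
    finally show ?thesis .
  qed
  define R where "R = exp (z * p * exp \<theta> * card U) / z powr T"
  have factor: "(\<Sum>S\<in>Pow U. c i S * p ^ card S) \<le> exp R" for i
  proof -
    have "(\<Sum>S\<in>Pow U. c i S * p ^ card S) \<le> (\<Sum>S\<in>Pow U. of_bool (S = {}) + (z * p * exp \<theta>) ^ card S / z powr T)"
    proof (rule sum_mono)
      fix S assume "S \<in> Pow U"
      have nn: "0 \<le> (z * p * exp \<theta>) ^ card S / z powr T" using assms by simp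
      show "c i S * p ^ card S \<le> of_bool (S = {}) + (z * p * exp \<theta>) ^ card S / z powr T"
      proof (cases "S \<noteq> {} \<and> card S > T")
        case True
        have "z powr T \<le> z powr card S" using True assms by (intro powr_mono) auto
        also have "\<dots> = z ^ card S" using assms by (simp add: powr_realpow)
        finally have "1 \<le> z ^ card S / z powr T" using assms by simp
        hence "(p * exp \<theta>) ^ card S * 1 \<le> (p * exp \<theta>) ^ card S * (z ^ card S / z powr T)"
          using assms by (intro mult_left_mono) auto
        also have "\<dots> = (z * p * exp \<theta>) ^ card S / z powr T" by (simp add: power_mult_distrib mult_ac)
        finally have "(p * exp \<theta>) ^ card S \<le> (z * p * exp \<theta>) ^ card S / z powr T" by simp
        moreover have "exp (\<theta> * card S) = exp \<theta> ^ card S" by (simp add: mult.commute flip: exp_of_nat_mult)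
        ultimately show ?thesis using True by (simp add: c_def power_mult_distrib mult_ac)
      qed (use nn in \<open>auto simp: c_def\<close>)
    qed
    also have "\<dots> = 1 + (\<Sum>S\<in>Pow U. (z * p * exp \<theta>) ^ card S) / z powr T"
    proof -
      have "Pow U \<inter> {S. S = {}} = {{}}" by auto
      hence "(\<Sum>S\<in>Pow U. of_bool (S = {})) = (1 :: real)"
        using finU by (subst sum_of_bool_eq) auto
      thus ?thesis by (simp only: sum.distrib sum_divide_distrib)
    qed
    also have "(\<Sum>S\<in>Pow U. (z * p * exp \<theta>) ^ card S) = (1 + z * p * exp \<theta>) ^ card U"
      using finU by (rule sum_Pow_power_card)
    also have "\<dots> \<le> exp (z * p * exp \<theta>) ^ card U"
      using assms by (intro power_mono) (auto intro: add_nonneg_nonneg)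
    also have "\<dots> = exp (z * p * exp \<theta> * card U)" by (simp add: mult.commute flip: exp_of_nat_mult)
    finally have "(\<Sum>S\<in>Pow U. c i S * p ^ card S) \<le> 1 + R"
      by (simp add: R_def divide_right_mono)
    thus ?thesis using exp_ge_add_one_self[of R] by linarith
  qed
  have "measure_pmf.expectation P X \<le> (\<Prod>i\<in>E. exp R)"
    using factor assms c0 by (intro order.trans[OF ex(2)] prod_mono) (auto intro!: sum_nonneg)
  also have "\<dots> = exp (card E * R)" by (simp flip: exp_of_nat_mult)
  finally have E: "measure_pmf.expectation P X \<le> exp (card E * R)" .
  have "measure_pmf.prob P {e. ?W e > b} \<le> measure_pmf.expectation P X / exp (\<theta> * b)"
  proof (rule pmf_Markov[OF ex(1)])
    fix e assume "e \<in> {e. ?W e > b}"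
    hence "exp (\<theta> * b) \<le> exp (\<theta> * ?W e)" using \<open>\<theta> \<ge> 0\<close> by (auto intro: mult_left_mono)
    thus "exp (\<theta> * b) \<le> X e" using X_ge[of e] by linarith
  qed (auto simp: X_def intro!: prod_nonneg sum_nonneg mult_nonneg_nonneg c0)
  also have "\<dots> \<le> exp (card E * R) / exp (\<theta> * b)" using E by (intro divide_right_mono) auto
  finally show ?thesis by (simp add: R_def exp_diff)
qed

text \<open>A union bound over all \<open>U\<close>. With \<open>y = card V / card U\<close>, the choice \<open>exp \<theta> = exp 1 * y powr (1/4)\<close> makes a
single set fail with probability at most \<open>(1/y) ^ (2 u) * exp (- 7 u)\<close>, where \<open>u = card U\<close>. One factor \<open>(1/y) ^ u\<close>
and a factor \<open>exp (- u)\<close> compensate for the number of sets of that size, because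
\<open>(card V choose u) * (1/y) ^ u \<le> (1 + 1/y) ^ card V \<le> exp u\<close>. The other factor \<open>(1/y) ^ u\<close> is at most
\<open>u / card V\<close>, which makes the whole sum as small as \<open>1 / card V\<close>.\<close>

lemma spread_prob_some_large_traces_le:
  fixes \<tau> \<alpha> p :: real and P :: "('i \<Rightarrow> 'a set) pmf"
  assumes spread: "spread P V E p" and fin: "finite V" "finite E" and V: "V \<noteq> {}"
    and "p \<ge> 0" and \<tau>: "\<tau> \<ge> 4" "\<tau> \<ge> ln (card E / card V)" and \<alpha>: "\<alpha> = exp 3 * p * card V"
    and mn: "card V \<le> card E"
  shows "measure_pmf.prob P {e. \<exists>U\<subseteq>V. U \<noteq> {} \<and>
      (\<Sum>i | i \<in> E \<and> real (trace_size e U i) > max \<tau> (\<alpha> * sqrt (card U / card V)). real (trace_size e U i)) > 8 * card U}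
     \<le> 1 / card V"
proof -
  let ?n = "real (card V)" and ?m = "real (card E)"
  have n: "?n > 0" using V fin by (simp add: card_gt_0_iff)
  define bad where "bad = (\<lambda>U :: 'a set. {e. 
      (\<Sum>i | i \<in> E \<and> real (trace_size e U i) > max \<tau> (\<alpha> * sqrt (card U / card V)). real (trace_size e U i)) > 8 * real (card U)})"
  have single: "measure_pmf.prob P (bad U) \<le> (card U / ?n) ^ (2 * card U) * exp (- 7 * real (card U))"
    if U: "U \<subseteq> V" "U \<noteq> {}" for U
  proof -
    let ?u = "real (card U)"
    have finU: "finite U" using fin U finite_subset by blast
    have u: "0 < ?u" "?u \<le> ?n" using U finU card_mono[OF fin(1) U(1)] by (auto simp: card_gt_0_iff)
    define y where "y = ?n / ?u"
    have y: "y \<ge> 1" "y > 0" using u n by (auto simp: y_def field_simps)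
    define T where "T = max \<tau> (\<alpha> * sqrt (?u / ?n))"
    \<comment> \<open>Both weights grow like \<open>y powr (1/4)\<close>: then \<open>z * exp \<theta>\<close> is compensated by the factor \<open>sqrt y\<close> by which
      the threshold exceeds the mean trace, and \<open>z powr T\<close> still beats \<open>m y / n\<close>.\<close>
    define \<theta> where "\<theta> = ln y / 4 + 1"
    define z where "z = exp 2 * y powr (1/4)"
    have "\<theta> \<ge> 0" using y by (simp add: \<theta>_def)
    have "y powr (1/4) \<ge> 1" using y by (simp add: ge_one_powr_ge_zero)
    hence "z \<ge> 1 * 1" unfolding z_def by (intro mult_mono) auto
    hence z: "z \<ge> 1" by simp
    have T: "T \<ge> 4" "T \<ge> ln (?m / ?n)" "T > 0" using \<tau> by (auto simp: T_def)
    have "exp \<theta> = exp 1 * y powr (1/4)" using y by (simp add: \<theta>_def powr_def exp_add mult.commute)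
    hence "z * p * exp \<theta> * ?u = exp 3 * p * (y powr (1/4) * y powr (1/4)) * ?u"
      by (simp add: z_def mult_ac flip: exp_add)
    also have "y powr (1/4) * y powr (1/4) = sqrt y" using y by (simp add: powr_half_sqrt flip: powr_add)
    also have "exp 3 * p * sqrt y * ?u = \<alpha> * (sqrt y * (1 / y))"
      using u n by (simp add: \<alpha> y_def)
    also have "sqrt y * (1 / y) = sqrt (1 / y)" using y 
      by (simp add: real_sqrt_divide real_div_sqrt field_simps)
    also have "\<alpha> * sqrt (1 / y) \<le> T" by (simp add: T_def y_def)
    finally have zq: "z * p * exp \<theta> * ?u \<le> T" .
    have zT: "z powr T = exp (2 * T) * y powr (T / 4)"
      by (simp add: z_def powr_mult powr_powr exp_powr_real)
    have "?m * exp (z * p * exp \<theta> * ?u) / z powr T \<le> ?m * exp T / (exp (2 * T) * y powr (T / 4))"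
      unfolding zT using zq by (intro divide_right_mono mult_left_mono) auto
    also have "?m * exp T / (exp (2 * T) * y powr (T / 4)) = ?m * (exp (- T) / y powr (T / 4))"
    proof -
      have "exp (2 * T) = exp T * exp T" by (simp flip: exp_add)
      thus ?thesis by (simp add: exp_minus field_simps)
    qed
    also have "\<dots> \<le> ?m * ((?n / ?m) / y)"
    proof (intro mult_left_mono frac_le)
      have "exp (ln (?m / ?n)) \<le> exp T" using T by simp
      hence "?m / ?n \<le> exp T" using n mn by (subst (asm) exp_ln) auto
      thus "exp (- T) \<le> ?n / ?m" using n mn by (simp add: exp_minus field_simps)
      have "y powr 1 \<le> y powr (T / 4)" using T y by (intro powr_mono) auto
      thus "y \<le> y powr (T / 4)" using y by simp
    qed (use y n in auto)
    also have "\<dots> = ?u" using n mn u by (simp add: y_def field_simps)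
    finally have 1: "?m * exp (z * p * exp \<theta> * ?u) / z powr T \<le> ?u" .
    have "measure_pmf.prob P (bad U) \<le> exp (?m * exp (z * p * exp \<theta> * ?u) / z powr T - \<theta> * (8 * ?u))"
      unfolding bad_def T_def[symmetric]
      using spread_prob_large_traces_le[OF spread fin U(1) \<open>p \<ge> 0\<close> T(3) z \<open>\<theta> \<ge> 0\<close>, of "8 * ?u"] by simp
    also have "\<dots> \<le> exp (?u - \<theta> * (8 * ?u))" using 1 by simp
    also have "?u - \<theta> * (8 * ?u) = (2 * ?u) * (- ln y) + (- 7 * ?u)" by (simp add: \<theta>_def algebra_simps)
    also have "exp \<dots> = exp (- ln y) powr (2 * ?u) * exp (- 7 * ?u)" by (simp only: exp_add exp_powr_real mult.commute)
    also have "exp (- ln y) = ?u / ?n" using y by (simp add: exp_minus y_def)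
    also have "(?u / ?n) powr (2 * ?u) = (?u / ?n) ^ (2 * card U)"
      using u n by (simp flip: powr_realpow)
    finally show ?thesis .
  qed
  let ?A = "\<lambda>k. {U. U \<subseteq> V \<and> card U = k}"
  have finA: "finite (?A k)" for k using fin by auto
  have level: "measure_pmf.prob P (\<Union>U\<in>?A k. bad U) \<le> 1 / ?n * (1/2) ^ k" if k: "k \<in> {1..card V}" for k
  proof -
    have kr: "1 \<le> real k" "real k \<le> ?n" using k by auto
    have "measure_pmf.prob P (\<Union>U\<in>?A k. bad U) \<le> (\<Sum>U\<in>?A k. measure_pmf.prob P (bad U))"
      by (intro measure_pmf.finite_measure_subadditive_finite finA) auto
    also have "\<dots> \<le> (\<Sum>U\<in>?A k. (k / ?n) ^ card U * ((k / ?n) ^ k * exp (- 7 * real k)))"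
    proof (rule sum_mono)
      fix U assume "U \<in> ?A k"
      hence "U \<subseteq> V" "card U = k" "U \<noteq> {}" using k by auto
      thus "measure_pmf.prob P (bad U) \<le> (k / ?n) ^ card U * ((k / ?n) ^ k * exp (- 7 * real k))"
        using single[of U] by (simp add: mult_2 power_add mult.assoc)
    qed
    also have "\<dots> = (\<Sum>U\<in>?A k. (k / ?n) ^ card U) * ((k / ?n) ^ k * exp (- 7 * real k))"
      by (rule sum_distrib_right[symmetric])
    also have "(\<Sum>U\<in>?A k. (k / ?n) ^ card U) \<le> (\<Sum>U\<in>Pow V. (k / ?n) ^ card U)"
      using fin n by (intro sum_mono2) auto
    also have "\<dots> = (1 + k / ?n) ^ card V" using fin by (intro sum_Pow_power_card)
    also have "\<dots> \<le> exp (k / ?n) ^ card V" using n by (intro power_mono) (auto intro: add_nonneg_nonneg)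
    also have "\<dots> = exp k" using n by (simp flip: exp_of_nat_mult)
    also have "(k / ?n) ^ k \<le> (k / ?n) ^ 1" using kr k n by (intro power_decreasing) auto
    also have "real k / ?n \<le> exp k / ?n" 
      using exp_ge_add_one_self[of "real k"] n by (intro divide_right_mono) linarith+
    finally have "measure_pmf.prob P (\<Union>U\<in>?A k. bad U) \<le> exp k * ((exp k / ?n) * exp (- 7 * real k))"
      by (simp add: mult_right_mono)
    also have "\<dots> = 1 / ?n * exp (- 5 * real k)" by (simp add: mult_ac flip: exp_add)
    also have "exp (- 5 * real k) = exp (- 5) ^ k" by (simp add: mult.commute flip: exp_of_nat_mult)
    also have "\<dots> \<le> (1/2) ^ k"
    proof (intro power_mono)
      have "2 \<le> exp (5::real)" using exp_ge_add_one_self[of "5::real"] by linarith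
      thus "exp (- 5) \<le> (1/2 :: real)" by (simp add: exp_minus field_simps)
    qed auto
    finally show ?thesis using n by (simp add: mult_left_mono divide_right_mono)
  qed
  have "{e. \<exists>U\<subseteq>V. U \<noteq> {} \<and>
      (\<Sum>i | i \<in> E \<and> real (trace_size e U i) > max \<tau> (\<alpha> * sqrt (card U / card V)). real (trace_size e U i)) > 8 * card U}
      \<subseteq> (\<Union>k\<in>{1..card V}. \<Union>U\<in>?A k. bad U)"
  proof (rule subsetI, drule CollectD, elim exE conjE)
    fix e U assume U: "U \<subseteq> V" "U \<noteq> {}" and
      b: "(\<Sum>i | i \<in> E \<and> real (trace_size e U i) > max \<tau> (\<alpha> * sqrt (card U / card V)). real (trace_size e U i)) > 8 * card U"
    have "finite U" using fin U finite_subset by blast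
    hence "card U \<in> {1..card V}" using U card_mono[OF fin(1) U(1)] by (auto simp: Suc_le_eq card_gt_0_iff)
    moreover have "e \<in> bad U" using b by (simp add: bad_def)
    ultimately show "e \<in> (\<Union>k\<in>{1..card V}. \<Union>U\<in>?A k. bad U)" using U by blast
  qed
  hence "measure_pmf.prob P {e. \<exists>U\<subseteq>V. U \<noteq> {} \<and>
      (\<Sum>i | i \<in> E \<and> real (trace_size e U i) > max \<tau> (\<alpha> * sqrt (card U / card V)). real (trace_size e U i)) > 8 * card U}
    \<le> measure_pmf.prob P (\<Union>k\<in>{1..card V}. \<Union>U\<in>?A k. bad U)"
    by (intro measure_pmf.finite_measure_mono) auto
  also have "\<dots> \<le> (\<Sum>k\<in>{1..card V}. measure_pmf.prob P (\<Union>U\<in>?A k. bad U))"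
    by (intro measure_pmf.finite_measure_subadditive_finite) auto
  also have "\<dots> \<le> (\<Sum>k\<in>{1..card V}. 1 / ?n * (1/2) ^ k)" by (intro sum_mono level)
  also have "\<dots> = 1 / ?n * (\<Sum>k\<in>{1..card V}. (1/2) ^ k)" by (simp add: sum_distrib_left)
  also have "\<dots> \<le> 1 / ?n * 1"
  proof (intro mult_left_mono)
    have "(\<Sum>k\<in>{1..N}. (1/2) ^ k) = 1 - (1/2::real) ^ N" for N by (induction N) auto
    thus "(\<Sum>k\<in>{1..card V}. (1/2) ^ k) \<le> (1::real)" by simp
  qed auto
  finally show ?thesis by simp
qed

section \<open>Anticoncentration of signed Bernoulli sums\<close>

text \<open>Taking expectations turns this into a lower bound for an upper tail: if \<open>z\<close> has mean \<open>0\<close>, variance \<open>1\<close>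
and fourth moment at most \<open>4\<close>, the left-hand side has mean at least \<open>1/32\<close>. The linear term is there to
outweigh \<open>z\<^sup>2\<close> for negative \<open>z\<close>.\<close>

lemma quartic_minorant:
  fixes z :: real
  shows "(1/8) * (5/4 * z + z\<^sup>2 - z ^ 4 / 8 - 1/4) \<le> of_bool (z \<ge> 1/8)"
proof (cases "z < 0")
  case True
  define v where "v = - z / 2"
  have "v > 0" using True by (simp add: v_def)
  \<comment> \<open>The cubic touches the axis near \<open>v = sqrt (2/3)\<close>, for which \<open>41/50\<close> is a convenient approximation.\<close>
  have tangent: "(v - s)\<^sup>2 * (v + 2 * s) = v ^ 3 - 3 * s\<^sup>2 * v + 2 * s ^ 3" for s
    by (simp add: power2_eq_square power3_eq_cube algebra_simps)
  have "0 \<le> (v - 41/50)\<^sup>2 * (v + 2 * (41/50))" using \<open>v > 0\<close> by (intro mult_nonneg_nonneg) auto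
  also have "\<dots> = v ^ 3 - 3 * (41/50)\<^sup>2 * v + 2 * (41/50) ^ 3" by (rule tangent)
  also have "\<dots> = v ^ 3 - 5043/2500 * v + 68921/62500" by (simp add: power2_eq_square power3_eq_cube)
  finally have "v ^ 3 - 2 * v + 5/4 \<ge> 0" using \<open>v > 0\<close> by linarith
  hence "2 * v * (v ^ 3 - 2 * v + 5/4) \<ge> 0" using \<open>v > 0\<close> by simp
  also have "2 * v * (v ^ 3 - 2 * v + 5/4) = - (5/4 * z + z\<^sup>2 - z ^ 4 / 8)"
    by (simp add: v_def power2_eq_square power3_eq_cube power4_eq_xxxx algebra_simps)
  finally show ?thesis using True by simp
next
  case False
  show ?thesis
  proof (cases "z \<ge> 1/8")
    case True
    have 1: "(z\<^sup>2 - 13/2)\<^sup>2 \<ge> 0" "(z - 1)\<^sup>2 \<ge> 0" by auto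
    have "z ^ 4 = (z\<^sup>2)\<^sup>2" by (simp flip: power_mult)
    hence "5/4 * z + z\<^sup>2 - z ^ 4 / 8 - 1/4 \<le> 8"
      using 1 by (simp add: power2_diff power_divide)
    thus ?thesis using True by simp
  next
    case F2: False
    have "z\<^sup>2 \<le> (1/8)\<^sup>2" using False F2 by (intro power_mono) auto
    moreover have "z ^ 4 \<ge> 0" by simp
    moreover have "(1/8 :: real)\<^sup>2 = 1/64" by (simp add: power2_eq_square)
    ultimately have "5/4 * z + z\<^sup>2 - z ^ 4 / 8 - 1/4 \<le> 0" using F2 by linarith
    thus ?thesis using F2 by simp
  qed
qed

abbreviation coins :: "'a set \<Rightarrow> ('a \<Rightarrow> real) \<Rightarrow> ('a \<Rightarrow> bool) pmf" where
  "coins A q \<equiv> Pi_pmf A False (\<lambda>v. bernoulli_pmf (q v))"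

lemma finite_set_coins: "finite A \<Longrightarrow> finite (set_pmf (coins A q))"
  by (rule finite_subset[OF set_Pi_pmf_subset'[of A False]]) auto

lemma integrable_coins: "finite A \<Longrightarrow> integrable (measure_pmf (coins A q)) (f :: _ \<Rightarrow> real)"
  by (intro integrable_measure_pmf_finite finite_set_coins)

lemma expectation_coins_insert:
  fixes f :: "('a \<Rightarrow> bool) \<Rightarrow> real"
  assumes "finite A" "x \<notin> A" "0 \<le> q x" "q x \<le> 1"
  shows "measure_pmf.expectation (coins (insert x A) q) f = 
     q x * measure_pmf.expectation (coins A q) (\<lambda>X. f (X(x := True))) +
     (1 - q x) * measure_pmf.expectation (coins A q) (\<lambda>X. f (X(x := False)))"
proof -
  have eq: "coins (insert x A) q = bernoulli_pmf (q x) \<bind> (\<lambda>y. map_pmf (\<lambda>X. X(x := y)) (coins A q))"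
    using assms by (simp add: Pi_pmf_insert' map_pmf_def)
  show ?thesis unfolding eq
    by (subst pmf_expectation_bind[of UNIV]) 
       (use assms in \<open>auto simp: UNIV_bool finite_set_coins\<close>)
qed

definition deviation :: "'a set \<Rightarrow> ('a \<Rightarrow> real) \<Rightarrow> ('a \<Rightarrow> real) \<Rightarrow> ('a \<Rightarrow> bool) \<Rightarrow> real" where
  "deviation A q a X = (\<Sum>v\<in>A. a v * (of_bool (X v) - q v))"

lemma deviation_insert:
  assumes "finite A" "x \<notin> A"
  shows "deviation (insert x A) q a (X(x := b)) = a x * (of_bool b - q x) + deviation A q a X"
  unfolding deviation_def using assms by (subst sum.insert) (auto intro!: sum.cong)

text \<open>Adding an independent centred term \<open>Z\<close> with \<open>\<bar>Z\<bar> \<le> 1\<close> to \<open>Y\<close> increases the fourth moment by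
\<open>6 E Y\<^sup>2 E Z\<^sup>2 + E Z ^ 4\<close>, and \<open>E Z ^ 4 \<le> E Z\<^sup>2\<close>.\<close>

lemma deviation_moments:
  fixes q a :: "'a \<Rightarrow> real"
  assumes "finite A" "\<And>v. v \<in> A \<Longrightarrow> 0 \<le> q v \<and> q v \<le> 1" "\<And>v. v \<in> A \<Longrightarrow> a v = 1 \<or> a v = -1"
  defines "Var \<equiv> \<lambda>A. \<Sum>v\<in>A. q v * (1 - q v)"
  shows "measure_pmf.expectation (coins A q) (deviation A q a) = 0 \<and>
    measure_pmf.expectation (coins A q) (\<lambda>X. (deviation A q a X)\<^sup>2) = Var A \<and>
    measure_pmf.expectation (coins A q) (\<lambda>X. (deviation A q a X) ^ 4) \<le> 3 * (Var A)\<^sup>2 + Var A"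
  using assms(1-3)
proof (induction rule: finite_induct)
  case empty
  thus ?case by (simp add: deviation_def Var_def)
next
  case (insert x A)
  let ?E = "measure_pmf.expectation (coins A q)" and ?Y = "deviation A q a"
  define E3 where "E3 = ?E (\<lambda>X. (?Y X) ^ 3)"
  define E4 where "E4 = ?E (\<lambda>X. (?Y X) ^ 4)"
  have IH: "?E ?Y = 0" "?E (\<lambda>X. (?Y X)\<^sup>2) = Var A" "E4 \<le> 3 * (Var A)\<^sup>2 + Var A"
    using insert.IH insert.prems by (auto simp: E4_def)
  have q: "0 \<le> q x" "q x \<le> 1" and a: "a x = 1 \<or> a x = -1" using insert.prems by auto
  have Var: "Var (insert x A) = q x * (1 - q x) + Var A" using insert.hyps by (simp add: Var_def)
  have int: "integrable (measure_pmf (coins A q)) f" for f :: "_ \<Rightarrow> real"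
    using insert.hyps by (intro integrable_coins)
  have E1: "?E (\<lambda>X. c + ?Y X) = c" for c
    using IH int by (subst Bochner_Integration.integral_add) auto
  have E2: "?E (\<lambda>X. (c + ?Y X)\<^sup>2) = c\<^sup>2 + Var A" for c
  proof -
    have "(\<lambda>X. (c + ?Y X)\<^sup>2) = (\<lambda>X. c\<^sup>2 + ((2 * c) * ?Y X + (?Y X)\<^sup>2))"
      by (simp add: power2_eq_square algebra_simps)
    hence "?E (\<lambda>X. (c + ?Y X)\<^sup>2) = ?E (\<lambda>X. c\<^sup>2 + ((2 * c) * ?Y X + (?Y X)\<^sup>2))" by simp
    also have "\<dots> = c\<^sup>2 + ((2 * c) * ?E ?Y + ?E (\<lambda>X. (?Y X)\<^sup>2))"
      by (simp add: Bochner_Integration.integral_add int)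
    finally show ?thesis using IH by simp
  qed
  have E4': "?E (\<lambda>X. (c + ?Y X) ^ 4) = c ^ 4 + 6 * c\<^sup>2 * Var A + 4 * c * E3 + E4" for c
  proof -
    have "(\<lambda>X. (c + ?Y X) ^ 4) = (\<lambda>X. c ^ 4 + ((4 * c ^ 3) * ?Y X + ((6 * c\<^sup>2) * (?Y X)\<^sup>2 + ((4 * c) * (?Y X) ^ 3 + (?Y X) ^ 4))))"
      by (simp add: power2_eq_square power3_eq_cube power4_eq_xxxx algebra_simps)
    hence "?E (\<lambda>X. (c + ?Y X) ^ 4) = ?E (\<lambda>X. c ^ 4 + ((4 * c ^ 3) * ?Y X + ((6 * c\<^sup>2) * (?Y X)\<^sup>2 + ((4 * c) * (?Y X) ^ 3 + (?Y X) ^ 4))))" by simp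
    also have "\<dots> = c ^ 4 + ((4 * c ^ 3) * ?E ?Y + ((6 * c\<^sup>2) * ?E (\<lambda>X. (?Y X)\<^sup>2) + ((4 * c) * E3 + E4)))"
      by (simp add: Bochner_Integration.integral_add int E3_def E4_def)
    finally show ?thesis using IH by simp
  qed
  let ?p = "q x" and ?E' = "measure_pmf.expectation (coins (insert x A) q)"
  have ins: "?E' (\<lambda>X. f (deviation (insert x A) q a X)) = 
      ?p * ?E (\<lambda>X. f (a x * (1 - ?p) + ?Y X)) + (1 - ?p) * ?E (\<lambda>X. f (a x * (0 - ?p) + ?Y X))"
    for f :: "real \<Rightarrow> real"
    using insert.hyps q by (subst expectation_coins_insert) (auto simp: deviation_insert)
  have 1: "?E' (deviation (insert x A) q a) = 0"
    using ins[of "\<lambda>y. y"] unfolding E1 by (simp add: algebra_simps)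
  have aa: "a x * a x = 1" using a by auto
  have 2: "?E' (\<lambda>X. (deviation (insert x A) q a X)\<^sup>2) = Var (insert x A)"
    unfolding ins[of "\<lambda>y. y\<^sup>2"] E2 Var power_mult_distrib using aa
    by (simp add: power2_eq_square algebra_simps)
  have "?E' (\<lambda>X. (deviation (insert x A) q a X) ^ 4) = 
      ?p * (1 - ?p) * ((1 - ?p) ^ 3 + ?p ^ 3) + 6 * (?p * (1 - ?p)) * Var A + E4"
  proof -
    have a4: "a x ^ 4 = 1" "(a x)\<^sup>2 = 1" using a by auto
    show ?thesis unfolding ins[of "\<lambda>y. y ^ 4"] E4' power_mult_distrib a4
      by (simp add: power2_eq_square power3_eq_cube power4_eq_xxxx algebra_simps)
  qed
  also have "\<dots> \<le> ?p * (1 - ?p) * 1 + 6 * (?p * (1 - ?p)) * Var A + (3 * (Var A)\<^sup>2 + Var A)"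
  proof (intro add_mono mult_left_mono IH)
    have "(1 - ?p) ^ 3 \<le> (1 - ?p) ^ 1" "?p ^ 3 \<le> ?p ^ 1" using q by (intro power_decreasing; simp)+
    thus "(1 - ?p) ^ 3 + ?p ^ 3 \<le> 1" by simp
  qed (use q in auto)
  also have "\<dots> \<le> 3 * (Var (insert x A))\<^sup>2 + Var (insert x A)"
    unfolding Var using zero_le_power2[of "?p * (1 - ?p)"] by (simp add: power2_eq_square algebra_simps)
  finally show ?case using 1 2 by simp
qed

text \<open>Take expectations in the quartic minorant at the normalised deviation.\<close>

lemma deviation_lower_tail:
  fixes q a :: "'a \<Rightarrow> real"
  assumes "finite A" "\<And>v. v \<in> A \<Longrightarrow> 0 \<le> q v \<and> q v \<le> 1" "\<And>v. v \<in> A \<Longrightarrow> a v = 1 \<or> a v = -1"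
    and v: "(\<Sum>v\<in>A. q v * (1 - q v)) \<ge> w" "w \<ge> 1"
  shows "measure_pmf.prob (coins A q) {X. deviation A q a X \<ge> sqrt w / 8} \<ge> 1/32"
proof -
  define s where "s = (\<Sum>v\<in>A. q v * (1 - q v))"
  have s: "s \<ge> 1" "s \<ge> w" using v by (auto simp: s_def)
  let ?E = "measure_pmf.expectation (coins A q)" and ?Y = "deviation A q a"
  have int: "integrable (measure_pmf (coins A q)) f" for f :: "_ \<Rightarrow> real"
    using assms by (intro integrable_coins)
  have mom: "?E ?Y = 0" "?E (\<lambda>X. (?Y X)\<^sup>2) = s" "?E (\<lambda>X. (?Y X) ^ 4) \<le> 3 * s\<^sup>2 + s"
    using deviation_moments[of A q a, folded s_def] assms by auto
  have "1/32 \<le> (1/8) * (5/4 * 0 + 1 - 4/8 - 1/4 :: real)" by simp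
  also have "\<dots> \<le> (1/8) * (5/4 * (?E ?Y / sqrt s) + ?E (\<lambda>X. (?Y X)\<^sup>2) / s - ?E (\<lambda>X. (?Y X) ^ 4) / s\<^sup>2 / 8 - 1/4)"
  proof -
    have "?E (\<lambda>X. (?Y X) ^ 4) / s\<^sup>2 \<le> (3 * s\<^sup>2 + s) / s\<^sup>2" using mom by (intro divide_right_mono) auto
    also have "\<dots> = 3 + 1 / s" using s by (simp add: field_simps power2_eq_square)
    also have "\<dots> \<le> 4" using s by simp
    finally show ?thesis using mom s by simp
  qed
  also have "\<dots> = ?E (\<lambda>X. (1/8) * (5/4 * (?Y X / sqrt s) + (?Y X)\<^sup>2 / s - (?Y X) ^ 4 / s\<^sup>2 / 8 - 1/4))"
    by (simp add: int)
  also have "\<dots> \<le> ?E (\<lambda>X. indicator {X. ?Y X \<ge> sqrt w / 8} X)"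
  proof (rule integral_mono[OF int int])
    fix X
    define z where "z = ?Y X / sqrt s"
    have "z\<^sup>2 = (?Y X)\<^sup>2 / s" using s by (simp add: z_def power_divide)
    moreover have "(sqrt s) ^ 4 = ((sqrt s)\<^sup>2)\<^sup>2" by (simp flip: power_mult)
    hence "z ^ 4 = (?Y X) ^ 4 / s\<^sup>2" using s by (simp add: z_def power_divide)
    ultimately have "(1/8) * (5/4 * (?Y X / sqrt s) + (?Y X)\<^sup>2 / s - (?Y X) ^ 4 / s\<^sup>2 / 8 - 1/4) \<le> of_bool (z \<ge> 1/8)"
      using quartic_minorant[of z] by (simp add: z_def)
    also have "\<dots> \<le> indicator {X. ?Y X \<ge> sqrt w / 8} X"
    proof -
      have "sqrt w / 8 \<le> sqrt s / 8" using s by simp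
      also have "z \<ge> 1/8 \<Longrightarrow> sqrt s / 8 \<le> ?Y X" using s by (simp add: z_def field_simps)
      finally show ?thesis by (auto simp: indicator_def)
    qed
    finally show "(1/8) * (5/4 * (?Y X / sqrt s) + (?Y X)\<^sup>2 / s - (?Y X) ^ 4 / s\<^sup>2 / 8 - 1/4) \<le> 
        indicator {X. ?Y X \<ge> sqrt w / 8} X" .
  qed
  finally show ?thesis by simp
qed

lemma prob_pair_pmf_Times:
  "measure_pmf.prob (pair_pmf M N) (A \<times> B) = measure_pmf.prob M A * measure_pmf.prob N B"
proof -
  have "measure_pmf.prob (pair_pmf M N) (A \<times> B) = 
      measure_pmf.prob (pair_pmf M N) ((A \<inter> set_pmf M) \<times> (B \<inter> set_pmf N))"
    by (subst measure_Int_set_pmf[symmetric]) (auto intro!: arg_cong[of _ _ "measure_pmf.prob _"])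
  also have "\<dots> = measure_pmf.prob M (A \<inter> set_pmf M) * measure_pmf.prob N (B \<inter> set_pmf N)"
    by (intro measure_pmf_prob_product countable_Int2) auto
  finally show ?thesis by (simp add: measure_Int_set_pmf)
qed

lemma subset_sum_in_window:
  fixes f :: "'a \<Rightarrow> real"
  assumes "finite A" "\<And>x. x \<in> A \<Longrightarrow> f x \<le> 1" "w \<le> (\<Sum>x\<in>A. f x)" "w \<ge> 0"
  obtains B where "B \<subseteq> A" "w \<le> (\<Sum>x\<in>B. f x)" "(\<Sum>x\<in>B. f x) \<le> w + 1"
proof -
  have "\<exists>B\<subseteq>A. w \<le> (\<Sum>x\<in>B. f x) \<and> (\<Sum>x\<in>B. f x) \<le> w + 1"
    using assms
  proof (induction rule: finite_induct)
    case (insert x A)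
    show ?case
    proof (cases "w \<le> (\<Sum>x\<in>A. f x)")
      case True
      thus ?thesis using insert by (meson insertCI subset_insertI2)
    next
      case False
      thus ?thesis using insert.prems insert.hyps by (intro exI[of _ "insert x A"]) force
    qed
  qed auto
  thus ?thesis using that by blast
qed

text \<open>Split off blocks of variance between \<open>w\<close> and \<open>w + 1\<close>, and ask all of them to deviate upwards. The
variables in different blocks are independent, so the probabilities multiply while the deviations add.\<close>

lemma deviation_block_tail:
  fixes q a :: "'a \<Rightarrow> real"
  assumes "finite A" "\<And>v. v \<in> A \<Longrightarrow> 0 \<le> q v \<and> q v \<le> 1" "\<And>v. v \<in> A \<Longrightarrow> a v = 1 \<or> a v = -1"
    and "(\<Sum>v\<in>A. q v * (1 - q v)) \<ge> real (Suc r) * (w + 1)" "w \<ge> 1"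
  shows "measure_pmf.prob (coins A q) {X. deviation A q a X \<ge> real (Suc r) * (sqrt w / 8)} \<ge> (1/32) ^ Suc r"
  using assms
proof (induction r arbitrary: A)
  case 0
  thus ?case using deviation_lower_tail[of A q a w] by simp
next
  case (Suc r)
  have q1: "q v * (1 - q v) \<le> 1" "0 \<le> q v * (1 - q v)" if "v \<in> A" for v
    using Suc.prems(2)[OF that] mult_mono[of "q v" 1 "1 - q v" 1] by auto
  have "w \<le> real (Suc (Suc r)) * (w + 1)" using Suc.prems(5) by (simp add: algebra_simps)
  hence "w \<le> (\<Sum>v\<in>A. q v * (1 - q v))" using Suc.prems(4) by linarith
  then obtain B where B: "B \<subseteq> A" "w \<le> (\<Sum>v\<in>B. q v * (1 - q v))" "(\<Sum>v\<in>B. q v * (1 - q v)) \<le> w + 1"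
    using subset_sum_in_window[of A "\<lambda>v. q v * (1 - q v)" w] q1 Suc.prems(1,5) by auto
  define C where "C = A - B"
  have fin: "finite B" "finite C" using B Suc.prems(1) finite_subset by (auto simp: C_def)
  have disj: "B \<inter> C = {}" and A: "A = B \<union> C" using B by (auto simp: C_def)
  have "(\<Sum>v\<in>A. q v * (1 - q v)) = (\<Sum>v\<in>B. q v * (1 - q v)) + (\<Sum>v\<in>C. q v * (1 - q v))"
    unfolding A by (rule sum.union_disjoint[OF fin disj])
  hence "(\<Sum>v\<in>C. q v * (1 - q v)) \<ge> real (Suc r) * (w + 1)"
    using Suc.prems(4) B(3) by (simp add: algebra_simps)
  hence probC: "measure_pmf.prob (coins C q) {X. deviation C q a X \<ge> real (Suc r) * (sqrt w / 8)} \<ge> (1/32) ^ Suc r"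
    using Suc.prems fin by (intro Suc.IH) (auto simp: C_def)
  have probB: "measure_pmf.prob (coins B q) {X. deviation B q a X \<ge> sqrt w / 8} \<ge> 1/32"
    using Suc.prems fin B by (intro deviation_lower_tail) auto
  define h where "h = (\<lambda>(f, g) x. if x \<in> B then f x else (g x :: bool))"
  have dev: "deviation A q a (h (f, g)) = deviation B q a f + deviation C q a g" for f g
  proof -
    have "deviation A q a (h (f, g)) = deviation B q a (h (f, g)) + deviation C q a (h (f, g))"
      unfolding A deviation_def by (rule sum.union_disjoint[OF fin disj])
    also have "deviation B q a (h (f, g)) = deviation B q a f"
      unfolding deviation_def h_def by (intro sum.cong) auto
    also have "deviation C q a (h (f, g)) = deviation C q a g"
      unfolding deviation_def h_def using disj by (intro sum.cong) auto
    finally show ?thesis .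
  qed
  have "(1/32) ^ Suc (Suc r) = (1/32) * (1/32 :: real) ^ Suc r" by simp
  also have "\<dots> \<le> measure_pmf.prob (coins B q) {X. deviation B q a X \<ge> sqrt w / 8} * 
      measure_pmf.prob (coins C q) {X. deviation C q a X \<ge> real (Suc r) * (sqrt w / 8)}"
    using probB probC by (intro mult_mono) auto
  also have "\<dots> = measure_pmf.prob (pair_pmf (coins B q) (coins C q))
     ({X. deviation B q a X \<ge> sqrt w / 8} \<times> {X. deviation C q a X \<ge> real (Suc r) * (sqrt w / 8)})"
    by (rule prob_pair_pmf_Times[symmetric])
  also have "\<dots> \<le> measure_pmf.prob (pair_pmf (coins B q) (coins C q))
     (h -` {X. deviation A q a X \<ge> real (Suc (Suc r)) * (sqrt w / 8)})"
  proof (intro measure_pmf.finite_measure_mono subsetI)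
    fix z assume z: "z \<in> {X. deviation B q a X \<ge> sqrt w / 8} \<times> {X. deviation C q a X \<ge> real (Suc r) * (sqrt w / 8)}"
    obtain f g where "z = (f, g)" by (cases z)
    thus "z \<in> h -` {X. deviation A q a X \<ge> real (Suc (Suc r)) * (sqrt w / 8)}"
      using z by (simp add: dev algebra_simps)
  qed auto
  also have "\<dots> = measure_pmf.prob (map_pmf h (pair_pmf (coins B q) (coins C q)))
      {X. deviation A q a X \<ge> real (Suc (Suc r)) * (sqrt w / 8)}" by simp
  also have "map_pmf h (pair_pmf (coins B q) (coins C q)) = coins A q"
    unfolding A h_def by (rule Pi_pmf_union[OF fin disj, symmetric])
  finally show ?case .
qed

text \<open>The mean of the signed sum may be large, but it does not hurt if the deviation is taken in
the direction of the mean; \<open>\<sigma>\<close> is the sign of the mean.\<close>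

lemma signed_sum_anticoncentration:
  fixes q :: "'a \<Rightarrow> real" and \<psi> :: "'a \<Rightarrow> int"
  assumes "finite V" "\<And>v. v \<in> V \<Longrightarrow> 0 \<le> q v \<and> q v \<le> 1" "\<And>v. v \<in> V \<Longrightarrow> \<psi> v \<in> {-1, 1}"
    and "(\<Sum>v\<in>V. q v * (1 - q v)) \<ge> real r * (w + 1)" "w \<ge> 1" "r > 0"
  shows "measure_pmf.prob (coins V q) {X. \<bar>real_of_int (\<Sum>v | v \<in> V \<and> X v. \<psi> v)\<bar> \<ge> real r * (sqrt w / 8)}
      \<ge> (1/32) ^ r"
proof -
  define M where "M = (\<Sum>v\<in>V. \<psi> v * q v)"
  define \<sigma> :: real where "\<sigma> = (if M \<ge> 0 then 1 else -1)"
  define a where "a = (\<lambda>v. \<sigma> * \<psi> v)"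
  have dev: "deviation V q a X = \<sigma> * real_of_int (\<Sum>v | v \<in> V \<and> X v. \<psi> v) - \<sigma> * M" for X
  proof -
    have "real_of_int (\<Sum>v | v \<in> V \<and> X v. \<psi> v) = (\<Sum>v\<in>V. real_of_int (if X v then \<psi> v else 0))"
      using assms(1) by (subst sum.inter_filter) auto
    also have "\<dots> = (\<Sum>v\<in>V. real_of_int (\<psi> v) * of_bool (X v))" by (intro sum.cong) auto
    finally have S: "real_of_int (\<Sum>v | v \<in> V \<and> X v. \<psi> v) = (\<Sum>v\<in>V. real_of_int (\<psi> v) * of_bool (X v))" .
    have "deviation V q a X = (\<Sum>v\<in>V. \<sigma> * (\<psi> v * of_bool (X v)) - \<sigma> * (\<psi> v * q v))"
      unfolding deviation_def a_def by (intro sum.cong) (auto simp: algebra_simps)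
    thus ?thesis unfolding S M_def by (simp add: sum_subtractf sum_distrib_left)
  qed
  have "\<sigma> * M \<ge> 0" by (auto simp: \<sigma>_def)
  obtain r' where r: "r = Suc r'" using \<open>r > 0\<close> by (cases r) auto
  have "(1/32) ^ r \<le> measure_pmf.prob (coins V q) {X. deviation V q a X \<ge> real r * (sqrt w / 8)}"
    unfolding r
  proof (rule deviation_block_tail)
    show "a v = 1 \<or> a v = -1" if "v \<in> V" for v using assms(3)[OF that] by (auto simp: a_def \<sigma>_def)
  qed (use assms r in auto)
  also have "\<dots> \<le> measure_pmf.prob (coins V q) {X. \<bar>real_of_int (\<Sum>v | v \<in> V \<and> X v. \<psi> v)\<bar> \<ge> real r * (sqrt w / 8)}"
    using \<open>\<sigma> * M \<ge> 0\<close> 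
    by (intro measure_pmf.finite_measure_mono) (auto simp: dev \<sigma>_def simp del: of_int_sum split: if_splits)
  finally show ?thesis .
qed

section \<open>Exposing the edges of the edge-dependent model\<close>

lemma prob_bind_pmf:
  "measure_pmf.prob (bind_pmf M N) A = measure_pmf.expectation M (\<lambda>x. measure_pmf.prob (N x) A)"
proof -
  have "ennreal (measure_pmf.prob (bind_pmf M N) A) = (\<integral>\<^sup>+x. ennreal (measure_pmf.prob (N x) A) \<partial>M)"
    by (simp flip: measure_pmf.emeasure_eq_measure)
  also have "\<dots> = ennreal (measure_pmf.expectation M (\<lambda>x. measure_pmf.prob (N x) A))"
    by (intro nn_integral_eq_integral measure_pmf.integrable_const_bound[where B = 1]) auto
  finally show ?thesis by (subst (asm) ennreal_inj) (auto intro!: integral_nonneg_AE)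
qed

definition uniform_subset :: "'i set \<Rightarrow> nat \<Rightarrow> 'i set pmf" where
  "uniform_subset A k = pmf_of_set {S. S \<subseteq> A \<and> card S = k}"

lemma uniform_subset_aux:
  assumes "finite A" "k \<le> card A"
  shows "finite {S. S \<subseteq> A \<and> card S = k}" "{S. S \<subseteq> A \<and> card S = k} \<noteq> {}"
    "card {S. S \<subseteq> A \<and> card S = k} = card A choose k"
proof -
  show "finite {S. S \<subseteq> A \<and> card S = k}" using assms by auto
  show *: "card {S. S \<subseteq> A \<and> card S = k} = card A choose k" by (rule n_subsets[OF assms(1)])
  show "{S. S \<subseteq> A \<and> card S = k} \<noteq> {}"
    using * assms zero_less_binomial[OF assms(2)] by (metis card.empty less_irrefl)
qed

lemma pmf_uniform_subset:
  assumes "finite A" "k \<le> card A"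
  shows "pmf (uniform_subset A k) S = of_bool (S \<subseteq> A \<and> card S = k) / (card A choose k)"
  unfolding uniform_subset_def using uniform_subset_aux[OF assms]
  by (simp add: pmf_of_set indicator_def)

lemma set_uniform_subset:
  assumes "finite A" "k \<le> card A"
  shows "set_pmf (uniform_subset A k) = {S. S \<subseteq> A \<and> card S = k}"
  unfolding uniform_subset_def using uniform_subset_aux[OF assms] by simp

text \<open>A uniformly random \<open>k\<close>-subset contains a given element with probability \<open>k / N\<close>, and given this decision
the rest is again a uniformly random subset of the appropriate size.\<close>

lemma uniform_subset_insert:
  assumes "finite A" "a \<notin> A" "k \<le> card A"
  shows "uniform_subset (insert a A) k =
    bernoulli_pmf (k / (card A + 1)) \<bind> 
      (\<lambda>b. map_pmf (\<lambda>S. if b then insert a S else S) (uniform_subset A (k - of_bool b)))"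
proof (rule pmf_eqI)
  fix S
  let ?N = "card A + 1"
  have N: "card (insert a A) = ?N" using assms by simp
  have q: "0 \<le> k / ?N" "k / ?N \<le> 1" using assms(3) by (auto simp: field_simps)
  have without_a: "pmf (uniform_subset A k) S * (1 - k / ?N) = of_bool (S \<subseteq> A \<and> card S = k) / (?N choose k)"
  proof -
    have "(?N - k) * (?N choose k) = ?N * (card A choose k)"
      using binomial_absorb_comp[of ?N k] by simp
    hence "real (?N - k) * real (?N choose k) = real ?N * real (card A choose k)"
      by (metis of_nat_mult)
    moreover have "real (?N - k) = real ?N - k" using assms(3) by (simp add: of_nat_diff)
    moreover have "?N choose k > 0" "card A choose k > 0" using assms(3) by auto
    moreover have "(1 - real k / N) / B = 1 / C" 
      if "(N - k) * C = N * B" "N > 0" "B > 0" "C > 0" for N B C :: real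
      using that by (simp add: field_simps)
    ultimately have "(1 - k / ?N) / (card A choose k) = 1 / (?N choose k)"
      by (simp only: of_nat_0_less_iff)
    thus ?thesis using assms by (auto simp: pmf_uniform_subset)
  qed
  have with_a: "pmf (map_pmf (insert a) (uniform_subset A (k - 1))) S * (k / ?N) =
      of_bool (S \<subseteq> insert a A \<and> a \<in> S \<and> card S = k) / (?N choose k)"
  proof (cases k)
    case 0
    have "\<not> (S \<subseteq> insert a A \<and> a \<in> S \<and> card S = 0)" 
      using assms(1) finite_subset[of S "insert a A"] by (auto simp: card_gt_0_iff)
    thus ?thesis using 0 by simp
  next
    case (Suc l)
    have l: "l \<le> card A" using Suc assms by simp
    have img: "insert a ` {S. S \<subseteq> A \<and> card S = l} = {S. S \<subseteq> insert a A \<and> a \<in> S \<and> card S = k}"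
    proof (rule equalityI; rule subsetI)
      fix S'' assume "S'' \<in> insert a ` {S. S \<subseteq> A \<and> card S = l}"
      then obtain S' where S': "S'' = insert a S'" "S' \<subseteq> A" "card S' = l" by auto
      moreover from this have "finite S'" "a \<notin> S'" using assms finite_subset by auto
      ultimately show "S'' \<in> {S. S \<subseteq> insert a A \<and> a \<in> S \<and> card S = k}" using Suc by auto
    next
      fix S' assume "S' \<in> {S. S \<subseteq> insert a A \<and> a \<in> S \<and> card S = k}"
      hence "S' = insert a (S' - {a})" "S' - {a} \<subseteq> A" "card (S' - {a}) = l"
        using Suc assms finite_subset[of S' "insert a A"] by auto
      thus "S' \<in> insert a ` {S. S \<subseteq> A \<and> card S = l}" 
        by (intro image_eqI[of _ _ "S' - {a}"]) auto
    qed
    have "map_pmf (insert a) (uniform_subset A l) = pmf_of_set (insert a ` {S. S \<subseteq> A \<and> card S = l})"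
      unfolding uniform_subset_def using uniform_subset_aux[OF assms(1) l] assms(2)
      by (intro map_pmf_of_set_inj) (auto simp: inj_on_def insert_ident subset_eq)
    also note img
    finally have "pmf (map_pmf (insert a) (uniform_subset A l)) S = 
        pmf (pmf_of_set {S. S \<subseteq> insert a A \<and> a \<in> S \<and> card S = k}) S" by simp
    also have "\<dots> = of_bool (S \<subseteq> insert a A \<and> a \<in> S \<and> card S = k) / (card A choose l)"
    proof -
      have "inj_on (insert a) {S. S \<subseteq> A \<and> card S = l}"
        using assms(2) by (auto simp: inj_on_def insert_ident subset_eq)
      hence "card (insert a ` {S. S \<subseteq> A \<and> card S = l}) = card A choose l"
        by (simp only: card_image n_subsets[OF assms(1)])
      moreover have "finite (insert a ` {S. S \<subseteq> A \<and> card S = l})" "insert a ` {S. S \<subseteq> A \<and> card S = l} \<noteq> {}"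
        using uniform_subset_aux[OF assms(1) l] by auto
      ultimately show ?thesis unfolding img by (simp add: pmf_of_set indicator_def)
    qed
    finally have p: "pmf (map_pmf (insert a) (uniform_subset A l)) S = 
        of_bool (S \<subseteq> insert a A \<and> a \<in> S \<and> card S = k) / (card A choose l)" .
    have "k * (?N choose k) = ?N * (card A choose l)"
      using Suc_times_binomial[of l "card A"] by (simp only: Suc Suc_eq_plus1)
    hence "real k * real (?N choose k) = real ?N * real (card A choose l)" by (metis of_nat_mult)
    moreover have "?N choose k > 0" "card A choose l > 0" using assms(3) l by auto
    moreover have "(real k / N) / B = 1 / C" 
      if "k * C = N * B" "N > 0" "B > 0" "C > 0" for N B C :: real
      using that by (simp add: field_simps)
    ultimately have "(k / ?N) / (card A choose l) = 1 / (?N choose k)"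
      by (simp only: of_nat_0_less_iff)
    hence "x / (card A choose l) * (k / ?N) = x / (?N choose k)" for x :: real
      by (metis mult.commute mult.right_neutral times_divide_eq_right times_divide_eq_left)
    moreover have "k - 1 = l" using Suc by simp
    ultimately show ?thesis using p by (simp only:)
  qed
  have "pmf (bernoulli_pmf (k / ?N) \<bind> 
      (\<lambda>b. map_pmf (\<lambda>S. if b then insert a S else S) (uniform_subset A (k - of_bool b)))) S =
      pmf (map_pmf (insert a) (uniform_subset A (k - 1))) S * (k / ?N) + pmf (uniform_subset A k) S * (1 - k / ?N)"
    using q by (simp add: pmf_bind)
  also have "\<dots> = of_bool (S \<subseteq> insert a A \<and> card S = k) / (?N choose k)"
    unfolding with_a without_a using assms(2) by (auto simp: subset_insert_iff)
  also have "\<dots> = pmf (uniform_subset (insert a A) k) S"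
    using assms by (subst pmf_uniform_subset) auto
  finally show "pmf (uniform_subset (insert a A) k) S = pmf (bernoulli_pmf (k / ?N) \<bind> 
      (\<lambda>b. map_pmf (\<lambda>S. if b then insert a S else S) (uniform_subset A (k - of_bool b)))) S" by simp
qed

lemma uniform_subsets_insert:
  assumes "finite V" "finite A" "a \<notin> A" "\<And>v. v \<in> V \<Longrightarrow> k v \<le> card A"
  shows "Pi_pmf V {} (\<lambda>v. uniform_subset (insert a A) (k v)) =
    do {X \<leftarrow> coins V (\<lambda>v. k v / (card A + 1));
        J \<leftarrow> Pi_pmf V {} (\<lambda>v. uniform_subset A (k v - of_bool (X v)));
        return_pmf (\<lambda>v. if v \<in> V then (if X v then insert a (J v) else J v) else {})}"
proof -
  have "Pi_pmf V {} (\<lambda>v. uniform_subset (insert a A) (k v)) =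
    Pi_pmf V {} (\<lambda>v. bernoulli_pmf (k v / (card A + 1)) \<bind> 
      (\<lambda>b. uniform_subset A (k v - of_bool b) \<bind> (\<lambda>S. return_pmf (if b then insert a S else S))))"
    using uniform_subset_insert[OF assms(2,3)] assms(4) by (intro Pi_pmf_cong) (auto simp: map_pmf_def)
  also have "\<dots> = coins V (\<lambda>v. k v / (card A + 1)) \<bind> (\<lambda>X. Pi_pmf V {} (\<lambda>v.
      uniform_subset A (k v - of_bool (X v)) \<bind> (\<lambda>S. return_pmf (if X v then insert a S else S))))"
    by (rule Pi_pmf_bind[OF assms(1)])
  also have "\<dots> = coins V (\<lambda>v. k v / (card A + 1)) \<bind> (\<lambda>X. 
      Pi_pmf V {} (\<lambda>v. uniform_subset A (k v - of_bool (X v))) \<bind> (\<lambda>J. 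
      return_pmf (\<lambda>v. if v \<in> V then (if X v then insert a (J v) else J v) else {})))"
    by (simp add: Pi_pmf_bind[OF assms(1), where d' = "{}"] assms(1))
  finally show ?thesis .
qed

text \<open>Here \<open>k v\<close> is the number of edges that still have to receive \<open>v\<close>, the edges in \<open>F\<close> are exposed and those in \<open>R\<close>
are not. When \<open>N\<close> edges remain, the next one contains \<open>v\<close> with conditional probability \<open>k v / N\<close>. This is at
most \<open>\<beta>\<close> since \<open>N \<ge> card R\<close>, and the sum over \<open>v\<close> is at least \<open>\<gamma>\<close> because the exposed edges use up at
most \<open>s\<close> incidences: the difference between \<open>\<Sum>v\<in>V. k v\<close> and \<open>s\<close> is invariant under exposing an edge if
both are updated.\<close>

lemma uniform_subsets_exposure:
  fixes Q :: "'a set \<Rightarrow> bool" and \<beta> \<gamma> \<delta> s :: real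
  assumes V: "finite V" and R: "finite R" and "0 \<le> \<beta>" "\<beta> \<le> 1" "\<gamma> \<ge> 0" "\<delta> \<le> 1"
    and anti: "\<And>q. (\<And>v. v \<in> V \<Longrightarrow> 0 \<le> q v \<and> q v \<le> \<beta>) \<Longrightarrow> (\<Sum>v\<in>V. q v) \<ge> \<gamma> \<Longrightarrow>
      measure_pmf.prob (coins V q) {X. Q {v \<in> V. X v}} \<le> 1 - \<delta>"
    and F: "distinct F" "set F \<inter> R = {}"
    and k: "\<And>v. v \<in> V \<Longrightarrow> real (k v) \<le> \<beta> * card R"
    and total: "(\<Sum>v\<in>V. real (k v)) - s \<ge> \<gamma> * (card R + length F)"
  shows "measure_pmf.prob (Pi_pmf V {} (\<lambda>v. uniform_subset (R \<union> set F) (k v)))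
     {I. (\<forall>i\<in>set F. Q {v\<in>V. i \<in> I v}) \<and> real (\<Sum>i\<in>set F. card {v\<in>V. i \<in> I v}) \<le> s} \<le> (1 - \<delta>) ^ length F"
  using F k total
proof (induction F arbitrary: k s)
  case Nil
  show ?case by simp
next
  case (Cons a F)
  let ?A = "R \<union> set F" and ?N = "real (card R + length F + 1)"
  have A: "finite ?A" "a \<notin> ?A" "R \<union> set (a # F) = insert a ?A" using R Cons.prems by auto
  have "card ?A = card R + length F"
    using Cons.prems R by (subst card_Un_disjoint) (auto simp: distinct_card)
  hence N: "card ?A + 1 = ?N" by simp
  have kR: "k v \<le> card R" if "v \<in> V" for v
  proof -
    have "real (k v) \<le> \<beta> * card R" using Cons.prems that by auto
    also have "\<dots> \<le> 1 * real (card R)" using \<open>\<beta> \<le> 1\<close> by (intro mult_right_mono) auto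
    finally show ?thesis by simp
  qed
  hence kA: "k v \<le> card ?A" if "v \<in> V" for v using \<open>card ?A = card R + length F\<close> that by fastforce
  define q where "q = (\<lambda>v. k v / (card ?A + 1))"
  let ?Ev = "{I. (\<forall>i\<in>set (a # F). Q {v\<in>V. i \<in> I v}) \<and> real (\<Sum>i\<in>set (a # F). card {v\<in>V. i \<in> I v}) \<le> s}"
  show ?case
  proof (cases "s < 0")
    case True
    have "I \<notin> ?Ev" for I
    proof
      assume "I \<in> ?Ev"
      hence "real (\<Sum>i\<in>set (a # F). card {v\<in>V. i \<in> I v}) \<le> s" by blast
      hence "0 \<le> s" by (rule order.trans[OF of_nat_0_le_iff])
      thus False using True by simp
    qed
    hence "?Ev = {}" by blast
    moreover have "0 \<le> (1 - \<delta>) ^ length (a # F)" using \<open>\<delta> \<le> 1\<close> by (intro zero_le_power) simp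
    ultimately show ?thesis by (simp only: measure_empty)
  next
    case s: False
    define next_law where "next_law = (\<lambda>X. Pi_pmf V {} (\<lambda>v. uniform_subset ?A (k v - of_bool (X v))) \<bind> (\<lambda>J. 
      return_pmf (\<lambda>v. if v \<in> V then (if X v then insert a (J v) else J v) else {})))"
    have law: "Pi_pmf V {} (\<lambda>v. uniform_subset (R \<union> set (a # F)) (k v)) = coins V q \<bind> next_law"
      unfolding A(3) q_def next_law_def by (rule uniform_subsets_insert[OF V A(1,2) kA])
    have step: "measure_pmf.prob (next_law X) ?Ev \<le> indicator {X. Q {v\<in>V. X v}} X * (1 - \<delta>) ^ length F" for X
    proof -
      define s' where "s' = s - real (card {v\<in>V. X v})"
      define k' where "k' = (\<lambda>v. k v - of_bool (X v))"
      define g where "g = (\<lambda>J v. if v \<in> V then (if X v then insert a (J v) else J v) else {})"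
      let ?P = "Pi_pmf V {} (\<lambda>v. uniform_subset ?A (k' v))"
      let ?Ev' = "{I. (\<forall>i\<in>set F. Q {v\<in>V. i \<in> I v}) \<and> real (\<Sum>i\<in>set F. card {v\<in>V. i \<in> I v}) \<le> s'}"
      have nl: "next_law X = map_pmf g ?P" by (simp add: next_law_def map_pmf_def g_def k'_def)
      have IH: "measure_pmf.prob ?P ?Ev' \<le> (1 - \<delta>) ^ length F"
      proof (rule Cons.IH)
        have "(\<Sum>v\<in>V. real (k v) - of_bool (X v)) \<le> (\<Sum>v\<in>V. real (k' v))"
          by (intro sum_mono) (auto simp: k'_def)
        moreover have "(\<Sum>v\<in>V. of_bool (X v)) = real (card {v\<in>V. X v})"
          using V by (simp add: sum_of_bool_eq Collect_conj_eq)
        ultimately have "(\<Sum>v\<in>V. real (k v)) - s \<le> (\<Sum>v\<in>V. real (k' v)) - s'"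
          by (simp add: sum_subtractf s'_def)
        moreover have "\<gamma> * (card R + length F) \<le> \<gamma> * (card R + length (a # F))"
          using \<open>\<gamma> \<ge> 0\<close> by (intro mult_left_mono) auto
        ultimately show "\<gamma> * (card R + length F) \<le> (\<Sum>v\<in>V. real (k' v)) - s'"
          using Cons.prems(4) by linarith
        show "real (k' v) \<le> \<beta> * card R" if "v \<in> V" for v
          using Cons.prems(3)[OF that] by (auto simp: k'_def)
      qed (use Cons.prems in auto)
      have "measure_pmf.prob (next_law X) ?Ev = measure_pmf.prob ?P (g -` ?Ev)" by (simp add: nl)
      also have "\<dots> = measure_pmf.prob ?P (g -` ?Ev \<inter> set_pmf ?P)" by (simp add: measure_Int_set_pmf)
      also have "\<dots> \<le> measure_pmf.prob ?P (if Q {v\<in>V. X v} then ?Ev' else {})"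
      proof (intro measure_pmf.finite_measure_mono subsetI)
        fix J assume J: "J \<in> g -` ?Ev \<inter> set_pmf ?P"
        have "a \<notin> J v" if "v \<in> V" for v
        proof -
          have "J v \<in> set_pmf (uniform_subset ?A (k' v))"
            using J set_Pi_pmf_subset'[OF V, of "{}" "\<lambda>v. uniform_subset ?A (k' v)"] that
            by (auto simp: PiE_dflt_def)
          moreover have "k' v \<le> card ?A" using kA[OF that] by (simp add: k'_def)
          ultimately show ?thesis using A set_uniform_subset[OF A(1)] by auto
        qed
        hence ga: "{v\<in>V. a \<in> g J v} = {v\<in>V. X v}" by (auto simp: g_def)
        have gi: "{v\<in>V. i \<in> g J v} = {v\<in>V. i \<in> J v}" if "i \<in> set F" for i
          using that A(2) by (auto simp: g_def)
        from J have Ev: "g J \<in> ?Ev" by simp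
        have "real (\<Sum>i\<in>set (a # F). card {v\<in>V. i \<in> g J v}) = 
            real (card {v\<in>V. X v}) + real (\<Sum>i\<in>set F. card {v\<in>V. i \<in> J v})"
          using Cons.prems(1) gi by (simp add: ga)
        hence "real (\<Sum>i\<in>set F. card {v\<in>V. i \<in> J v}) \<le> s'" using Ev by (simp add: s'_def)
        moreover have "Q {v\<in>V. X v}" "\<forall>i\<in>set F. Q {v\<in>V. i \<in> J v}"
          using Ev gi by (auto simp: ga)
        ultimately show "J \<in> (if Q {v\<in>V. X v} then ?Ev' else {})" by simp
      qed auto
      also have "\<dots> \<le> indicator {X. Q {v\<in>V. X v}} X * (1 - \<delta>) ^ length F"
        using IH by (auto simp: indicator_def)
      finally show ?thesis .
    qed
    have "measure_pmf.prob (coins V q \<bind> next_law) ?Ev = 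
        measure_pmf.expectation (coins V q) (\<lambda>X. measure_pmf.prob (next_law X) ?Ev)"
      by (rule prob_bind_pmf)
    also have "\<dots> \<le> measure_pmf.expectation (coins V q) (\<lambda>X. indicator {X. Q {v\<in>V. X v}} X * (1 - \<delta>) ^ length F)"
      using V step by (intro integral_mono integrable_coins)
    also have "\<dots> = measure_pmf.prob (coins V q) {X. Q {v\<in>V. X v}} * (1 - \<delta>) ^ length F" by simp
    also have "\<dots> \<le> (1 - \<delta>) * (1 - \<delta>) ^ length F"
    proof (intro mult_right_mono anti)
      fix v assume v: "v \<in> V"
      have "real (k v) \<le> \<beta> * card R" using Cons.prems v by auto
      also have "\<dots> \<le> \<beta> * ?N" using \<open>0 \<le> \<beta>\<close> by (intro mult_left_mono) auto
      finally show "0 \<le> q v \<and> q v \<le> \<beta>"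
        using \<open>card ?A = card R + length F\<close> by (simp add: q_def field_simps)
    next
      have "\<gamma> * ?N \<le> (\<Sum>v\<in>V. real (k v))" using Cons.prems(4) s by (simp add: algebra_simps)
      hence "\<gamma> \<le> (\<Sum>v\<in>V. real (k v)) / ?N" by (simp add: field_simps)
      thus "\<gamma> \<le> (\<Sum>v\<in>V. q v)" using \<open>card ?A = card R + length F\<close>
        by (simp add: q_def sum_divide_distrib add.commute)
    qed (use \<open>\<delta> \<le> 1\<close> in auto)
    finally show ?thesis unfolding law by simp
  qed
qed

section \<open>The two random models\<close>

definition independent_edges :: "'a set \<Rightarrow> 'i set \<Rightarrow> real \<Rightarrow> ('i \<Rightarrow> 'a set) pmf" where
  "independent_edges V E p = map_pmf (\<lambda>X i. {v\<in>V. X (v, i)}) (coins (V \<times> E) (\<lambda>_. p))"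

definition dependent_edges :: "'a set \<Rightarrow> 'i set \<Rightarrow> nat \<Rightarrow> ('i \<Rightarrow> 'a set) pmf" where
  "dependent_edges V E k = map_pmf (\<lambda>I i. {v\<in>V. i \<in> I v}) (Pi_pmf V {} (\<lambda>_. uniform_subset E k))"

lemma spread_independent_edges:
  assumes "finite V" "finite E" "0 \<le> p" "p \<le> 1"
  shows "spread (independent_edges V E p) V E p"
  unfolding spread_def
proof safe
  fix S assume S: "S \<subseteq> V \<times> E"
  define B where "B = (\<lambda>z. if z \<in> S then {True} else UNIV)"
  have "measure_pmf.prob (independent_edges V E p) {e. \<forall>(v, i)\<in>S. v \<in> e i} =
      measure_pmf.prob (coins (V \<times> E) (\<lambda>_. p)) (Pi (V \<times> E) B)"
    unfolding independent_edges_def measure_map_pmf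
    by (rule arg_cong[of _ _ "measure_pmf.prob _"]) (use S in \<open>auto simp: B_def Pi_def split: if_splits\<close>)
  also have "\<dots> = (\<Prod>z\<in>V \<times> E. measure_pmf.prob (bernoulli_pmf p) (B z))"
    using assms by (intro measure_Pi_pmf_Pi) auto
  also have "\<dots> = (\<Prod>z\<in>V \<times> E. if z \<in> S then p else 1)"
    using assms by (intro prod.cong) (auto simp: B_def measure_pmf_single)
  also have "\<dots> = p ^ card S"
    using assms S by (simp add: prod.If_cases Int_absorb1)
  finally show "measure_pmf.prob (independent_edges V E p) {e. \<forall>(v, i)\<in>S. v \<in> e i} \<le> p ^ card S" by simp
qed

text \<open>Reveal the elements of \<open>D\<close> one at a time: having received one element, the subset has \<open>k - 1\<close> of the remaining
\<open>N - 1\<close> places left, and \<open>(k - 1) / (N - 1) \<le> k / N\<close>.\<close>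

lemma prob_uniform_subset_superset_le:
  assumes "finite E" "k \<le> card E" "D \<subseteq> E"
  shows "measure_pmf.prob (uniform_subset E k) {S. D \<subseteq> S} \<le> (k / card E) ^ card D"
proof -
  have "finite D" using assms finite_subset by blast
  thus ?thesis using assms
  proof (induction D arbitrary: E k rule: finite_induct)
    case (insert x D)
    define A where "A = E - {x}"
    have A: "finite A" "x \<notin> A" "E = insert x A" "D \<subseteq> A" using insert by (auto simp: A_def)
    have cE: "card E = card A + 1" using A by simp
    show ?case
    proof (cases "k = card E")
      case True
      hence "real k / card E = 1" using cE by simp
      thus ?thesis by simp
    next
      case False
      hence kA: "k \<le> card A" using insert.prems cE by simp
      define q where "q = real k / (card A + 1)"
      have q: "0 \<le> q" "q \<le> 1" using kA by (auto simp: q_def)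
      have sub: "x \<notin> S" if "S \<in> set_pmf (uniform_subset A k)" for S
        using that set_uniform_subset[OF A(1) kA] A(2) by auto
      have 0: "measure_pmf.prob (uniform_subset A k) {S. insert x D \<subseteq> S} = 0"
        using sub by (subst measure_pmf_zero_iff) auto
      have "measure_pmf.prob (uniform_subset E k) {S. insert x D \<subseteq> S} =
          q * measure_pmf.prob (uniform_subset A (k - 1)) {S. insert x D \<subseteq> insert x S}"
        unfolding A(3) uniform_subset_insert[OF A(1,2) kA] prob_bind_pmf
        using q 0 by (simp add: q_def vimage_def)
      also have "\<dots> \<le> q * measure_pmf.prob (uniform_subset A (k - 1)) {S. D \<subseteq> S}"
        using insert.hyps q by (intro mult_left_mono measure_pmf.finite_measure_mono) auto
      also have "\<dots> \<le> q * (real (k - 1) / card A) ^ card D"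
        using q kA A by (intro mult_left_mono insert.IH) auto
      also have "\<dots> \<le> q * q ^ card D"
      proof (intro mult_left_mono power_mono)
        show "real (k - 1) / card A \<le> q"
        proof (cases "k = 0")
          case False
          hence "real (k - 1) = real k - 1" "card A > 0" using kA by (auto simp: of_nat_diff)
          thus ?thesis using kA False by (simp add: q_def field_simps)
        qed (auto simp: q_def)
      qed (use q in auto)
      finally show ?thesis using insert.hyps cE by (simp add: q_def add.commute)
    qed
  qed simp
qed

lemma spread_dependent_edges:
  assumes "finite V" "finite E" "k \<le> card E"
  shows "spread (dependent_edges V E k) V E (k / card E)"
  unfolding spread_def
proof safe
  fix S assume S: "S \<subseteq> V \<times> E"
  define D where "D = (\<lambda>v. {i. (v, i) \<in> S})"
  have D: "D v \<subseteq> E" for v using S by (auto simp: D_def)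
  have "measure_pmf.prob (dependent_edges V E k) {e. \<forall>(v, i)\<in>S. v \<in> e i} =
      measure_pmf.prob (Pi_pmf V {} (\<lambda>_. uniform_subset E k)) (Pi V (\<lambda>v. {S. D v \<subseteq> S}))"
    unfolding dependent_edges_def measure_map_pmf
    by (rule arg_cong[of _ _ "measure_pmf.prob _"]) (use S in \<open>auto simp: D_def Pi_def\<close>)
  also have "\<dots> = (\<Prod>v\<in>V. measure_pmf.prob (uniform_subset E k) {S. D v \<subseteq> S})"
    using assms by (intro measure_Pi_pmf_Pi) auto
  also have "\<dots> \<le> (\<Prod>v\<in>V. (k / card E) ^ card (D v))"
    using assms D by (intro prod_mono conjI prob_uniform_subset_superset_le) auto
  also have "\<dots> = (k / card E) ^ (\<Sum>v\<in>V. card (D v))" by (simp add: power_sum)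
  also have "(\<Sum>v\<in>V. card (D v)) = card (SIGMA v:V. D v)"
    using assms D finite_subset by (intro card_SigmaI[symmetric]) blast+
  also have "(SIGMA v:V. D v) = S" using S by (auto simp: D_def)
  finally show "measure_pmf.prob (dependent_edges V E k) {e. \<forall>(v, i)\<in>S. v \<in> e i} \<le> (k / card E) ^ card S" .
qed

lemma prob_independent_edges_all:
  fixes Q :: "'a set \<Rightarrow> bool"
  assumes "finite E" "finite V"
  shows "measure_pmf.prob (independent_edges V E p) {e. \<forall>i\<in>E. Q (e i)} =
     measure_pmf.prob (coins V (\<lambda>_. p)) {X. Q {v\<in>V. X v}} ^ card E"
  using assms(1)
proof (induction rule: finite_induct)
  case empty
  show ?case by simp
next
  case (insert a E)
  let ?c = "\<lambda>E. coins (V \<times> E) (\<lambda>_. p)" and ?P = "coins V (\<lambda>_. p)"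
  let ?h = "\<lambda>(f, g) x. if x \<in> V \<times> {a} then f x else (g x :: bool)"
  have fin: "finite (V \<times> {a})" "finite (V \<times> E)" and disj: "(V \<times> {a}) \<inter> (V \<times> E) = {}" 
    using insert assms by auto
  have "V \<times> insert a E = V \<times> {a} \<union> V \<times> E" by auto
  hence law: "?c (insert a E) = map_pmf ?h (pair_pmf (?c {a}) (?c E))"
    by (simp only: Pi_pmf_union[OF fin disj])
  have "?P = map_pmf (\<lambda>g. g \<circ> (\<lambda>v. (v, a))) (?c {a})"
    using assms(2) by (intro Pi_pmf_bij_betw) (auto simp: bij_betw_def inj_on_def)
  hence first: "measure_pmf.prob (?c {a}) {f. Q {v\<in>V. f (v, a)}} = measure_pmf.prob ?P {X. Q {v\<in>V. X v}}"
    by (simp add: vimage_def)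
  have "measure_pmf.prob (independent_edges V (insert a E) p) {e. \<forall>i\<in>insert a E. Q (e i)} =
      measure_pmf.prob (pair_pmf (?c {a}) (?c E)) ({f. Q {v\<in>V. f (v, a)}} \<times> {g. \<forall>i\<in>E. Q {v\<in>V. g (v, i)}})"
    unfolding independent_edges_def law measure_map_pmf
  proof (rule arg_cong[of _ _ "measure_pmf.prob _"], rule set_eqI, clarify)
    fix f g
    have 1: "{v\<in>V. ?h (f, g) (v, a)} = {v\<in>V. f (v, a)}" by auto
    have 2: "{v\<in>V. ?h (f, g) (v, i)} = {v\<in>V. g (v, i)}" if "i \<in> E" for i using that insert.hyps by auto
    have rest: "(\<forall>i\<in>E. Q {v\<in>V. ?h (f, g) (v, i)}) = (\<forall>i\<in>E. Q {v\<in>V. g (v, i)})"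
      by (intro ball_cong refl) (simp only: 2)
    have "((f, g) \<in> ?h -` (\<lambda>X i. {v \<in> V. X (v, i)}) -` {e. \<forall>i\<in>insert a E. Q (e i)}) =
        (\<forall>i\<in>insert a E. Q {v\<in>V. ?h (f, g) (v, i)})"
      by (simp only: vimage_eq mem_Collect_eq)
    also have "\<dots> = (Q {v\<in>V. ?h (f, g) (v, a)} \<and> (\<forall>i\<in>E. Q {v\<in>V. ?h (f, g) (v, i)}))"
      by blast
    also have "\<dots> = (Q {v\<in>V. f (v, a)} \<and> (\<forall>i\<in>E. Q {v\<in>V. g (v, i)}))"
      by (simp only: 1 rest)
    also have "\<dots> = ((f, g) \<in> {f. Q {v\<in>V. f (v, a)}} \<times> {g. \<forall>i\<in>E. Q {v\<in>V. g (v, i)}})"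
      by (simp only: mem_Times_iff fst_conv snd_conv mem_Collect_eq)
    finally show "((f, g) \<in> ?h -` (\<lambda>X i. {v \<in> V. X (v, i)}) -` {e. \<forall>i\<in>insert a E. Q (e i)}) =
        ((f, g) \<in> {f. Q {v\<in>V. f (v, a)}} \<times> {g. \<forall>i\<in>E. Q {v\<in>V. g (v, i)}})" .
  qed
  also have "\<dots> = measure_pmf.prob ?P {X. Q {v\<in>V. X v}} * 
      measure_pmf.prob (independent_edges V E p) {e. \<forall>i\<in>E. Q (e i)}"
    unfolding prob_pair_pmf_Times first by (simp add: independent_edges_def vimage_def)
  finally show ?case using insert by simp
qed

lemma prob_dependent_edges_all_le:
  fixes Q :: "'a set \<Rightarrow> bool" and \<beta> \<gamma> \<delta> s :: real
  assumes V: "finite V" and R: "finite R" and "0 \<le> \<beta>" "\<beta> \<le> 1" "\<gamma> \<ge> 0" "\<delta> \<le> 1"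
    and anti: "\<And>q. (\<And>v. v \<in> V \<Longrightarrow> 0 \<le> q v \<and> q v \<le> \<beta>) \<Longrightarrow> (\<Sum>v\<in>V. q v) \<ge> \<gamma> \<Longrightarrow>
      measure_pmf.prob (coins V q) {X. Q {v \<in> V. X v}} \<le> 1 - \<delta>"
    and F: "finite F" "F \<inter> R = {}"
    and k: "real k \<le> \<beta> * card R"
    and total: "real k * card V - s \<ge> \<gamma> * (card R + card F)"
  shows "measure_pmf.prob (dependent_edges V (R \<union> F) k)
     {e. (\<forall>i\<in>F. Q (e i)) \<and> real (\<Sum>i\<in>F. card (e i \<inter> V)) \<le> s} \<le> (1 - \<delta>) ^ card F"
proof -
  obtain xs where xs: "set xs = F" "distinct xs" using finite_distinct_list[OF F(1)] by blast
  have len: "length xs = card F" using xs distinct_card by fastforce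
  have "measure_pmf.prob (Pi_pmf V {} (\<lambda>v. uniform_subset (R \<union> set xs) k))
     {I. (\<forall>i\<in>set xs. Q {v\<in>V. i \<in> I v}) \<and> real (\<Sum>i\<in>set xs. card {v\<in>V. i \<in> I v}) \<le> s} \<le> (1 - \<delta>) ^ length xs"
    using assms xs len by (intro uniform_subsets_exposure[of V R \<beta> \<gamma> \<delta> Q xs "\<lambda>_. k"]) (auto simp: mult.commute)
  moreover have "{v\<in>V. i \<in> I v} \<inter> V = {v\<in>V. i \<in> I v}" for i and I :: "'a \<Rightarrow> 'b set" by auto
  ultimately show ?thesis unfolding xs len dependent_edges_def by (simp add: vimage_def)
qed

section \<open>Colourings of low discrepancy are unlikely\<close>

text \<open>With \<open>r = \<lfloor>l / 10\<rfloor>\<close> blocks the probability \<open>32 powr - r\<close> is at least \<open>exp (- l / 2)\<close>, as \<open>32 \<le> exp 4\<close>. The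
variance is at least \<open>\<epsilon>\<^sub>0 * \<mu> / 4\<close>, so the deviation is of order \<open>sqrt (r * \<epsilon>\<^sub>0 * \<mu>)\<close>.\<close>

lemma anticoncentration_log_scale:
  fixes \<mu> l \<epsilon>\<^sub>0 :: real
  assumes V: "finite V" and \<psi>: "\<psi> \<in> colourings V" and q: "\<And>v. v \<in> V \<Longrightarrow> 0 \<le> q v \<and> q v \<le> 1 - \<epsilon>\<^sub>0 / 2"
    and total: "(\<Sum>v\<in>V. q v) \<ge> \<mu> / 2" and \<epsilon>: "0 < \<epsilon>\<^sub>0" and l: "l \<ge> 20" and \<mu>: "\<epsilon>\<^sub>0 * \<mu> \<ge> l"
  shows "measure_pmf.prob (coins V q) 
     {X. \<bar>real_of_int (\<Sum>v | v \<in> V \<and> X v. \<psi> v)\<bar> < sqrt (\<epsilon>\<^sub>0 / 160) / 8 * sqrt (\<mu> * l)} \<le> 1 - exp (- l / 2)"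
proof -
  define r where "r = nat \<lfloor>l / 10\<rfloor>"
  have r: "real r \<le> l / 10" "real r \<ge> l / 20" "r > 0"
    unfolding r_def using l by (auto simp: le_nat_floor) linarith+
  define w where "w = \<epsilon>\<^sub>0 * \<mu> / 4 / r - 1"
  have rw: "real r * (w + 1) = \<epsilon>\<^sub>0 * \<mu> / 4" using r by (simp add: w_def)
  have "2 * real r \<le> \<epsilon>\<^sub>0 * \<mu> / 4" using r \<mu> by linarith
  hence w2: "\<epsilon>\<^sub>0 * \<mu> / 4 / r \<ge> 2" using r by (simp add: field_simps)
  hence w1: "w \<ge> 1" "w \<ge> \<epsilon>\<^sub>0 * \<mu> / 4 / r / 2" by (auto simp: w_def)
  have "\<epsilon>\<^sub>0 / 2 * (\<mu> / 2) \<le> \<epsilon>\<^sub>0 / 2 * (\<Sum>v\<in>V. q v)" using total \<epsilon> by (intro mult_left_mono) auto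
  also have "\<dots> = (\<Sum>v\<in>V. q v * (\<epsilon>\<^sub>0 / 2))" by (simp add: sum_distrib_left mult.commute)
  also have "\<dots> \<le> (\<Sum>v\<in>V. q v * (1 - q v))" 
  proof (intro sum_mono mult_left_mono)
    fix v assume "v \<in> V"
    thus "\<epsilon>\<^sub>0 / 2 \<le> 1 - q v" "0 \<le> q v" using q[of v] by linarith+
  qed
  finally have var: "(\<Sum>v\<in>V. q v * (1 - q v)) \<ge> real r * (w + 1)" using rw by simp
  have "exp (- l / 2) \<le> exp (- (4 * real r))" using r by simp
  also have "\<dots> = exp (- 4) ^ r" by (simp add: mult.commute flip: exp_of_nat_mult)
  also have "\<dots> \<le> (1 / 32) ^ r"
  proof (intro power_mono)
    have "2.5 \<le> exp (1::real)" using exp_lower_Taylor_quadratic[of "1::real"] by simp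
    hence "2.5 ^ 4 \<le> exp (1::real) ^ 4" by (intro power_mono) auto
    also have "exp (1::real) ^ 4 = exp 4" by (simp flip: exp_of_nat_mult)
    finally have "32 \<le> exp (4::real)" by (simp add: power_divide)
    thus "exp (- 4) \<le> (1 / 32 :: real)" by (simp add: exp_minus field_simps)
  qed auto
  also have "\<dots> \<le> measure_pmf.prob (coins V q) {X. \<bar>real_of_int (\<Sum>v | v \<in> V \<and> X v. \<psi> v)\<bar> \<ge> real r * (sqrt w / 8)}"
  proof (rule signed_sum_anticoncentration[OF V _ _ var w1(1) r(3)])
    show "0 \<le> q v \<and> q v \<le> 1" if "v \<in> V" for v using q[OF that] \<epsilon> by linarith
    show "\<psi> v \<in> {-1, 1}" if "v \<in> V" for v using \<psi> that by (auto simp: colourings_def PiE_def Pi_def)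
  qed
  also have "\<dots> \<le> measure_pmf.prob (coins V q) (- {X. \<bar>real_of_int (\<Sum>v | v \<in> V \<and> X v. \<psi> v)\<bar> < sqrt (\<epsilon>\<^sub>0 / 160) / 8 * sqrt (\<mu> * l)})"
  proof -
    have \<mu>0: "\<mu> > 0" using \<mu> l \<epsilon> by (smt (verit) mult_nonneg_nonpos)
    have "\<epsilon>\<^sub>0 / 160 * (\<mu> * l) = l / 20 * (\<epsilon>\<^sub>0 * \<mu> / 8)" by simp
    also have "\<dots> \<le> real r * (\<epsilon>\<^sub>0 * \<mu> / 8)" using r \<epsilon> \<mu>0 by (intro mult_right_mono) auto
    also have "\<dots> = (real r)\<^sup>2 * (\<epsilon>\<^sub>0 * \<mu> / 4 / r / 2)" using r by (simp add: power2_eq_square)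
    also have "\<dots> \<le> (real r)\<^sup>2 * w" using w1 by (intro mult_left_mono) auto
    finally have "sqrt (\<epsilon>\<^sub>0 / 160 * (\<mu> * l)) \<le> sqrt ((real r)\<^sup>2 * w)" by (rule real_sqrt_le_mono)
    hence "sqrt (\<epsilon>\<^sub>0 / 160) * sqrt (\<mu> * l) \<le> real r * sqrt w"
      by (simp only: real_sqrt_mult real_sqrt_abs abs_of_nat)
    thus ?thesis by (intro measure_pmf.finite_measure_mono) (auto simp del: of_int_sum)
  qed
  also have "\<dots> = 1 - measure_pmf.prob (coins V q) {X. \<bar>real_of_int (\<Sum>v | v \<in> V \<and> X v. \<psi> v)\<bar> < sqrt (\<epsilon>\<^sub>0 / 160) / 8 * sqrt (\<mu> * l)}"
    using measure_pmf.prob_compl[of _ "coins V q"] by (simp add: Compl_eq_Diff_UNIV)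
  finally show ?thesis by linarith
qed

lemma prob_Union_colourings_le:
  assumes "finite V" "\<And>\<psi>. \<psi> \<in> colourings V \<Longrightarrow> measure_pmf.prob P {e. Q \<psi> e} \<le> exp (- (2 * card V))"
  shows "measure_pmf.prob P {e. \<exists>\<psi>\<in>colourings V. Q \<psi> e} \<le> exp (- real (card V))"
proof -
  have "measure_pmf.prob P {e. \<exists>\<psi>\<in>colourings V. Q \<psi> e} = measure_pmf.prob P (\<Union>\<psi>\<in>colourings V. {e. Q \<psi> e})"
    by (rule arg_cong[of _ _ "measure_pmf.prob _"]) auto
  also have "\<dots> \<le> (\<Sum>\<psi>\<in>colourings V. measure_pmf.prob P {e. Q \<psi> e})"
    using assms by (intro measure_pmf.finite_measure_subadditive_finite finite_colourings) auto
  also have "\<dots> \<le> (\<Sum>\<psi>\<in>colourings V. exp (- (2 * card V)))" by (intro sum_mono assms)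
  also have "\<dots> = 2 ^ card V * exp (- (2 * card V))" using assms by (simp add: card_colourings)
  also have "\<dots> \<le> exp 1 ^ card V * exp (- (2 * card V))"
    using exp_ge_add_one_self[of "1::real"] by (intro mult_right_mono power_mono) auto
  also have "\<dots> = exp (- real (card V))" by (simp flip: exp_of_nat_mult exp_add)
  finally show ?thesis .
qed

lemma power_one_minus_le_exp:
  fixes \<delta> :: real
  assumes "\<delta> \<le> 1"
  shows "(1 - \<delta>) ^ N \<le> exp (- (\<delta> * N))"
proof -
  have "(1 - \<delta>) ^ N \<le> exp (- \<delta>) ^ N"
    using assms exp_ge_add_one_self[of "- \<delta>"] by (intro power_mono) auto
  also have "\<dots> = exp (- (\<delta> * N))" by (simp add: mult.commute flip: exp_of_nat_mult)
  finally show ?thesis .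
qed

lemma prob_independent_edges_low_disc_le:
  fixes p \<epsilon>\<^sub>0 :: real and V :: "'a set" and E :: "'i set"
  assumes V: "finite V" "V \<noteq> {}" and E: "finite E" and p: "0 \<le> p" "p \<le> 1 - \<epsilon>\<^sub>0" and \<epsilon>: "0 < \<epsilon>\<^sub>0"
  defines "l \<equiv> ln (card E / card V)"
  assumes l: "l \<ge> 20" and \<mu>: "\<epsilon>\<^sub>0 * (p * card V) \<ge> l" 
  shows "measure_pmf.prob (independent_edges V E p) {e. \<exists>\<psi>\<in>colourings V. \<forall>i\<in>E. 
     \<bar>real_of_int (\<Sum>v\<in>e i. \<psi> v)\<bar> < sqrt (\<epsilon>\<^sub>0 / 160) / 8 * sqrt (p * card V * l)} \<le> exp (- real (card V))"
proof (rule prob_Union_colourings_le[OF V(1)])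
  let ?n = "real (card V)" and ?m = "real (card E)"
  fix \<psi> assume \<psi>: "\<psi> \<in> colourings V"
  define Q where "Q = (\<lambda>e. \<bar>real_of_int (\<Sum>v\<in>e. \<psi> v)\<bar> < sqrt (\<epsilon>\<^sub>0 / 160) / 8 * sqrt (p * ?n * l))"
  have n: "?n > 0" using V by (simp add: card_gt_0_iff)
  have m: "?m > 0" using l unfolding l_def by (cases "?m = 0") auto
  have "measure_pmf.prob (coins V (\<lambda>_. p)) {X. Q {v\<in>V. X v}} \<le> 1 - exp (- l / 2)"
    unfolding Q_def
  proof (rule anticoncentration_log_scale[OF V(1) \<psi> _ _ \<epsilon> l \<mu>])
    show "p * ?n / 2 \<le> (\<Sum>v\<in>V. p)" using p n by simp
  qed (use p \<epsilon> in auto)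
  moreover have "measure_pmf.prob (independent_edges V E p) {e. \<forall>i\<in>E. Q (e i)} = 
      measure_pmf.prob (coins V (\<lambda>_. p)) {X. Q {v\<in>V. X v}} ^ card E"
    by (rule prob_independent_edges_all[OF E V(1)])
  ultimately have "measure_pmf.prob (independent_edges V E p) {e. \<forall>i\<in>E. Q (e i)} \<le> (1 - exp (- l / 2)) ^ card E"
    by (simp add: power_mono)
  also have "\<dots> \<le> exp (- (exp (- l / 2) * ?m))" using l by (intro power_one_minus_le_exp) simp
  also have "exp (- l / 2) * ?m = exp (- l / 2) * exp l * ?n"
    using n m by (simp add: l_def)
  also have "\<dots> = exp (l / 2) * ?n" by (simp flip: exp_add)
  also have "exp (- (exp (l / 2) * ?n)) \<le> exp (- (2 * ?n))"
  proof -
    have "2 \<le> exp (l / 2)" using exp_ge_add_one_self[of "l / 2"] l by linarith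
    thus ?thesis using n by (simp add: mult_right_mono)
  qed
  finally show "measure_pmf.prob (independent_edges V E p) {e. \<forall>i\<in>E. 
     \<bar>real_of_int (\<Sum>v\<in>e i. \<psi> v)\<bar> < sqrt (\<epsilon>\<^sub>0 / 160) / 8 * sqrt (p * ?n * l)} \<le> exp (- (2 * card V))"
    by (simp add: Q_def)
qed

text \<open>Only the first \<open>\<epsilon>\<^sub>0 / 4 * m\<close> edges are exposed. This keeps the conditional probabilities at most
\<open>1 - \<epsilon>\<^sub>0 / 2\<close>, and these edges contain less than a quarter of all incidences on average, so it is unlikely that
they use up half of them.\<close>

lemma prob_dependent_edges_low_disc_le:
  fixes \<epsilon>\<^sub>0 :: real and V :: "'a set" and m k :: nat
  assumes V: "finite V" "V \<noteq> {}" and k: "k > 0" "real k \<le> (1 - \<epsilon>\<^sub>0) * m" and \<epsilon>: "0 < \<epsilon>\<^sub>0"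
  defines "l \<equiv> ln (m / card V)"
  assumes l: "l \<ge> 20" "exp (l / 2) \<ge> 16 / \<epsilon>\<^sub>0" and \<mu>0: "\<epsilon>\<^sub>0 * (k / m * card V) \<ge> l" and m4: "\<epsilon>\<^sub>0 * m \<ge> 4"
  shows "measure_pmf.prob (dependent_edges V {1..m} k) {e. \<exists>\<psi>\<in>colourings V. \<forall>i\<in>{1..m}. 
     \<bar>real_of_int (\<Sum>v\<in>e i. \<psi> v)\<bar> < sqrt (\<epsilon>\<^sub>0 / 160) / 8 * sqrt (k / m * card V * l)}
    \<le> exp (- real (card V)) + exp (- real (card V) / 12)"
proof -
  let ?n = "real (card V)"
  have n: "?n > 0" using V by (simp add: card_gt_0_iff)
  have m: "real m > 0" using m4 by (cases "m = 0") auto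
  have k1: "(1 - \<epsilon>\<^sub>0) * m > 0" using k by linarith
  hence \<epsilon>1: "\<epsilon>\<^sub>0 < 1" using m by (simp add: zero_less_mult_iff)
  define \<mu> where "\<mu> = k / m * ?n"
  define f where "f = nat \<lfloor>\<epsilon>\<^sub>0 / 4 * m\<rfloor>"
  have f: "real f \<le> \<epsilon>\<^sub>0 / 4 * m" "real f \<ge> \<epsilon>\<^sub>0 / 8 * m"
  proof -
    have "\<lfloor>\<epsilon>\<^sub>0 / 4 * m\<rfloor> \<ge> 1" using m4 by (simp add: le_floor_iff)
    moreover have "real_of_int \<lfloor>\<epsilon>\<^sub>0 / 4 * m\<rfloor> > \<epsilon>\<^sub>0 / 4 * m - 1" "real_of_int \<lfloor>\<epsilon>\<^sub>0 / 4 * m\<rfloor> \<le> \<epsilon>\<^sub>0 / 4 * m"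
      by linarith+
    ultimately show "real f \<le> \<epsilon>\<^sub>0 / 4 * m" "real f \<ge> \<epsilon>\<^sub>0 / 8 * m"
      unfolding f_def by linarith+
  qed
  have "\<epsilon>\<^sub>0 / 4 * m \<le> 1 * real m" using \<epsilon>1 by (intro mult_right_mono) auto
  hence fm: "f \<le> m" using f by linarith
  define F where "F = {1..f}"
  define R where "R = {f+1..m}"
  have FR: "finite F" "finite R" "F \<inter> R = {}" "{1..m} = R \<union> F" "card F = f" "card R = m - f"
    using fm by (auto simp: F_def R_def)
  define s where "s = real k * ?n / 2"
  let ?P = "dependent_edges V {1..m} k"
  let ?low = "\<lambda>\<psi> e. \<bar>real_of_int (\<Sum>v\<in>e. \<psi> v)\<bar> < sqrt (\<epsilon>\<^sub>0 / 160) / 8 * sqrt (\<mu> * l)"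
  let ?small = "\<lambda>e. real (\<Sum>i\<in>F. card (e i \<inter> V)) \<le> s"
  have km: "k \<le> m"
  proof -
    have "real k \<le> (1 - \<epsilon>\<^sub>0) * m" by fact
    also have "\<dots> \<le> 1 * real m" using \<epsilon> by (intro mult_right_mono) auto
    finally show ?thesis by simp
  qed
  have large_total: "measure_pmf.prob ?P {e. \<not> ?small e} \<le> exp (- ?n / 12)"
  proof -
    have "measure_pmf.prob ?P {e. \<not> ?small e} \<le> exp (k / m * ?n * f) / 2 powr s"
      using spread_prob_total_size_le[OF spread_dependent_edges[OF V(1), of "{1..m}" k] V(1), of F s] km FR fm
      by (simp add: not_le F_def)
    also have "\<dots> = exp (k / m * ?n * f - s * ln 2)" by (simp add: powr_def exp_diff)
    also have "\<dots> \<le> exp (- ?n / 12)"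
    proof -
      have "k / m * ?n * f \<le> k / m * ?n * (1 / 4 * m)"
        using f \<epsilon>1 m n by (intro mult_left_mono) (auto intro: order.trans mult_right_mono)
      also have "\<dots> = real k * ?n / 4" using m by simp
      finally have "k / m * ?n * f \<le> real k * ?n / 4" .
      moreover have "s * ln 2 \<ge> s * (2 / 3)"
        using ln2_ge_two_thirds n by (intro mult_left_mono) (auto simp: s_def)
      ultimately have "k / m * ?n * f - s * ln 2 \<le> - (real k * ?n / 12)" by (simp add: s_def)
      also have "\<dots> \<le> - (1 * ?n / 12)" using k n by (simp add: mult_right_mono)
      finally show ?thesis by simp
    qed
    finally show ?thesis .
  qed
  have each: "measure_pmf.prob ?P {e. (\<forall>i\<in>F. ?low \<psi> (e i)) \<and> ?small e} \<le> exp (- (2 * card V))"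
    if \<psi>: "\<psi> \<in> colourings V" for \<psi>
  proof -
    have "measure_pmf.prob ?P {e. (\<forall>i\<in>F. ?low \<psi> (e i)) \<and> ?small e} \<le> (1 - exp (- l / 2)) ^ card F"
      unfolding FR(4)
    proof (rule prob_dependent_edges_all_le[where \<beta> = "1 - \<epsilon>\<^sub>0 / 2" and \<gamma> = "\<mu> / 2", OF V(1) FR(2) _ _ _ _ _ FR(1,3)])
      show "measure_pmf.prob (coins V q) {X. ?low \<psi> {v\<in>V. X v}} \<le> 1 - exp (- l / 2)"
        if "\<And>v. v \<in> V \<Longrightarrow> 0 \<le> q v \<and> q v \<le> 1 - \<epsilon>\<^sub>0 / 2" "\<mu> / 2 \<le> (\<Sum>v\<in>V. q v)" for q
        using anticoncentration_log_scale[OF V(1) \<psi> that \<epsilon> l(1)] \<mu>0 by (simp add: \<mu>_def)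
      have "(1 - \<epsilon>\<^sub>0) * m \<le> (1 - \<epsilon>\<^sub>0 / 2) * (1 - \<epsilon>\<^sub>0 / 4) * m"
        using \<epsilon> by (intro mult_right_mono) (auto simp: algebra_simps)
      also have "\<dots> \<le> (1 - \<epsilon>\<^sub>0 / 2) * (real m - f)"
        unfolding mult.assoc using f \<epsilon>1 by (intro mult_left_mono) (auto simp: algebra_simps)
      finally show "real k \<le> (1 - \<epsilon>\<^sub>0 / 2) * card R"
        using k fm by (simp add: FR of_nat_diff)
      show "\<mu> / 2 * (card R + card F) \<le> real k * card V - s"
        using m fm by (simp add: FR \<mu>_def s_def)
    qed (use \<epsilon> \<epsilon>1 l n in \<open>auto simp: \<mu>_def\<close>)
    also have "\<dots> \<le> exp (- (exp (- l / 2) * card F))" using l by (intro power_one_minus_le_exp) simp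
    also have "\<dots> \<le> exp (- (2 * ?n))"
    proof -
      have "2 * ?n = 16 / \<epsilon>\<^sub>0 * (\<epsilon>\<^sub>0 / 8 * ?n)" using \<epsilon> by simp
      also have "\<dots> \<le> exp (l / 2) * (\<epsilon>\<^sub>0 / 8 * ?n)" using l \<epsilon> n by (intro mult_right_mono) auto
      also have "\<dots> = exp (- l / 2) * (\<epsilon>\<^sub>0 / 8 * (exp l * ?n))" by (simp flip: exp_add)
      also have "exp l * ?n = m" using n m by (simp add: l_def)
      also have "exp (- l / 2) * (\<epsilon>\<^sub>0 / 8 * m) \<le> exp (- l / 2) * card F"
        using f by (intro mult_left_mono) (auto simp: FR)
      finally show ?thesis by simp
    qed
    finally show ?thesis by simp
  qed
  have "measure_pmf.prob ?P {e. \<exists>\<psi>\<in>colourings V. \<forall>i\<in>{1..m}. ?low \<psi> (e i)} \<le>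
      measure_pmf.prob ?P ({e. \<exists>\<psi>\<in>colourings V. (\<forall>i\<in>F. ?low \<psi> (e i)) \<and> ?small e} \<union> {e. \<not> ?small e})"
  proof (intro measure_pmf.finite_measure_mono)
    have "F \<subseteq> {1..m}" using FR(4) by blast
    thus "{e. \<exists>\<psi>\<in>colourings V. \<forall>i\<in>{1..m}. ?low \<psi> (e i)} \<subseteq>
        {e. \<exists>\<psi>\<in>colourings V. (\<forall>i\<in>F. ?low \<psi> (e i)) \<and> ?small e} \<union> {e. \<not> ?small e}" by blast
  qed simp
  also have "\<dots> \<le> measure_pmf.prob ?P {e. \<exists>\<psi>\<in>colourings V. (\<forall>i\<in>F. ?low \<psi> (e i)) \<and> ?small e} + 
      measure_pmf.prob ?P {e. \<not> ?small e}"
    by (rule measure_Un_le) auto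
  also have "\<dots> \<le> exp (- ?n) + exp (- ?n / 12)"
    using prob_Union_colourings_le[OF V(1) each] large_total by (intro add_mono) auto
  finally show ?thesis by (simp add: \<mu>_def)
qed

section \<open>The discrepancy of the random hypergraphs\<close>

lemma disc_colouring_hypergraph_of:
  assumes "m > 0"
  shows "disc_colouring (snd (hypergraph_of n m e)) \<psi> = Max ((\<lambda>i. \<bar>\<Sum>v\<in>e i. \<psi> v\<bar>) ` {1..m})"
  using assms by (simp add: disc_colouring_def hypergraph_of_def image_image)

lemma disc_hypergraph_of_le:
  assumes "m > 0" "\<psi> \<in> colourings {1..n}" "\<And>i. i \<in> {1..m} \<Longrightarrow> \<bar>real_of_int (\<Sum>v\<in>e i. \<psi> v)\<bar> \<le> D"
  shows "real_of_int (disc (hypergraph_of n m e)) \<le> D"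
proof -
  let ?H = "hypergraph_of n m e"
  have "disc ?H \<le> disc_colouring (snd ?H) \<psi>"
    unfolding disc_def using assms(2) 
    by (intro Min_le finite_imageI imageI) (auto simp: hypergraph_of_def intro: finite_colourings)
  moreover have "disc_colouring (snd ?H) \<psi> \<in> (\<lambda>i. \<bar>\<Sum>v\<in>e i. \<psi> v\<bar>) ` {1..m}"
    unfolding disc_colouring_hypergraph_of[OF assms(1)] using assms(1) by (intro Max_in) auto
  then obtain i where i: "i \<in> {1..m}" "disc_colouring (snd ?H) \<psi> = \<bar>\<Sum>v\<in>e i. \<psi> v\<bar>" by blast
  moreover have "real_of_int \<bar>\<Sum>v\<in>e i. \<psi> v\<bar> \<le> D" using assms(3)[OF i(1)] by (simp del: of_int_sum)
  ultimately show ?thesis by linarith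
qed

lemma disc_hypergraph_of_less:
  assumes "m > 0" "real_of_int (disc (hypergraph_of n m e)) < t"
  shows "\<exists>\<psi>\<in>colourings {1..n}. \<forall>i\<in>{1..m}. \<bar>real_of_int (\<Sum>v\<in>e i. \<psi> v)\<bar> < t"
proof -
  let ?H = "hypergraph_of n m e"
  have "colourings {1..n} \<noteq> {}" by (auto simp: colourings_def PiE_eq_empty_iff)
  hence "Min (disc_colouring (snd ?H) ` colourings {1..n}) \<in> disc_colouring (snd ?H) ` colourings {1..n}"
    by (intro Min_in) (auto intro: finite_colourings)
  moreover have "disc ?H = Min (disc_colouring (snd ?H) ` colourings {1..n})"
    by (simp add: disc_def hypergraph_of_def)
  ultimately have "disc ?H \<in> disc_colouring (snd ?H) ` colourings {1..n}" by simp
  then obtain \<psi> where \<psi>: "\<psi> \<in> colourings {1..n}" "disc ?H = disc_colouring (snd ?H) \<psi>" by blast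
  have "\<bar>real_of_int (\<Sum>v\<in>e i. \<psi> v)\<bar> < t" if i: "i \<in> {1..m}" for i
  proof -
    have "\<bar>\<Sum>v\<in>e i. \<psi> v\<bar> \<le> disc ?H"
      unfolding \<psi>(2) disc_colouring_hypergraph_of[OF assms(1)] using i by (intro Max_ge) auto
    hence "real_of_int \<bar>\<Sum>v\<in>e i. \<psi> v\<bar> \<le> real_of_int (disc ?H)" by (simp only: of_int_le_iff)
    thus ?thesis using assms(2) by (simp del: of_int_sum)
  qed
  thus ?thesis using \<psi>(1) by blast
qed

lemma edge_independent_altdef:
  "edge_independent n m p = map_pmf (hypergraph_of n m) (independent_edges {1..n} {1..m} p)"
  by (simp add: edge_independent_def independent_edges_def map_pmf_comp)

lemma edge_dependent_altdef:
  "edge_dependent n m k = map_pmf (hypergraph_of n m) (dependent_edges {1..n} {1..m} k)"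
  by (simp add: edge_dependent_def dependent_edges_def map_pmf_comp uniform_subset_def)

text \<open>The bound \<open>\<tau> + drift\<close> of the colouring construction in units of \<open>\<tau>\<close>, once \<open>ln (80 * \<lambda>) \<le> 2 * ln \<lambda>\<close>.\<close>

definition upper_factor :: real where
  "upper_factor = 1 + 4 * sqrt (2 * exp 3) / (1 - (9/10) powr (1/8))"

lemma upper_factor_ge_one: "upper_factor \<ge> 1"
proof -
  have "(9/10::real) powr (1/8) < 1 powr (1/8)" by (intro powr_less_mono2) auto
  thus ?thesis by (simp add: upper_factor_def)
qed

text \<open>Everything follows from \<open>\<tau> \<ge> l\<close>: the constant \<open>102400 = 320\<^sup>2\<close> ensures \<open>sqrt \<tau> \<ge> 320\<close>, and it exceeds
\<open>4 * (exp 3)\<^sup>2\<close>, as is needed for the bound on \<open>\<alpha>\<close>.\<close>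

lemma prob_high_disc_le:
  fixes p :: real
  assumes spread: "spread P {1..n} {1..m} p" and P: "\<And>e i. e \<in> set_pmf P \<Longrightarrow> e i \<subseteq> {1..n}"
    and n: "n > 0" and p: "0 \<le> p" "p \<le> 1"
  defines "l \<equiv> ln (m / n)"
  assumes l: "l \<ge> 102400" and \<mu>: "p * n \<ge> l"
  shows "measure_pmf.prob P {e. \<not> real_of_int (disc (hypergraph_of n m e)) \<le> upper_factor * sqrt (p * n * l)} \<le> 1 / n"
proof -
  define \<mu> where "\<mu> = p * n"
  define \<tau> where "\<tau> = sqrt (\<mu> * l)"
  define \<alpha> where "\<alpha> = exp 3 * \<mu>"
  have m0: "real m > 0" using l by (cases "m = 0") (auto simp: l_def)
  have m: "m > 0" using m0 by simp
  have el: "exp l = m / n" using m0 n by (simp add: l_def)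
  have "m / n \<ge> 102400 + 1" using exp_ge_add_one_self[of l] l el by linarith
  hence mn: "real n * 102400 \<le> m" using n by (simp add: field_simps)
  have \<mu>l: "\<mu> \<ge> l" "\<mu> > 0" "\<mu> \<le> n" using \<mu> l p by (auto simp: \<mu>_def mult_left_le_one_le)
  have "l = sqrt (l * l)" using l by simp
  also have "\<dots> \<le> \<tau>" unfolding \<tau>_def using \<mu>l l by (intro real_sqrt_le_mono mult_right_mono) auto
  finally have \<tau>l: "\<tau> \<ge> l" .
  have "sqrt (320\<^sup>2) \<le> sqrt \<tau>" using \<tau>l l by (intro real_sqrt_le_mono) simp
  hence \<tau>320: "sqrt \<tau> \<ge> 320" by simp
  have e3: "exp 3 \<le> (27::real)"
  proof -
    have "exp 1 ^ 3 \<le> (3::real) ^ 3" using exp_le by (intro power_mono) auto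
    thus ?thesis by (simp flip: exp_of_nat_mult)
  qed
  have \<alpha>2: "4 * \<alpha>\<^sup>2 \<le> n * \<tau>\<^sup>2"
  proof -
    have "4 * \<alpha>\<^sup>2 = 4 * (exp 3)\<^sup>2 * \<mu> * \<mu>" by (simp add: \<alpha>_def power2_eq_square)
    also have "\<dots> \<le> l * \<mu> * n"
    proof (intro mult_mono)
      have "(exp 3)\<^sup>2 \<le> (27::real)\<^sup>2" using e3 by (intro power_mono) auto
      thus "4 * (exp 3)\<^sup>2 \<le> l" using l by simp
    qed (use \<mu>l l in auto)
    also have "\<dots> = n * \<tau>\<^sup>2" using \<mu>l l by (simp add: \<tau>_def)
    finally show ?thesis .
  qed
  define bad where "bad = {e. \<exists>U\<subseteq>{1..n}. U \<noteq> {} \<and>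
      (\<Sum>i | i \<in> {1..m} \<and> real (trace_size e U i) > max \<tau> (\<alpha> * sqrt (card U / n)). real (trace_size e U i)) > 8 * card U}"
  have good: "real_of_int (disc (hypergraph_of n m e)) \<le> upper_factor * sqrt (p * n * l)"
    if e: "e \<notin> bad" "e \<in> set_pmf P" for e
  proof -
    interpret sparse_traces "{1..n}" "{1..m}" e \<tau> \<alpha>
      using n mn \<tau>320 \<mu>l \<alpha>2 e by unfold_locales (auto simp: \<alpha>_def bad_def not_less)
    obtain z where z: "\<And>v. v \<in> {1..n} \<Longrightarrow> z v \<in> {-1, 1::int}"
      "\<And>i. i \<in> {1..m} \<Longrightarrow> \<bar>real_of_int (\<Sum>v\<in>e i \<inter> {1..n}. z v)\<bar> \<le> \<tau> + drift"
    proof -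
      have one: "(real (card {1..n}) / real (card {1..n})) powr (1/8) = 1" using n by simp
      from colour_set[OF order.refl, unfolded one mult_1_right] that show ?thesis by blast
    qed
    define \<psi> where "\<psi> = restrict z {1..n}"
    have "\<psi> \<in> colourings {1..n}" using z(1) by (auto simp: \<psi>_def colourings_def)
    moreover have "\<bar>real_of_int (\<Sum>v\<in>e i. \<psi> v)\<bar> \<le> \<tau> + drift" if i: "i \<in> {1..m}" for i
    proof -
      have "(\<Sum>v\<in>e i. \<psi> v) = (\<Sum>v\<in>e i \<inter> {1..n}. z v)"
        using P[OF e(2), of i] by (intro sum.cong) (auto simp: \<psi>_def)
      thus ?thesis using z(2)[OF i] by simp
    qed
    ultimately have "real_of_int (disc (hypergraph_of n m e)) \<le> \<tau> + drift"
      by (intro disc_hypergraph_of_le[OF m]) auto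
    also have "\<dots> \<le> upper_factor * \<tau>"
    proof -
      have "(9/10::real) powr (1/8) < 1 powr (1/8)" by (intro powr_less_mono2) auto
      hence c: "1 - (9/10::real) powr (1/8) > 0" by simp
      have "ln (80 * (m / n)) = ln 80 + l" unfolding l_def using m n by (intro ln_mult_pos) auto
      also have "ln 80 \<le> (80::real)" using ln_le_minus_one[of "80::real"] by linarith
      finally have "ln (80 * (m / n)) \<le> 2 * l" using l by linarith
      hence "sqrt (\<alpha> * ln (80 * (m / n))) \<le> sqrt (\<alpha> * (2 * l))"
        using \<mu>l by (intro real_sqrt_le_mono mult_left_mono) (auto simp: \<alpha>_def)
      also have "\<alpha> * (2 * l) = (2 * exp 3) * (\<mu> * l)" by (simp add: \<alpha>_def)
      also have "sqrt \<dots> = sqrt (2 * exp 3) * \<tau>" by (simp only: real_sqrt_mult \<tau>_def)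
      finally have "drift \<le> 4 * (sqrt (2 * exp 3) * \<tau>) / (1 - (9/10) powr (1/8))"
        unfolding drift_def using c by (intro divide_right_mono mult_left_mono) auto
      thus ?thesis by (simp add: upper_factor_def algebra_simps)
    qed
    finally show ?thesis by (simp add: \<tau>_def \<mu>_def)
  qed
  have "measure_pmf.prob P {e. \<not> real_of_int (disc (hypergraph_of n m e)) \<le> upper_factor * sqrt (p * n * l)} =
      measure_pmf.prob P ({e. \<not> real_of_int (disc (hypergraph_of n m e)) \<le> upper_factor * sqrt (p * n * l)} \<inter> set_pmf P)"
    by (simp add: measure_Int_set_pmf)
  also have "\<dots> \<le> measure_pmf.prob P bad"
    using good by (intro measure_pmf.finite_measure_mono) auto
  also have "\<dots> \<le> 1 / n"
    using spread_prob_some_large_traces_le[OF spread, of \<tau> \<alpha>] n p \<tau>l l mn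
    by (simp add: bad_def \<alpha>_def \<mu>_def l_def[symmetric])
  finally show ?thesis .
qed

lemma prob_disc_in_range:
  fixes p \<epsilon>\<^sub>0 :: real
  assumes H: "H = edge_independent n m p \<or> (\<exists>k. H = edge_dependent n m k \<and> p = k / m)"
    and n: "n > 0" and p: "0 < p" "p \<le> 1 - \<epsilon>\<^sub>0" and \<epsilon>: "0 < \<epsilon>\<^sub>0"
  defines "l \<equiv> ln (m / n)"
  assumes l: "l \<ge> 102400" "l \<ge> 32 / \<epsilon>\<^sub>0" and \<mu>: "\<epsilon>\<^sub>0 * (p * n) \<ge> l"
  shows "measure_pmf.prob H {h. sqrt (\<epsilon>\<^sub>0 / 160) / 8 * sqrt (p * n * l) \<le> real_of_int (disc h) \<and>
      real_of_int (disc h) \<le> upper_factor * sqrt (p * n * l)} \<ge> 1 - 14 / n"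
proof -
  let ?lo = "sqrt (\<epsilon>\<^sub>0 / 160) / 8 * sqrt (p * n * l)" and ?hi = "upper_factor * sqrt (p * n * l)"
  have m0: "real m > 0" using l by (cases "m = 0") (auto simp: l_def)
  have m: "m > 0" using m0 by simp
  have \<epsilon>1: "\<epsilon>\<^sub>0 < 1" using p by linarith
  have "\<epsilon>\<^sub>0 * (p * n) \<le> 1 * (p * n)" using \<epsilon>1 p by (intro mult_right_mono) auto
  hence \<mu>1: "p * n \<ge> l" using \<mu> by linarith
  have el: "exp l = m / n" using m0 n by (simp add: l_def)
  have exps: "exp (- real n) \<le> 1 / n" "exp (- real n / 12) \<le> 12 / n"
  proof -
    have "real n \<le> exp (real n)" "real n / 12 \<le> exp (real n / 12)"
      using exp_ge_add_one_self[of "real n"] exp_ge_add_one_self[of "real n / 12"] by linarith+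
    thus "exp (- real n) \<le> 1 / n" "exp (- real n / 12) \<le> 12 / n"
      using n by (auto simp: exp_minus field_simps)
  qed
  obtain P where P: "H = map_pmf (hypergraph_of n m) P" "spread P {1..n} {1..m} p"
    "\<And>e i. e \<in> set_pmf P \<Longrightarrow> e i \<subseteq> {1..n}"
    and low: "measure_pmf.prob P {e. \<exists>\<psi>\<in>colourings {1..n}. \<forall>i\<in>{1..m}. 
     \<bar>real_of_int (\<Sum>v\<in>e i. \<psi> v)\<bar> < ?lo} \<le> exp (- real n) + exp (- real n / 12)"
  proof (cases "H = edge_independent n m p")
    case True
    show ?thesis
    proof (rule that[of "independent_edges {1..n} {1..m} p"])
      show "H = map_pmf (hypergraph_of n m) (independent_edges {1..n} {1..m} p)"
        using True by (simp add: edge_independent_altdef)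
      show "spread (independent_edges {1..n} {1..m} p) {1..n} {1..m} p"
        using p \<epsilon> by (intro spread_independent_edges) auto
      show "\<And>e i. e \<in> set_pmf (independent_edges {1..n} {1..m} p) \<Longrightarrow> e i \<subseteq> {1..n}"
        by (auto simp: independent_edges_def)
      have "measure_pmf.prob (independent_edges {1..n} {1..m} p) {e. \<exists>\<psi>\<in>colourings {1..n}. \<forall>i\<in>{1..m}. 
          \<bar>real_of_int (\<Sum>v\<in>e i. \<psi> v)\<bar> < ?lo} \<le> exp (- real n)"
        using prob_independent_edges_low_disc_le[of "{1..n}" "{1..m}" p \<epsilon>\<^sub>0] n p \<epsilon> l \<mu> by (simp add: l_def)
      thus "measure_pmf.prob (independent_edges {1..n} {1..m} p) {e. \<exists>\<psi>\<in>colourings {1..n}. \<forall>i\<in>{1..m}. 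
          \<bar>real_of_int (\<Sum>v\<in>e i. \<psi> v)\<bar> < ?lo} \<le> exp (- real n) + exp (- real n / 12)"
        using exp_ge_zero[of "- real n / 12"] by linarith
    qed
  next
    case False
    then obtain k where k: "H = edge_dependent n m k" "p = k / m" using H by blast
    have k': "real k \<le> (1 - \<epsilon>\<^sub>0) * m" "k > 0" using p m0 k(2) by (auto simp: field_simps intro: gr0I)
    have "(1 - \<epsilon>\<^sub>0) * m \<le> 1 * real m" using \<epsilon> by (intro mult_right_mono) auto
    hence km: "k \<le> m" using k' by linarith
    show ?thesis
    proof (rule that[of "dependent_edges {1..n} {1..m} k"])
      show "H = map_pmf (hypergraph_of n m) (dependent_edges {1..n} {1..m} k)"
        using k by (simp add: edge_dependent_altdef)
      show "spread (dependent_edges {1..n} {1..m} k) {1..n} {1..m} p"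
        using spread_dependent_edges[of "{1..n}" "{1..m}" k] km k by simp
      show "\<And>e i. e \<in> set_pmf (dependent_edges {1..n} {1..m} k) \<Longrightarrow> e i \<subseteq> {1..n}"
        by (auto simp: dependent_edges_def)
      have "16 / \<epsilon>\<^sub>0 \<le> exp (l / 2)" using exp_ge_add_one_self[of "l / 2"] l by linarith
      moreover have "4 \<le> \<epsilon>\<^sub>0 * m"
      proof -
        have "4 / \<epsilon>\<^sub>0 \<le> 32 / \<epsilon>\<^sub>0" using \<epsilon> by (intro divide_right_mono) auto
        also have "\<dots> \<le> exp l" using exp_ge_add_one_self[of l] l by linarith
        also have "exp l \<le> m / 1" unfolding el using n by (intro divide_left_mono) auto
        finally show ?thesis using \<epsilon> by (simp add: field_simps)
      qed
      ultimately show "measure_pmf.prob (dependent_edges {1..n} {1..m} k) {e. \<exists>\<psi>\<in>colourings {1..n}. \<forall>i\<in>{1..m}. 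
          \<bar>real_of_int (\<Sum>v\<in>e i. \<psi> v)\<bar> < ?lo} \<le> exp (- real n) + exp (- real n / 12)"
        using prob_dependent_edges_low_disc_le[of "{1..n}" k \<epsilon>\<^sub>0 m] n p \<epsilon> l \<mu> k k' by (simp add: l_def)
    qed
  qed
  let ?D = "\<lambda>e. real_of_int (disc (hypergraph_of n m e))"
  have high: "measure_pmf.prob P {e. \<not> ?D e \<le> ?hi} \<le> 1 / n"
    unfolding l_def
  proof (rule prob_high_disc_le[of P n m p])
    show "102400 \<le> ln (real m / real n)" "ln (real m / real n) \<le> p * n" using l \<mu>1 by (simp_all add: l_def)
  qed (use P(2,3) n p \<epsilon> in auto)
  have low': "measure_pmf.prob P {e. ?D e < ?lo} \<le> exp (- real n) + exp (- real n / 12)"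
    using disc_hypergraph_of_less[OF m, of n _ ?lo]
    by (intro order.trans[OF measure_pmf.finite_measure_mono low]) auto
  have "1 - measure_pmf.prob P {e. ?lo \<le> ?D e \<and> ?D e \<le> ?hi} = 
      measure_pmf.prob P (- {e. ?lo \<le> ?D e \<and> ?D e \<le> ?hi})"
    using measure_pmf.prob_compl[of _ P] by (simp add: Compl_eq_Diff_UNIV)
  also have "- {e. ?lo \<le> ?D e \<and> ?D e \<le> ?hi} = {e. ?D e < ?lo} \<union> {e. \<not> ?D e \<le> ?hi}" by auto
  also have "measure_pmf.prob P \<dots> \<le> measure_pmf.prob P {e. ?D e < ?lo} + measure_pmf.prob P {e. \<not> ?D e \<le> ?hi}"
    by (rule measure_Un_le) auto
  also have "\<dots> \<le> 1 / n + 12 / n + 1 / n" using low' high exps by linarith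
  also have "\<dots> = 14 / n" by (simp flip: add_divide_distrib)
  finally show ?thesis by (simp add: P(1) vimage_def)
qed

theorem corollary1p4:
  fixes m :: "nat \<Rightarrow> nat" and d :: "nat \<Rightarrow> real" and \<epsilon> \<epsilon>\<^sub>0 :: real
    and H :: "nat \<Rightarrow> nat hypergraph pmf"
  assumes m_pos: "\<And>n. n \<ge> 1 \<Longrightarrow> m n > 0"
    and d_range: "\<And>n. n \<ge> 1 \<Longrightarrow> 0 < d n \<and> d n \<le> real (m n)"
    and model:
      "(\<exists>k :: nat \<Rightarrow> nat. \<forall>n\<ge>1. d n = real (k n) \<and> H n = edge_dependent n (m n) (k n)) \<or>
       (\<forall>n\<ge>1. H n = edge_independent n (m n) (d n / real (m n)))"
    and eps0: "\<epsilon>\<^sub>0 > 0"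
    and p_bound: "\<forall>\<^sub>F n in sequentially. d n / real (m n) \<le> 1 - \<epsilon>\<^sub>0"
    and m_large: "(\<lambda>n. real n / real (m n)) \<longlonglongrightarrow> 0"
    and eps: "\<epsilon> > 0"
    and d_large: "\<forall>\<^sub>F n in sequentially. d n \<ge> (real (m n) / real n) powr (1 + \<epsilon>)"
  shows "\<exists>c C :: real. 0 < c \<and> c < C \<and>
    (\<lambda>n. measure_pmf.prob (H n)
       {h. c * sqrt (d n * real n / real (m n) * ln (real (m n) / real n)) \<le> real_of_int (disc h) \<and>
           real_of_int (disc h) \<le> C * sqrt (d n * real n / real (m n) * ln (real (m n) / real n))})
    \<longlonglongrightarrow> 1"
proof -
  define c where "c = sqrt (\<epsilon>\<^sub>0 / 160) / 8"
  define l where "l = (\<lambda>n. ln (real (m n) / real n))"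
  let ?prob = "\<lambda>n. measure_pmf.prob (H n)
       {h. c * sqrt (d n * real n / real (m n) * l n) \<le> real_of_int (disc h) \<and>
           real_of_int (disc h) \<le> upper_factor * sqrt (d n * real n / real (m n) * l n)}"
  obtain n1 where n1: "n1 \<ge> 1" "d n1 / real (m n1) \<le> 1 - \<epsilon>\<^sub>0"
    using p_bound unfolding eventually_sequentially by (metis nat_le_linear)
  have "\<epsilon>\<^sub>0 \<le> 1" using n1 d_range[OF n1(1)] m_pos[OF n1(1)] 
    by (smt (verit) divide_pos_pos of_nat_0_less_iff)
  have c: "0 < c" "c < upper_factor"
  proof -
    show "0 < c" using eps0 by (simp add: c_def)
    have "sqrt (\<epsilon>\<^sub>0 / 160) \<le> sqrt 1" using \<open>\<epsilon>\<^sub>0 \<le> 1\<close> by (intro real_sqrt_le_mono) auto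
    hence "sqrt (\<epsilon>\<^sub>0 / 160) \<le> 1" by simp
    thus "c < upper_factor" unfolding c_def using upper_factor_ge_one by linarith
  qed
  have l_top: "filterlim l at_top sequentially"
  proof -
    have "filterlim (\<lambda>n. inverse (real n / real (m n))) at_top sequentially"
      using m_large m_pos
      by (intro filterlim_inverse_at_top) (auto simp: eventually_at_top_linorder intro!: exI[of _ 1])
    hence "filterlim (\<lambda>n. real (m n) / real n) at_top sequentially" by simp
    thus ?thesis unfolding l_def by (rule filterlim_compose[OF ln_at_top])
  qed
  have l_ev: "\<forall>\<^sub>F n in sequentially. l n \<ge> K" for K
    using l_top by (simp add: filterlim_at_top)
  have bound: "\<forall>\<^sub>F n in sequentially. 1 - 14 / real n \<le> ?prob n"
    using p_bound d_large l_ev[of 102400] l_ev[of "32 / \<epsilon>\<^sub>0"] l_ev[of "2 / (\<epsilon>\<^sub>0 * \<epsilon>\<^sup>2)"] eventually_ge_at_top[of 1]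
  proof eventually_elim
    case (elim n)
    define p where "p = d n / real (m n)"
    have pos: "real n > 0" "real (m n) > 0" "d n > 0" using elim m_pos[of n] d_range[of n] by auto
    define x where "x = real (m n) / real n"
    have x: "x > 0" using pos by (simp add: x_def)
    \<comment> \<open>\<open>p * n = d / \<lambda> \<ge> \<lambda> powr \<epsilon> = exp (\<epsilon> * l n)\<close>, and the exponential exceeds its quadratic Taylor term.\<close>
    have \<mu>: "l n \<le> \<epsilon>\<^sub>0 * (p * n)"
    proof -
      have "l n = \<epsilon>\<^sub>0 * \<epsilon>\<^sup>2 / 2 * (2 / (\<epsilon>\<^sub>0 * \<epsilon>\<^sup>2)) * l n" using eps eps0 by simp
      also have "\<dots> \<le> \<epsilon>\<^sub>0 * \<epsilon>\<^sup>2 / 2 * l n * l n"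
        using elim eps eps0 by (intro mult_right_mono mult_left_mono) auto
      also have "\<dots> = \<epsilon>\<^sub>0 * ((\<epsilon> * l n)\<^sup>2 / 2)" by (simp add: power2_eq_square)
      also have "\<dots> \<le> \<epsilon>\<^sub>0 * exp (\<epsilon> * l n)"
      proof (intro mult_left_mono)
        have "0 \<le> \<epsilon> * l n" using elim eps by simp
        thus "(\<epsilon> * l n)\<^sup>2 / 2 \<le> exp (\<epsilon> * l n)" using exp_lower_Taylor_quadratic[of "\<epsilon> * l n"] by linarith
      qed (use eps0 in auto)
      also have "exp (\<epsilon> * l n) = x powr (1 + \<epsilon>) / x"
        using x by (simp add: powr_def l_def x_def[symmetric] exp_add algebra_simps)
      also have "\<dots> \<le> d n / x" using elim x by (intro divide_right_mono) (auto simp: x_def)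
      also have "d n / x = p * n" using pos by (simp add: p_def x_def)
      finally show ?thesis using eps0 by simp
    qed
    have "H n = edge_independent n (m n) p \<or> (\<exists>k. H n = edge_dependent n (m n) k \<and> p = k / m n)"
      using model elim(6) unfolding p_def by metis
    from prob_disc_in_range[OF this, of \<epsilon>\<^sub>0] elim pos eps0 \<mu>
    have "1 - 14 / real n \<le> measure_pmf.prob (H n) {h. sqrt (\<epsilon>\<^sub>0 / 160) / 8 * sqrt (p * n * l n) \<le> real_of_int (disc h) \<and>
      real_of_int (disc h) \<le> upper_factor * sqrt (p * n * l n)}"
      by (simp add: p_def l_def)
    also have "p * n * l n = d n * real n / real (m n) * l n" by (simp add: p_def)
    finally show ?case by (simp add: c_def)
  qed
  have "(\<lambda>n. 1 - 14 / real n) \<longlonglongrightarrow> 1"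
  proof -
    have "(\<lambda>n. 1 - 14 * (1 / real n)) \<longlonglongrightarrow> 1 - 14 * 0"
      by (intro tendsto_diff tendsto_mult tendsto_const lim_1_over_n)
    thus ?thesis by simp
  qed
  from tendsto_sandwich[OF bound _ this tendsto_const] have "?prob \<longlonglongrightarrow> 1" by simp
  hence "(\<lambda>n. measure_pmf.prob (H n)
       {h. c * sqrt (d n * real n / real (m n) * ln (real (m n) / real n)) \<le> real_of_int (disc h) \<and>
           real_of_int (disc h) \<le> upper_factor * sqrt (d n * real n / real (m n) * ln (real (m n) / real n))})
    \<longlonglongrightarrow> 1"
    unfolding l_def .
  with c show ?thesis by (intro exI[of _ c] exI[of _ upper_factor] conjI)
qed

end
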